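(* Let $\tau(\lambda,p)$, $\tau_0(\lambda,p)$ and $\lambda_p^*$ be the quantities attached to the model $X\sim P\in\mathcal{E}(O,\Lambda)$ as defined in the context, with $p$ ranging over the integers $p\ge 2$. Then: (1) For fixed $\lambda>1$, the function $p\mapsto\tau(\lambda,p)$ is strictly decreasing and satisfies $\tau(\lambda,p)=\lambda^2/p+o(1/p)$ as $p\to\infty$. (2) For fixed $\lambda>1$, the function $p\mapsto\tau_0(\lambda,p)$ is strictly decreasing and satisfies $\tau_0(\lambda,p)=1/p+o(1/p)$ as $p\to\infty$. (3) For fixed $p$, the function $\lambda\mapsto\tau(\lambda,p)$ is strictly increasing and satisfies $\tau(\lambda,p)=1+o(1)$ as $\lambda\to\infty$. (4) The function $p\mapsto\lambda_p^*$ is strictly increasing and, for all $\varepsilon>0$, satisfies $p^{\frac12-\varepsilon}<\lambda_p^*<p^{\frac12+\varepsilon}$ for all $p$ large enough. (5) There exists a unique $C>0$ such that $\tau(Cp^{1/2},p)\to 1/2$ as $p\to\infty$, and its approximate value is $C\approx 1.634$ (rounded to three decimals).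
   Context: Let $p\ge 2$ be an integer. $\|\cdot\|$ is the Euclidean norm and $'$ denotes transpose. $\mathcal{O}^p$ is the set of $p\times p$ orthogonal matrices. $\mathcal{D}_1^p=\{\sigma\,\mathrm{diag}(\lambda,1,\ldots,1)\mid \sigma>0,\ \lambda>1\}$ (diagonal $p\times p$ matrices). For fixed $O\in\mathcal{O}^p$ and $\Lambda\in\mathcal{D}_1^p$, a probability distribution $P$ on $\mathbb{R}^p$ belongs to $\mathcal{E}(O,\Lambda)$ if $X\sim P$ admits the representation $X=O\Lambda Z$ for some random $p$-vector $Z$ such that: (1) $Z$ is spherical, i.e. $VZ$ has the same distribution as $Z$ for every $V\in\mathcal{O}^p$; (2) $R:=\|Z\|$ admits a density $f_R:(0,\infty)\to(0,\infty)$ with respect to Lebesgue measure; (3) $r\mapsto f_R(r)/r^{p-1}$ is strictly decreasing on $(0,\infty)$; (4) $\mathrm{E}(R)<\infty$. For $X\sim P\in\mathcal{E}(O,\Lambda)$ with $\Lambda=\sigma\,\mathrm{diag}(\lambda,1,\ldots,1)$, let $S_P=\mathrm{E}(XX'/\|X\|^2)$ be the spatial sign covariance matrix. Its largest eigenvalue depends on $P$ only through $(\lambda,p)$ and is denoted $\tau(\lambda,p):=\phi_1(S_P)$; it has the integral representation $\tau(\lambda,p)=\frac{\lambda^2}{2}\int_0^\infty(1+\lambda^2x)^{-3/2}(1+x)^{(1-p)/2}\,dx$. The remaining $p-1$ eigenvalues of $S_P$ all equal $\tau_0(\lambda,p):=\{1-\tau(\lambda,p)\}/(p-1)$. For fixed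 $p$, $\lambda_p^*$ denotes the unique root of $\lambda\mapsto\tau(\lambda,p)-1/2$ on $[1,\infty)$, where $\tau(1,p)=1/p$ is the value at $\lambda=1$ of the same integral formula. *)

theory Defs
  imports "HOL-Probability.Probability" "Jordan_Normal_Form.Spectral_Radius"
begin

unbundle no vec_syntax and no inner_syntax

text \<open>The dimension \<open>p\<close> varies within the statement, so points of \<open>p\<close>-space are vectors in
  \<open>carrier_vec p\<close>. They carry the sigma-algebra pulled back along the coordinate map, i.e. the
  usual Borel sigma-algebra.\<close>

definition Rvec :: "nat \<Rightarrow> real Matrix.vec measure" where
  "Rvec p = vimage_algebra (carrier_vec p) (\<lambda>v. \<lambda>i\<in>{..<p}. v $ i) (Pi\<^sub>M {..<p} (\<lambda>_. borel))"

definition eucl_norm :: "real Matrix.vec \<Rightarrow> real" where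
  "eucl_norm v = sqrt (v \<bullet> v)"

definition orthogonal_mats :: "nat \<Rightarrow> real Matrix.mat set" where
  "orthogonal_mats p = {V \<in> carrier_mat p p. V * V\<^sup>T = 1\<^sub>m p \<and> V\<^sup>T * V = 1\<^sub>m p}"

definition Lambda_mat :: "nat \<Rightarrow> real \<Rightarrow> real \<Rightarrow> real Matrix.mat" where
  "Lambda_mat p \<sigma> l = \<sigma> \<cdot>\<^sub>m mat_diag p (\<lambda>i. if i = 0 then l else 1)"

text \<open>The random vectors \<open>X\<close> and \<open>Z\<close> enter only through their laws \<open>P\<close> and \<open>Q\<close>.
  Only the values of the radial density \<open>f\<close> on the positive half-line matter.\<close>

definition spherical :: "nat \<Rightarrow> real Matrix.vec measure \<Rightarrow> bool" where
  "spherical p Q \<longleftrightarrow>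
     (\<forall>V\<in>orthogonal_mats p. distr Q (Rvec p) (\<lambda>z. V *\<^sub>v z) = Q)"

definition elliptical ::
    "nat \<Rightarrow> real Matrix.mat \<Rightarrow> real Matrix.mat \<Rightarrow> real Matrix.vec measure set" where
  "elliptical p U L = {P. \<exists>Q.
     prob_space Q \<and> sets Q = sets (Rvec p) \<and>
     P = distr Q (Rvec p) (\<lambda>z. (U * L) *\<^sub>v z) \<and>
     spherical p Q \<and>
     (\<exists>f. (\<forall>r>0. f r > 0) \<and>
          distributed Q lborel eucl_norm (\<lambda>r. ennreal (indicator {0<..} r * f r)) \<and>
          strict_antimono_on {0<..} (\<lambda>r. f r / r ^ (p - 1))) \<and>
     integrable Q eucl_norm}"

definition sign_cov :: "nat \<Rightarrow> real Matrix.vec measure \<Rightarrow> real Matrix.mat" where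
  "sign_cov p P = Matrix.mat p p (\<lambda>(i, j). \<integral>x. x $ i * x $ j / (eucl_norm x)\<^sup>2 \<partial>P)"

definition largest_eigenvalue :: "real Matrix.mat \<Rightarrow> real" where
  "largest_eigenvalue A = Max (spectrum A)"

definition tau_integral :: "real \<Rightarrow> nat \<Rightarrow> real" where
  "tau_integral l p = l\<^sup>2 / 2 *
     (LBINT x:{0<..}. (1 + l\<^sup>2 * x) powr (- 3 / 2) * (1 + x) powr ((1 - real p) / 2))"

text \<open>For \<open>l > 1\<close>, \<open>tau l p\<close> is the common value of the largest eigenvalue of the spatial sign
  covariance matrix over all distributions in the model with shape parameter \<open>l\<close>. The value
  \<open>l = 1\<close> is outside the model; there \<open>tau\<close> is extended by the integral formula.\<close>

definition tau :: "real \<Rightarrow> nat \<Rightarrow> real" where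
  "tau l p =
     (if l > 1 then
        THE t. \<forall>U\<in>orthogonal_mats p. \<forall>\<sigma>>0. \<forall>P\<in>elliptical p U (Lambda_mat p \<sigma> l).
                 largest_eigenvalue (sign_cov p P) = t
      else tau_integral l p)"

definition tau0 :: "real \<Rightarrow> nat \<Rightarrow> real" where
  "tau0 l p = (1 - tau l p) / (real p - 1)"

definition lambda_star :: "nat \<Rightarrow> real" where
  "lambda_star p = (THE l. l \<ge> 1 \<and> tau l p - 1 / 2 = 0)"

end

theory Submission
  imports Defs "HOL-Real_Asymp.Real_Asymp"
begin

text \<open>
  The integral formula. Let \<open>Q\<close>, \<open>Q'\<close> be spherical laws without atom at the origin and \<open>z\<close>, \<open>a\<close>
  independent with these laws. Given \<open>a\<close>, the cosine of the angle between \<open>z\<close> and \<open>a\<close> is distributed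
  like \<open>z\<^sub>0 / \<parallel>z\<parallel>\<close>; given \<open>z\<close>, like \<open>a\<^sub>0 / \<parallel>a\<parallel>\<close>. So, by Fubini, the law of
  \<open>z\<^sub>0 / \<parallel>z\<parallel>\<close> is the same for all \<open>Q\<close> and can be computed for the Gaussian law, where
  \<open>1 / A = 1/2 \<integral> exp (- t A / 2) dt\<close> makes the expectation factorise over the coordinates. Reflections
  show that the sign covariance matrix is diagonal in the basis \<open>U\<close> with all but one entry equal.

  The asymptotics. The remaining eigenvalue also has an integral representation, with an integrand
  which is decreasing in \<open>l\<close> and in \<open>p\<close>. Substituting \<open>x = y / p\<close> and letting \<open>p\<close> tend to infinity,
  \<open>1 - tau (C \<surd>p) p\<close> tends to \<open>1/2 \<integral> (1 + C\<^sup>2 y) powr (-1/2) exp (- y / 2) dy = a M a\<close>, where \<open>a = 1 / C\<close>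
  and \<open>M\<close> is the Mills ratio of the normal law; the constant is the root of \<open>a M a = 1 / 2\<close>.
\<close>

section \<open>Integrals over the half-line\<close>

text \<open>\<open>tau\<close> is a definite description over the whole model, so two facts must
  precede the integral formula: all members give the same largest eigenvalue, and there is at least
  one member. The Gaussian law serves for both, as the law for which the value is computed and as
  the witness. Because the dimension is a number and not a type, its orthogonal invariance is traced
  back to Lebesgue measure on coordinate vectors, characterised here by translations and balls; the
  volume of balls also yields the radial density that membership demands. In the analysis the
  obstacle is the factor l^2 in front of \<open>tau_integral\<close>: the integral falls as l grows
  while the factor rises. The trace of the matrix is 1, and passing to the other eigenvalue removes
  the factor. In p the roles are reversed: the factor p - 1 of the trace identity would spoil the
  argument, so both integrals are compared pointwise. For the constant, strict monotonicity reduces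
  three correct decimals to two rational inequalities, at 1.6335 and 1.6345.\<close>

lemma halfline_FTC:
  fixes f F :: "real \<Rightarrow> real"
  assumes [measurable]: "f \<in> borel_measurable borel"
    and der: "\<And>x. 0 \<le> x \<Longrightarrow> (F has_real_derivative f x) (at x)"
    and nonneg: "\<And>x. 0 \<le> x \<Longrightarrow> 0 \<le> f x"
    and lim: "(F \<longlongrightarrow> T) at_top"
  shows "set_integrable lborel {0<..} f" and "(LBINT x:{0<..}. f x) = T - F 0"
proof -
  have mono: "F 0 \<le> F x" if "0 \<le> x" for x
    using that der nonneg by (intro DERIV_nonneg_imp_nondecreasing[of 0 x F]) (auto intro: order_trans)
  have le: "F 0 \<le> T"
    by (rule tendsto_lowerbound[OF lim])
       (use mono in \<open>auto intro!: eventually_mono[OF eventually_ge_at_top[of 0]]\<close>)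
  have "(\<integral>\<^sup>+x. ennreal (indicator {0<..} x *\<^sub>R f x) \<partial>lborel)
      = (\<integral>\<^sup>+x. ennreal (f x) * indicator {0..} x \<partial>lborel)"
  proof (rule nn_integral_cong_AE)
    have "AE x in lborel. x \<noteq> (0::real)"
      by (rule AE_lborel_singleton)
    thus "AE x in lborel. ennreal (indicator {0<..} x *\<^sub>R f x) = ennreal (f x) * indicator {0..} x"
      by eventually_elim (auto simp: indicator_def)
  qed
  also have "\<dots> = ennreal (T - F 0)"
    using nn_integral_FTC_atLeast[of f 0 F T] assms by auto
  finally have nn: "(\<integral>\<^sup>+x. ennreal (indicator {0<..} x *\<^sub>R f x) \<partial>lborel) = ennreal (T - F 0)" .
  have "has_bochner_integral lborel (\<lambda>x. indicator {0<..} x *\<^sub>R f x) (T - F 0)"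
    by (rule has_bochner_integral_nn_integral)
       (use nn nonneg le in \<open>auto simp: indicator_def\<close>)
  thus "set_integrable lborel {0<..} f" "(LBINT x:{0<..}. f x) = T - F 0"
    unfolding set_integrable_def set_lebesgue_integral_def
    by (auto simp: has_bochner_integral_iff)
qed

text \<open>Equal integrals would force the difference \<open>g - f\<close> to vanish almost
  everywhere, yet it is positive on \<open>{0<..1}\<close>, a set of measure 1.\<close>

lemma set_integral_halfline_less:
  fixes f g :: "real \<Rightarrow> real"
  assumes f: "set_integrable lborel {0<..} f" and g: "set_integrable lborel {0<..} g"
    and less: "\<And>x. 0 < x \<Longrightarrow> f x < g x"
  shows "(LBINT x:{0<..}. f x) < (LBINT x:{0<..}. g x)"
proof -
  let ?d = "\<lambda>x. indicator {0<..} x *\<^sub>R (g x - f x)"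
  have int: "integrable lborel ?d"
    using set_integral_diff(1)[OF g f] by (simp add: set_integrable_def)
  have nonneg: "AE x in lborel. 0 \<le> ?d x"
    using less by (auto simp: indicator_def less_imp_le)
  have "integral\<^sup>L lborel ?d \<noteq> 0"
  proof
    assume "integral\<^sup>L lborel ?d = 0"
    hence "AE x in lborel. ?d x = 0"
      using integral_nonneg_eq_0_iff_AE[OF int nonneg] by simp
    hence "AE x in lborel. x \<notin> {0<..1::real}"
      by eventually_elim (use less in \<open>force simp: indicator_def\<close>)
    hence "emeasure lborel {0<..1::real} = 0"
      by (subst (asm) AE_iff_measurable[of "{0<..1}"]) auto
    thus False by simp
  qed
  moreover have "0 \<le> integral\<^sup>L lborel ?d"
    by (rule integral_nonneg_AE[OF nonneg])
  ultimately have "0 < (LBINT x:{0<..}. g x - f x)"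
    by (simp add: set_lebesgue_integral_def)
  thus ?thesis
    using set_integral_diff(2)[OF g f] by simp
qed

lemma set_integrable_halfline_bound:
  fixes f g :: "real \<Rightarrow> real"
  assumes g: "set_integrable lborel {0<..} g"
    and [measurable]: "f \<in> borel_measurable borel"
    and le: "\<And>x. 0 < x \<Longrightarrow> \<bar>f x\<bar> \<le> g x"
  shows "set_integrable lborel {0<..} f"
  unfolding set_integrable_def
  by (rule Bochner_Integration.integrable_bound[OF g[unfolded set_integrable_def]])
     (use le in \<open>auto simp: indicator_def intro!: AE_I2 intro: order_trans[OF _ abs_ge_self]\<close>)

lemma powr_halfline:
  fixes c s :: real
  assumes "c > 0" "s > 1"
  shows "set_integrable lborel {0<..} (\<lambda>x. (1 + c * x) powr (- s))"
    and "(LBINT x:{0<..}. (1 + c * x) powr (- s)) = 1 / (c * (s - 1))"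
proof -
  let ?F = "\<lambda>x. - ((1 + c * x) powr (1 - s)) / (c * (s - 1))"
  have der: "(?F has_real_derivative (1 + c * x) powr (- s)) (at x)" if "0 \<le> x" for x
  proof -
    have "0 < 1 + c * x" using that assms by (simp add: add_pos_nonneg)
    moreover have "1 - s - 1 = - s" "- ((1 - s) * (c * y) / (c * (s - 1))) = y" for y
      using assms by (auto simp: field_simps)
    ultimately show ?thesis using assms
      by (auto intro!: derivative_eq_intros)
  qed
  have lim: "(?F \<longlongrightarrow> 0) at_top"
    using assms by real_asymp
  note halfline_FTC[of "\<lambda>x. (1 + c * x) powr (- s)" ?F 0, OF _ der _ lim]
  from this[simplified] show "set_integrable lborel {0<..} (\<lambda>x. (1 + c * x) powr (- s))"
    and "(LBINT x:{0<..}. (1 + c * x) powr (- s)) = 1 / (c * (s - 1))"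
    using assms by auto
qed

text \<open>This is what the Gaussian calculation gives for a coordinate of unit scale: its second
  moment contributes (1 + x) to the power -3/2, the p - 2 other unit coordinates contribute -1/2
  each, and coordinate 0 contributes the factor with l. The identification with the eigenvalue is
  made through the trace.\<close>

definition tau0_integral :: "real \<Rightarrow> nat \<Rightarrow> real" where
  "tau0_integral l p =
     (LBINT x:{0<..}. (1 + l\<^sup>2 * x) powr (- 1 / 2) * (1 + x) powr (- (real p + 1) / 2)) / 2"

lemma powr_neg_le_one: "1 \<le> x \<Longrightarrow> s \<ge> 0 \<Longrightarrow> x powr (- s) \<le> (1::real)"
  by (simp add: powr_minus ge_one_powr_ge_zero inverse_le_1_iff)

lemma tau0_integrable:
  assumes "p \<ge> 2"
  shows "set_integrable lborel {0<..} (\<lambda>x. (1 + l\<^sup>2 * x) powr (- 1 / 2) * (1 + x) powr (- (real p + 1) / 2))"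
\<comment> \<open>The exponent 3/2 is the value of (p + 1) / 2 at p = 2, the slowest decay that
  occurs; the factor with l is at most 1.\<close>
proof (rule set_integrable_halfline_bound[OF powr_halfline(1)[of 1 "3/2"]])
  fix x :: real assume x: "0 < x"
  have "(1 + l\<^sup>2 * x) powr (- (1 / 2)) \<le> 1"
    by (rule powr_neg_le_one) (use x in auto)
  moreover have "(1 + x) powr (- (real p + 1) / 2) \<le> (1 + x) powr (- (3/2))"
    by (rule powr_mono) (use x assms in auto)
  ultimately show "\<bar>(1 + l\<^sup>2 * x) powr (- 1 / 2) * (1 + x) powr (- (real p + 1) / 2)\<bar> \<le> (1 + 1 * x) powr - (3 / 2)"
    using mult_mono[of "(1 + l\<^sup>2 * x) powr (- (1 / 2))" 1 "(1 + x) powr (- (real p + 1) / 2)" "(1 + x) powr (- (3/2))"]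
    by (simp add: abs_mult)
qed auto

text \<open>The two integrands, weighted with the multiplicities 1 and p - 1 of the eigenvalues, add
  up to the derivative of the product \<open>?F\<close>, which rises from -1 at 0 to 0 at infinity.
  This is the analytic form of trace = 1. Integrability of the first integrand comes along by
  subtraction.\<close>

lemma tau_add_tau0_integral:
  assumes "p \<ge> 2" "l > 0"
  shows "set_integrable lborel {0<..} (\<lambda>x. (1 + l\<^sup>2 * x) powr (- 3 / 2) * (1 + x) powr ((1 - real p) / 2))"
    and "tau_integral l p + (real p - 1) * tau0_integral l p = 1"
proof -
  let ?g' = "\<lambda>x. (1 + l\<^sup>2 * x) powr (- 3 / 2) * (1 + x) powr ((1 - real p) / 2)"
  let ?h = "\<lambda>x. (1 + l\<^sup>2 * x) powr (- 1 / 2) * (1 + x) powr (- (real p + 1) / 2)"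
  let ?F = "\<lambda>x. - ((1 + l\<^sup>2 * x) powr (- 1 / 2) * (1 + x) powr ((1 - real p) / 2))"
  let ?f = "\<lambda>x. l\<^sup>2 / 2 * ?g' x + (real p - 1) / 2 * ?h x"
  have der: "(?F has_real_derivative ?f x) (at x)" if "0 \<le> x" for x
  proof -
    have pos: "0 < 1 + l\<^sup>2 * x" "0 < 1 + x" using that assms by (auto simp: add_pos_nonneg)
    have e: "(1 - real p) / 2 - 1 = - (real p + 1) / 2" "- 1 / 2 - 1 = (- 3 / 2 :: real)" by (auto simp: field_simps)
    show ?thesis
      by (rule derivative_eq_intros refl pos)+ (use pos in \<open>simp add: e[simplified] algebra_simps diff_divide_distrib add_divide_distrib\<close>)
  qed
  have lim: "(?F \<longlongrightarrow> 0) at_top"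
  proof -
    have "real p > 1" using assms by simp
    moreover have "l\<^sup>2 > 0" using assms by simp
    ultimately show ?thesis by real_asymp
  qed
  have nonneg: "0 \<le> ?f x" for x using assms by simp
  have int: "set_integrable lborel {0<..} ?f"
    by (rule halfline_FTC(1)[of ?f ?F 0]) (use der nonneg lim in auto)
  have "(LBINT x:{0<..}. ?f x) = 0 - ?F 0"
    by (rule halfline_FTC(2)[of ?f ?F 0]) (use der nonneg lim in auto)
  hence val: "(LBINT x:{0<..}. ?f x) = 1" by simp
  have int0: "set_integrable lborel {0<..} ?h" by (rule tau0_integrable) fact
  have "set_integrable lborel {0<..} (\<lambda>x. (2 / l\<^sup>2) * (?f x - (real p - 1) / 2 * ?h x))"
    by (intro set_integrable_mult_right set_integral_diff int int0)
  thus int1: "set_integrable lborel {0<..} ?g'"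
    using assms by simp
  show "tau_integral l p + (real p - 1) * tau0_integral l p = 1"
    using val int1 int0
    by (subst (asm) set_integral_add) (auto simp: tau_integral_def tau0_integral_def)
qed

section \<open>Monotonicity, limits and continuity of the eigenvalue integrals\<close>

lemma tau0_integral_less_l:
  assumes "p \<ge> 2" "0 \<le> l" "l < m"
  shows "tau0_integral m p < tau0_integral l p"
proof -
  have "(1 + m\<^sup>2 * x) powr (- 1 / 2) * (1 + x) powr (- (real p + 1) / 2)
      < (1 + l\<^sup>2 * x) powr (- 1 / 2) * (1 + x) powr (- (real p + 1) / 2)" if "0 < x" for x
  proof -
    have "l\<^sup>2 < m\<^sup>2" using assms by (intro power_strict_mono) auto
    hence "1 + l\<^sup>2 * x < 1 + m\<^sup>2 * x" using that by simp
    hence "(1 + m\<^sup>2 * x) powr (- 1 / 2) < (1 + l\<^sup>2 * x) powr (- 1 / 2)"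
      using that by (intro powr_less_mono2_neg) (auto simp: add_pos_nonneg)
    thus ?thesis using that by simp
  qed
  thus ?thesis unfolding tau0_integral_def
    by (intro divide_strict_right_mono set_integral_halfline_less tau0_integrable assms) auto
qed

lemma tau0_integral_less_p:
  assumes "p \<ge> 2" "p < q"
  shows "tau0_integral l q < tau0_integral l p"
proof -
  have "(1 + l\<^sup>2 * x) powr (- 1 / 2) * (1 + x) powr (- (real q + 1) / 2)
      < (1 + l\<^sup>2 * x) powr (- 1 / 2) * (1 + x) powr (- (real p + 1) / 2)" if "0 < x" for x
  proof -
    have "(1 + x) powr (- (real q + 1) / 2) < (1 + x) powr (- (real p + 1) / 2)"
      using that assms by (intro powr_less_mono) auto
    moreover have "0 < (1 + l\<^sup>2 * x) powr s" for s
      using that by (simp add: add_pos_nonneg less_imp_neq[symmetric])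
    ultimately show ?thesis by (intro mult_strict_left_mono)
  qed
  thus ?thesis unfolding tau0_integral_def
    using assms by (intro divide_strict_right_mono set_integral_halfline_less tau0_integrable assms) auto
qed

text \<open>In p the integrand itself decreases and the factor in front is constant. The trace
  identity would be inconclusive here, since p - 1 grows while \<open>tau0_integral\<close>
  falls.\<close>

lemma tau_integral_less_p:
  assumes "p \<ge> 2" "p < q" "l > 0"
  shows "tau_integral l q < tau_integral l p"
proof -
  have "(1 + l\<^sup>2 * x) powr (- 3 / 2) * (1 + x) powr ((1 - real q) / 2)
      < (1 + l\<^sup>2 * x) powr (- 3 / 2) * (1 + x) powr ((1 - real p) / 2)" if "0 < x" for x
  proof -
    have "(1 + x) powr ((1 - real q) / 2) < (1 + x) powr ((1 - real p) / 2)"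
      using that assms by (intro powr_less_mono) auto
    moreover have "0 < (1 + l\<^sup>2 * x) powr s" for s
      using that by (simp add: add_pos_nonneg less_imp_neq[symmetric])
    ultimately show ?thesis by (intro mult_strict_left_mono)
  qed
  hence "(LBINT x:{0<..}. (1 + l\<^sup>2 * x) powr (- 3 / 2) * (1 + x) powr ((1 - real q) / 2))
      < (LBINT x:{0<..}. (1 + l\<^sup>2 * x) powr (- 3 / 2) * (1 + x) powr ((1 - real p) / 2))"
    using assms by (intro set_integral_halfline_less tau_add_tau0_integral(1)) auto
  thus ?thesis unfolding tau_integral_def
    using assms by (intro mult_strict_left_mono) auto
qed

lemma tau_integral_eq: "p \<ge> 2 \<Longrightarrow> l > 0 \<Longrightarrow> tau_integral l p = 1 - (real p - 1) * tau0_integral l p"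
  using tau_add_tau0_integral(2)[of p l] by simp

lemma tau_integral_less_l:
  assumes "p \<ge> 2" "0 < l" "l < m"
  shows "tau_integral l p < tau_integral m p"
  using tau0_integral_less_l[of p l m] assms by (simp add: tau_integral_eq)

text \<open>At l = 1 the two powers share their base and merge. The value 1/p is the average of all
  eigenvalues: it is the starting point for the intermediate value theorem and the lower bound that
  makes \<open>tau_integral\<close> the larger of the two eigenvalues.\<close>

lemma tau_integral_one:
  assumes "p \<ge> 2"
  shows "tau_integral 1 p = 1 / real p"
proof -
  have "tau_integral 1 p = 1 / 2 * (LBINT x:{0<..}. (1 + x) powr (- (real p / 2 + 1)))"
    unfolding tau_integral_def
  proof -
    have "- 3 / 2 + (1 - real p) / 2 = - (real p / 2 + 1)" by (simp add: field_simps)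
    hence "(1 + x) powr (- 3 / 2) * (1 + x) powr ((1 - real p) / 2) = (1 + x) powr (- (real p / 2 + 1))" for x :: real
      by (metis powr_add)
    thus "1\<^sup>2 / 2 * (LBINT x:{0<..}. (1 + 1\<^sup>2 * x) powr (- 3 / 2) * (1 + x) powr ((1 - real p) / 2))
      = 1 / 2 * (LBINT x:{0<..}. (1 + x) powr - (real p / 2 + 1))" by (simp only: power_one mult_1)
  qed
  also have "\<dots> = 1 / real p"
    using powr_halfline(2)[of 1 "real p / 2 + 1"] assms by simp
  finally show ?thesis .
qed

text \<open>Dominated convergence: for every x > 0 the factor with l tends to 0, and it never
  exceeds 1, so the factor with p alone is a majorant.\<close>

lemma tau0_integral_tendsto_l: 
  assumes "p \<ge> 2"
  shows "((\<lambda>l. tau0_integral l p) \<longlongrightarrow> 0) at_top"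
proof -
  have "((\<lambda>l. LBINT x. indicator {0<..} x *\<^sub>R ((1 + l\<^sup>2 * x) powr (- 1 / 2) * (1 + x) powr (- (real p + 1) / 2)))
         \<longlongrightarrow> (LBINT x::real. (0::real))) at_top"
  proof (rule integral_dominated_convergence_at_top[where w="\<lambda>x. indicator {0<..} x *\<^sub>R (1 + x) powr (- (real p + 1) / 2)"])
    show "integrable lborel (\<lambda>x::real. indicator {0<..} x *\<^sub>R (1 + x) powr (- (real p + 1) / 2))"
      using powr_halfline(1)[of 1 "(real p + 1) / 2"] assms
      unfolding set_integrable_def minus_divide_left[symmetric] by simp
    show "AE x in lborel. ((\<lambda>l. indicator {0<..} x *\<^sub>R ((1 + l\<^sup>2 * x) powr (- 1 / 2) * (1 + x) powr (- (real p + 1) / 2))) \<longlongrightarrow> 0) at_top"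
    proof (rule AE_I2)
      fix x :: real
      show "((\<lambda>l. indicator {0<..} x *\<^sub>R ((1 + l\<^sup>2 * x) powr (- 1 / 2) * (1 + x) powr (- (real p + 1) / 2))) \<longlongrightarrow> 0) at_top"
      proof (cases "x > 0")
        case True
        have "((\<lambda>l. (1 + l\<^sup>2 * x) powr (- 1 / 2)) \<longlongrightarrow> 0) at_top"
          using True by real_asymp
        thus ?thesis using True by (auto intro!: tendsto_mult_left_zero)
      qed auto
    qed
    show "\<forall>\<^sub>F l in at_top. AE x in lborel. norm (indicator {0<..} x *\<^sub>R ((1 + l\<^sup>2 * x) powr (- 1 / 2) * (1 + x) powr (- (real p + 1) / 2)))
       \<le> indicator {0<..} x *\<^sub>R (1 + x) powr (- (real p + 1) / 2)"
    proof (intro always_eventually allI AE_I2)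
      fix l x :: real
      have "(1 + l\<^sup>2 * x) powr (- (1 / 2)) \<le> 1" if "x > 0"
        by (rule powr_neg_le_one) (use that in auto)
      thus "norm (indicator {0<..} x *\<^sub>R ((1 + l\<^sup>2 * x) powr (- 1 / 2) * (1 + x) powr (- (real p + 1) / 2)))
       \<le> indicator {0<..} x *\<^sub>R (1 + x) powr (- (real p + 1) / 2)"
        by (auto simp: indicator_def abs_mult intro!: mult_left_le_one_le)
    qed
  qed auto
  thus ?thesis
    unfolding tau0_integral_def set_lebesgue_integral_def by (auto intro: tendsto_divide_zero)
qed

lemma tau_integral_tendsto_l: 
  assumes "p \<ge> 2"
  shows "((\<lambda>l. tau_integral l p) \<longlongrightarrow> 1) at_top"
proof -
  have "((\<lambda>l. 1 - (real p - 1) * tau0_integral l p) \<longlongrightarrow> 1 - (real p - 1) * 0) at_top"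
    by (intro tendsto_intros tau0_integral_tendsto_l assms)
  moreover have "\<forall>\<^sub>F l in at_top. 1 - (real p - 1) * tau0_integral l p = tau_integral l p"
    by (rule eventually_mono[OF eventually_gt_at_top[of 0]]) (simp add: tau_integral_eq assms)
  ultimately show ?thesis by (auto dest: Lim_transform_eventually)
qed

text \<open>Continuity is tested along sequences so that dominated convergence applies; the
  majorant, the factor with p alone, is the same for every l.\<close>

lemma continuous_on_tau_integral:
  assumes "p \<ge> 2"
  shows "continuous_on {1..} (\<lambda>l. tau_integral l p)"
proof -
  have "continuous_on {1..} (\<lambda>l. tau0_integral l p)"
    unfolding continuous_on_sequentially
  proof safe
    fix X and m :: real assume X: "X \<longlonglongrightarrow> m" and m: "1 \<le> m"
    have "(\<lambda>n. LBINT x. indicator {0<..} x *\<^sub>R ((1 + (X n)\<^sup>2 * x) powr (- 1 / 2) * (1 + x) powr (- (real p + 1) / 2)))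
         \<longlonglongrightarrow> (LBINT x. indicator {0<..} x *\<^sub>R ((1 + m\<^sup>2 * x) powr (- 1 / 2) * (1 + x) powr (- (real p + 1) / 2)))"
    proof (rule integral_dominated_convergence[where w="\<lambda>x. indicator {0<..} x *\<^sub>R (1 + x) powr (- (real p + 1) / 2)"])
      show "integrable lborel (\<lambda>x::real. indicator {0<..} x *\<^sub>R (1 + x) powr (- (real p + 1) / 2))"
        using powr_halfline(1)[of 1 "(real p + 1) / 2"] assms
        unfolding set_integrable_def minus_divide_left[symmetric] by simp
      show "AE x in lborel. (\<lambda>n. indicator {0<..} x *\<^sub>R ((1 + (X n)\<^sup>2 * x) powr (- 1 / 2) * (1 + x) powr (- (real p + 1) / 2)))
         \<longlonglongrightarrow> indicator {0<..} x *\<^sub>R ((1 + m\<^sup>2 * x) powr (- 1 / 2) * (1 + x) powr (- (real p + 1) / 2))"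
      proof (rule AE_I2)
        fix x :: real
        have "1 + m\<^sup>2 * x \<noteq> 0" if "x > 0" 
          using that by (auto simp: add_pos_nonneg less_imp_neq[symmetric])
        thus "(\<lambda>n. indicator {0<..} x *\<^sub>R ((1 + (X n)\<^sup>2 * x) powr (- 1 / 2) * (1 + x) powr (- (real p + 1) / 2)))
         \<longlonglongrightarrow> indicator {0<..} x *\<^sub>R ((1 + m\<^sup>2 * x) powr (- 1 / 2) * (1 + x) powr (- (real p + 1) / 2))"
          using X by (cases "x > 0") (auto intro!: tendsto_intros)
      qed
      show "AE x in lborel. norm (indicator {0<..} x *\<^sub>R ((1 + (X n)\<^sup>2 * x) powr (- 1 / 2) * (1 + x) powr (- (real p + 1) / 2)))
         \<le> indicator {0<..} x *\<^sub>R (1 + x) powr (- (real p + 1) / 2)" for n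
      proof (intro AE_I2)
        fix x :: real
        have "(1 + (X n)\<^sup>2 * x) powr (- (1 / 2)) \<le> 1" if "x > 0"
          by (rule powr_neg_le_one) (use that in auto)
        thus "norm (indicator {0<..} x *\<^sub>R ((1 + (X n)\<^sup>2 * x) powr (- 1 / 2) * (1 + x) powr (- (real p + 1) / 2)))
         \<le> indicator {0<..} x *\<^sub>R (1 + x) powr (- (real p + 1) / 2)"
          by (auto simp: indicator_def abs_mult intro!: mult_left_le_one_le)
      qed
    qed auto
    thus "((\<lambda>l. tau0_integral l p) \<circ> X) \<longlonglongrightarrow> tau0_integral m p"
      unfolding tau0_integral_def set_lebesgue_integral_def o_def by (auto intro!: tendsto_divide)
  qed
  hence "continuous_on {1..} (\<lambda>l. 1 - (real p - 1) * tau0_integral l p)"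
    by (intro continuous_intros)
  thus ?thesis
    by (rule continuous_on_cong[THEN iffD1, OF refl, rotated]) (use assms in \<open>auto simp: tau_integral_eq\<close>)
qed

text \<open>For large p the mass of the integral sits near x = 0, where the factor with l is close
  to 1. That factor is squeezed between 1 - 3/2 l^2 x and 1, and both bounds lead to power integrals
  with explicit values, so the limit becomes one of rational functions of p.\<close>

lemma tau_integral_asymp:
  assumes "l > 0"
  shows "(\<lambda>p. real p * tau_integral l p) \<longlonglongrightarrow> l\<^sup>2"
proof (rule tendsto_sandwich)
  have int1: "set_integrable lborel {0<..} (\<lambda>x. (1 + x) powr ((1 - real p) / 2))"
    and val1: "(LBINT x:{0<..}. (1 + x) powr ((1 - real p) / 2)) = 2 / (real p - 3)" if "p \<ge> 4" for p
  proof -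
    from that have "real p > 3" by simp
    hence *: "(real p - 1) / 2 > 1" "(1::real) > 0" by auto
    have e: "- ((real p - 1) / 2) = (1 - real p) / 2" by (simp add: field_simps)
    from powr_halfline[OF *(2,1)] *(1) show "set_integrable lborel {0<..} (\<lambda>x. (1 + x) powr ((1 - real p) / 2))"
      "(LBINT x:{0<..}. (1 + x) powr ((1 - real p) / 2)) = 2 / (real p - 3)"
      unfolding e by (simp_all add: field_simps)
  qed
  let ?g' = "\<lambda>p x. (1 + l\<^sup>2 * x) powr (- 3 / 2) * (1 + x) powr ((1 - real p) / 2)"
  have up: "tau_integral l p \<le> l\<^sup>2 / (real p - 3)" if "p \<ge> 4" for p
  proof -
    have "(LBINT x:{0<..}. ?g' p x) \<le> (LBINT x:{0<..}. (1 + x) powr ((1 - real p) / 2))"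
    proof (rule set_integral_mono)
      fix x :: real assume "x \<in> {0<..}"
      hence "(1 + l\<^sup>2 * x) powr (- (3 / 2)) \<le> 1"
        by (intro powr_neg_le_one) auto
      thus "?g' p x \<le> (1 + x) powr ((1 - real p) / 2)"
        by (auto intro!: mult_left_le_one_le)
    next
      show "set_integrable lborel {0<..} (?g' p)" using that assms by (intro tau_add_tau0_integral(1)) auto
      show "set_integrable lborel {0<..} (\<lambda>x. (1 + x) powr ((1 - real p) / 2))" by (rule int1[OF that])
    qed
    hence "tau_integral l p \<le> l\<^sup>2 / 2 * (2 / (real p - 3))"
      unfolding tau_integral_def val1[OF that] by (intro mult_left_mono) auto
    thus ?thesis by simp
  qed
  have low: "l\<^sup>2 / (real p - 3) - 3 * l ^ 4 / ((real p - 3) * (real p - 5)) \<le> tau_integral l p" if "p \<ge> 6" for p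
  proof -
    have e: "(1 + x) powr ((1 - real (p - 2)) / 2) = (1 + x) * (1 + x) powr ((1 - real p) / 2)" if "x > 0" for x
    proof -
      have "(1 - real (p - 2)) / 2 = 1 + (1 - real p) / 2" using \<open>p \<ge> 6\<close> by (simp add: of_nat_diff field_simps)
      thus ?thesis using that by (simp only: powr_add) simp
    qed
    \<comment> \<open>This is (1 - 3/2 l^2 x) times the power for p, with x written as (1 + x) - 1:
      the extra factor 1 + x turns the power for p into the power for p - 2. The value formula then
      needs p - 2 to be at least 4, whence the bound 6.\<close>
    let ?g = "\<lambda>x. (1 + 3/2 * l\<^sup>2) * (1 + x) powr ((1 - real p) / 2) - 3/2 * l\<^sup>2 * (1 + x) powr ((1 - real (p - 2)) / 2)"
    have "(LBINT x:{0<..}. ?g x) \<le> (LBINT x:{0<..}. ?g' p x)"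
    proof (rule set_integral_mono)
      show "set_integrable lborel {0<..} ?g"
        using that by (intro set_integral_diff set_integrable_mult_right int1) auto
      fix x :: real assume "x \<in> {0<..}"
      hence x: "x > 0" by simp
      \<comment> \<open>Bernoulli's inequality for the exponent -3/2, from ln (1 + u) \<le> u and 1
        + v \<le> exp v.\<close>
      have "1 - 3/2 * (l\<^sup>2 * x) \<le> (1 + l\<^sup>2 * x) powr (- 3 / 2)"
      proof -
        have "- 3/2 * (l\<^sup>2 * x) \<le> - 3/2 * ln (1 + l\<^sup>2 * x)"
          using ln_add_one_self_le_self[of "l\<^sup>2 * x"] x by simp
        hence "1 - 3/2 * (l\<^sup>2 * x) \<le> 1 + - 3/2 * ln (1 + l\<^sup>2 * x)" by simp
        also have "\<dots> \<le> exp (- 3/2 * ln (1 + l\<^sup>2 * x))" by (rule exp_ge_add_one_self)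
        also have "\<dots> = (1 + l\<^sup>2 * x) powr (- 3 / 2)"
        proof -
          have "1 + l\<^sup>2 * x > 0" using x by (simp add: add_pos_nonneg)
          thus ?thesis by (simp add: powr_def)
        qed
        finally show ?thesis .
      qed
      hence "(1 - 3/2 * (l\<^sup>2 * x)) * (1 + x) powr ((1 - real p) / 2) \<le> ?g' p x"
        by (intro mult_right_mono) auto
      thus "?g x \<le> ?g' p x"
        unfolding e[OF x] by (simp add: algebra_simps)
    next
      show "set_integrable lborel {0<..} (?g' p)" using that assms by (intro tau_add_tau0_integral(1)) auto
    qed
    moreover have "(LBINT x:{0<..}. ?g x) = (1 + 3/2 * l\<^sup>2) * (2 / (real p - 3)) - 3/2 * l\<^sup>2 * (2 / (real p - 5))"
    proof -
      have "4 \<le> p" "4 \<le> p - 2" using that by auto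
      note p = this
      have "real (p - 2) - 3 = real p - 5" using that by (simp add: of_nat_diff)
      thus ?thesis
        by (subst set_integral_diff)
           (simp_all only: set_integrable_mult_right int1[OF p(1)] int1[OF p(2)] set_integral_mult_right val1[OF p(1)] val1[OF p(2)])
    qed
    ultimately have "l\<^sup>2 / 2 * ((1 + 3/2 * l\<^sup>2) * (2 / (real p - 3)) - 3/2 * l\<^sup>2 * (2 / (real p - 5))) \<le> tau_integral l p"
      unfolding tau_integral_def by (intro mult_left_mono) auto
    moreover have "l\<^sup>2 / 2 * ((1 + 3/2 * l\<^sup>2) * (2 / (real p - 3)) - 3/2 * l\<^sup>2 * (2 / (real p - 5)))
        = l\<^sup>2 / (real p - 3) - 3 * l ^ 4 / ((real p - 3) * (real p - 5))"
    proof -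
      have "real p - 3 \<noteq> 0" "real p - 5 \<noteq> 0" using that by auto
      thus ?thesis by (simp add: divide_simps) (simp add: algebra_simps power2_eq_square power4_eq_xxxx)
    qed
    ultimately show ?thesis by (simp only:)
  qed
  show "\<forall>\<^sub>F p in sequentially. real p * (l\<^sup>2 / (real p - 3) - 3 * l ^ 4 / ((real p - 3) * (real p - 5))) \<le> real p * tau_integral l p"
    by (rule eventually_mono[OF eventually_ge_at_top[of 6]]) (intro mult_left_mono low, auto)
  show "\<forall>\<^sub>F p in sequentially. real p * tau_integral l p \<le> real p * (l\<^sup>2 / (real p - 3))"
    by (rule eventually_mono[OF eventually_ge_at_top[of 4]]) (intro mult_left_mono up, auto)
  show "(\<lambda>p. real p * (l\<^sup>2 / (real p - 3))) \<longlonglongrightarrow> l\<^sup>2" by real_asymp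
  show "(\<lambda>p. real p * (l\<^sup>2 / (real p - 3) - 3 * l ^ 4 / ((real p - 3) * (real p - 5)))) \<longlonglongrightarrow> l\<^sup>2" by real_asymp
qed

lemma tau_integral_tendsto_zero:
  assumes "l > 0"
  shows "(\<lambda>p. tau_integral l p) \<longlonglongrightarrow> 0"
proof (rule Lim_transform_eventually)
  have "(\<lambda>p. 1 / real p * (real p * tau_integral l p)) \<longlonglongrightarrow> 0 * l\<^sup>2"
    by (intro tendsto_mult tau_integral_asymp assms lim_1_over_n)
  thus "(\<lambda>p. 1 / real p * (real p * tau_integral l p)) \<longlonglongrightarrow> 0" by simp
  show "\<forall>\<^sub>F p in sequentially. 1 / real p * (real p * tau_integral l p) = tau_integral l p"
    by (rule eventually_mono[OF eventually_gt_at_top[of 0]]) auto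
qed

lemma tau0_integral_asymp:
  assumes "l > 0"
  shows "(\<lambda>p. real p * tau0_integral l p) \<longlonglongrightarrow> 1"
proof (rule Lim_transform_eventually)
  have "(\<lambda>p. real p / (real p - 1)) \<longlonglongrightarrow> 1" by real_asymp
  hence "(\<lambda>p. real p / (real p - 1) * (1 - tau_integral l p)) \<longlonglongrightarrow> 1 * (1 - 0)"
    by (intro tendsto_intros tau_integral_tendsto_zero assms)
  thus "(\<lambda>p. real p / (real p - 1) * (1 - tau_integral l p)) \<longlonglongrightarrow> 1" by simp
  show "\<forall>\<^sub>F p in sequentially. real p / (real p - 1) * (1 - tau_integral l p) = real p * tau0_integral l p"
    by (rule eventually_mono[OF eventually_ge_at_top[of 2]]) (auto simp: tau_integral_eq assms)
qed

section \<open>The scaling limit for shape parameters of order sqrt p\<close>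

definition limit_integral :: "real \<Rightarrow> real" where
  "limit_integral C = (LBINT y:{0<..}. (1 + C\<^sup>2 * y) powr (- 1 / 2) * exp (- y / 2)) / 2"

lemma exp_halfline: "set_integrable lborel {0<..} (\<lambda>y::real. exp (- y / 2))"
proof (rule halfline_FTC(1)[where F="\<lambda>y. - 2 * exp (- y / 2)" and T=0])
  show "((\<lambda>y::real. - 2 * exp (- y / 2)) \<longlongrightarrow> 0) at_top" by real_asymp
qed (auto intro!: derivative_eq_intros)

lemma limit_integrable:
  "set_integrable lborel {0<..} (\<lambda>y::real. (1 + C\<^sup>2 * y) powr (- 1 / 2) * exp (- y / 2))"
proof (rule set_integrable_halfline_bound[OF exp_halfline])
  fix y :: real assume "0 < y"
  hence "(1 + C\<^sup>2 * y) powr (- (1 / 2)) \<le> 1" by (intro powr_neg_le_one) auto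
  thus "\<bar>(1 + C\<^sup>2 * y) powr (- 1 / 2) * exp (- y / 2)\<bar> \<le> exp (- y / 2)"
    by (auto simp: abs_mult intro!: mult_left_le_one_le)
qed auto

lemma limit_integral_less:
  assumes "0 \<le> C" "C < D"
  shows "limit_integral D < limit_integral C"
proof -
  have "(1 + D\<^sup>2 * x) powr (- 1 / 2) * exp (- x / 2) < (1 + C\<^sup>2 * x) powr (- 1 / 2) * exp (- x / 2)" if "0 < x" for x
  proof -
    have "C\<^sup>2 < D\<^sup>2" using assms by (intro power_strict_mono) auto
    hence "1 + C\<^sup>2 * x < 1 + D\<^sup>2 * x" using that by simp
    hence "(1 + D\<^sup>2 * x) powr (- 1 / 2) < (1 + C\<^sup>2 * x) powr (- 1 / 2)"
      using that by (intro powr_less_mono2_neg) (auto simp: add_pos_nonneg)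
    thus ?thesis by simp
  qed
  thus ?thesis unfolding limit_integral_def
    by (intro divide_strict_right_mono set_integral_halfline_less limit_integrable) auto
qed

lemma tau0_integral_scaled:
  assumes "p > 0"
  shows "real p * tau0_integral (C * sqrt (real p)) p =
    (LBINT y:{0<..}. (1 + C\<^sup>2 * y) powr (- 1 / 2) * (1 + y / real p) powr (- (real p + 1) / 2)) / 2"
proof -
  have "(LBINT y:{0<..}. (1 + C\<^sup>2 * y) powr (- 1 / 2) * (1 + y / real p) powr (- (real p + 1) / 2))
     = real p * (LBINT x. indicator {0<..} (real p * x) *\<^sub>R ((1 + C\<^sup>2 * (real p * x)) powr (- 1 / 2) * (1 + real p * x / real p) powr (- (real p + 1) / 2)))"
    using assms unfolding set_lebesgue_integral_def
    by (subst lborel_integral_real_affine[where t=0 and c="real p"]) auto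
  also have "(\<lambda>x. indicator {0<..} (real p * x) *\<^sub>R ((1 + C\<^sup>2 * (real p * x)) powr (- 1 / 2) * (1 + real p * x / real p) powr (- (real p + 1) / 2)))
     = (\<lambda>x. indicator {0<..} x *\<^sub>R ((1 + (C * sqrt (real p))\<^sup>2 * x) powr (- 1 / 2) * (1 + x) powr (- (real p + 1) / 2)))"
    using assms by (auto simp: fun_eq_iff indicator_def power_mult_distrib zero_less_mult_iff mult.assoc)
  finally show ?thesis
    by (simp add: tau0_integral_def set_lebesgue_integral_def)
qed

text \<open>Concavity of ln makes (1 + y/p)^p increasing in p, so the power at p = 4 dominates all
  later ones; the surplus 1 in p + 1 is given away. Starting at 4 yields the exponent -2, hence an
  integrable majorant that does not depend on p.\<close>

lemma powr_dominated:
  assumes "p \<ge> 4" "y > 0"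
  shows "(1 + y / real p) powr (- (real p + 1) / 2) \<le> (1 + y / 4) powr (- 2)"
proof -
  have "ln (1 + y / 4) \<le> real p / 4 * ln (1 + y / real p)"
  proof -
    \<comment> \<open>With this weight, 1 + y/p is the convex combination of 1 and 1 + y/4, and ln 1
      = 0 removes one term of the concavity inequality.\<close>
    let ?t = "4 / real p"
    have t: "0 \<le> ?t" "?t \<le> 1" using assms by auto
    have "(1 - ?t) * ln 1 + ?t * ln (1 + y / 4) \<le> ln ((1 - ?t) *\<^sub>R 1 + ?t *\<^sub>R (1 + y / 4))"
      by (rule concave_onD[OF ln_concave]) (use t assms in auto)
    also have "(1 - ?t) *\<^sub>R 1 + ?t *\<^sub>R (1 + y / 4) = 1 + y / real p"
      using assms by (simp add: field_simps)
    finally show ?thesis using assms by (simp add: field_simps)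
  qed
  moreover have "real p / 4 * ln (1 + y / real p) \<le> (real p + 1) / 4 * ln (1 + y / real p)"
    using assms by (intro mult_right_mono) auto
  ultimately have "- (real p + 1) / 2 * ln (1 + y / real p) \<le> - 2 * ln (1 + y / 4)"
    by (simp add: field_simps)
  moreover have "1 + y / real p > 0" "1 + y / 4 > 0" using assms by (auto intro: add_pos_pos)
  ultimately show ?thesis by (simp add: powr_def)
qed

lemma tau0_integral_scaled_tendsto:
  shows "(\<lambda>p. real p * tau0_integral (C * sqrt (real p)) p) \<longlonglongrightarrow> limit_integral C"
proof -
  let ?w = "\<lambda>x::real. indicator {0<..} x *\<^sub>R (1 + 1/4 * x) powr - 2"
  let ?s = "\<lambda>p y. indicator {0<..} y *\<^sub>R ((1 + C\<^sup>2 * y) powr (- 1 / 2) * (1 + y / real p) powr (- (real p + 1) / 2))"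
  \<comment> \<open>The majorant is available only from p = 4 on, so the sequence is shifted by 4
    and shifted back afterwards.\<close>
  have "(\<lambda>p. LBINT y. ?s (p + 4) y) \<longlonglongrightarrow> (LBINT y. indicator {0<..} y *\<^sub>R ((1 + C\<^sup>2 * y) powr (- 1 / 2) * exp (- y / 2)))"
  proof (rule integral_dominated_convergence[where w="?w"])
    show "integrable lborel ?w"
      using powr_halfline(1)[of "1/4" 2] by (simp add: set_integrable_def)
    show "AE y in lborel. (\<lambda>p. ?s (p + 4) y) \<longlonglongrightarrow> indicator {0<..} y *\<^sub>R ((1 + C\<^sup>2 * y) powr (- 1 / 2) * exp (- y / 2))"
    proof (rule AE_I2)
      fix y :: real
      have "(\<lambda>p. (1 + y / real p) powr (- (real p + 1) / 2)) \<longlonglongrightarrow> exp (- y / 2)" if "y > 0"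
        using that by real_asymp
      from LIMSEQ_ignore_initial_segment[OF this, of 4] 
      show "(\<lambda>p. ?s (p + 4) y) \<longlonglongrightarrow> indicator {0<..} y *\<^sub>R ((1 + C\<^sup>2 * y) powr (- 1 / 2) * exp (- y / 2))"
        by (cases "y > 0") (auto intro!: tendsto_intros)
    qed
    show "AE y in lborel. norm (?s (p + 4) y) \<le> ?w y" for p
    proof (rule AE_I2)
      fix y :: real
      show "norm (?s (p + 4) y) \<le> ?w y"
      proof (cases "y > 0")
        case True
        have "(1 + C\<^sup>2 * y) powr (- (1 / 2)) \<le> 1" using True by (intro powr_neg_le_one) auto
        moreover have "(1 + y / real (p + 4)) powr (- (real (p + 4) + 1) / 2) \<le> (1 + y / 4) powr (- 2)"
          using True by (intro powr_dominated) auto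
        ultimately have "(1 + C\<^sup>2 * y) powr (- (1 / 2)) * (1 + y / real (p + 4)) powr (- (real (p + 4) + 1) / 2) \<le> 1 * (1 + y / 4) powr (- 2)"
          by (intro mult_mono) auto
        thus ?thesis using True by (simp add: abs_mult)
      qed auto
    qed
  qed auto
  hence "(\<lambda>p. LBINT y. ?s p y) \<longlonglongrightarrow> (LBINT y. indicator {0<..} y *\<^sub>R ((1 + C\<^sup>2 * y) powr (- 1 / 2) * exp (- y / 2)))"
    by (rule LIMSEQ_offset)
  hence "(\<lambda>p. (LBINT y. ?s p y) / 2) \<longlonglongrightarrow> limit_integral C"
    unfolding limit_integral_def set_lebesgue_integral_def by (intro tendsto_intros) auto
  thus ?thesis
    by (rule Lim_transform_eventually)
       (rule eventually_mono[OF eventually_gt_at_top[of 0]], simp add: tau0_integral_scaled set_lebesgue_integral_def)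
qed

lemma tau_integral_scaled_tendsto:
  assumes "C > 0"
  shows "(\<lambda>p. tau_integral (C * sqrt (real p)) p) \<longlonglongrightarrow> 1 - limit_integral C"
proof (rule Lim_transform_eventually)
  have "(\<lambda>p. (real p - 1) / real p) \<longlonglongrightarrow> 1" by real_asymp
  hence "(\<lambda>p. 1 - (real p - 1) / real p * (real p * tau0_integral (C * sqrt (real p)) p)) \<longlonglongrightarrow> 1 - 1 * limit_integral C"
    by (intro tendsto_intros tau0_integral_scaled_tendsto)
  thus "(\<lambda>p. 1 - (real p - 1) / real p * (real p * tau0_integral (C * sqrt (real p)) p)) \<longlonglongrightarrow> 1 - limit_integral C" by simp
  show "\<forall>\<^sub>F p in sequentially. 1 - (real p - 1) / real p * (real p * tau0_integral (C * sqrt (real p)) p) = tau_integral (C * sqrt (real p)) p"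
    by (rule eventually_mono[OF eventually_ge_at_top[of 2]]) (auto simp: tau_integral_eq assms)
qed

section \<open>The limit integral as a Gaussian tail\<close>

definition gauss_int :: "real \<Rightarrow> real" where
  "gauss_int a = integral {0..a} (\<lambda>s. exp (- s\<^sup>2 / 2))"

lemma gauss_int_zero: "gauss_int 0 = 0"
  by (simp add: gauss_int_def)

lemma has_derivative_gauss_int:
  assumes "a > 0"
  shows "(gauss_int has_real_derivative exp (- a\<^sup>2 / 2)) (at a)"
proof -
  have "((\<lambda>u. integral {0..u} (\<lambda>s. exp (- s\<^sup>2 / 2))) has_real_derivative exp (- a\<^sup>2 / 2)) (at a within {0..a + 1})"
    using assms by (intro integral_has_real_derivative continuous_intros) auto
  hence "((\<lambda>u. integral {0..u} (\<lambda>s. exp (- s\<^sup>2 / 2))) has_real_derivative exp (- a\<^sup>2 / 2)) (at a within {0<..<a + 1})"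
    by (rule DERIV_subset) auto
  thus ?thesis
    unfolding gauss_int_def[abs_def] using assms by (subst (asm) at_within_open) auto
qed

lemma continuous_on_gauss_int: "continuous_on {0..b} gauss_int"
proof -
  have "continuous_on {0..b} (\<lambda>u. integral {0..u} (\<lambda>s::real. exp (- s\<^sup>2 / 2)))"
    by (intro indefinite_integral_continuous_1 integrable_continuous_real continuous_intros) auto
  thus ?thesis unfolding gauss_int_def[abs_def] .
qed

text \<open>The half-line integral of exp (-x^2) is sqrt pi / 2; rescaling x by 1 / sqrt 2 gives the
  weight used here. Consequently \<open>sqrt (pi / 2) - gauss_int a\<close> is the Gaussian tail
  beyond a.\<close>

lemma gauss_int_tendsto: "(gauss_int \<longlongrightarrow> sqrt (pi / 2)) at_top"
proof -
  have "has_bochner_integral lborel (\<lambda>x. indicator {0..} (0 + 1 / sqrt 2 * x) *\<^sub>R exp (- (0 + 1 / sqrt 2 * x)\<^sup>2)) ((sqrt pi / 2) /\<^sub>R \<bar>1 / sqrt 2\<bar>)"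
    by (rule lborel_has_bochner_integral_real_affine_iff[THEN iffD1, OF _ gaussian_moment_0]) auto
  also have "(\<lambda>x. indicator {0..} (0 + 1 / sqrt 2 * x) *\<^sub>R exp (- (0 + 1 / sqrt 2 * x)\<^sup>2)) = (\<lambda>x. indicator {0..} x *\<^sub>R exp (- x\<^sup>2 / 2))"
    by (auto simp: fun_eq_iff indicator_def power_divide zero_le_divide_iff)
  also have "(sqrt pi / 2) /\<^sub>R \<bar>1 / sqrt 2\<bar> = sqrt (pi / 2)"
  proof -
    have "2 = sqrt 2 * sqrt 2" by simp
    thus ?thesis by (simp add: real_sqrt_divide field_simps)
  qed
  finally have b: "has_bochner_integral lborel (\<lambda>x::real. indicator {0..} x *\<^sub>R exp (- x\<^sup>2 / 2)) (sqrt (pi / 2))" .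
  hence "((\<lambda>y. LBINT x. indicator {.. y} x *\<^sub>R (indicator {0..} x *\<^sub>R exp (- x\<^sup>2 / 2))) \<longlongrightarrow> sqrt (pi / 2)) at_top"
    using tendsto_integral_at_top[of lborel "\<lambda>x::real. indicator {0..} x *\<^sub>R exp (- x\<^sup>2 / 2)"]
    by (simp add: has_bochner_integral_iff)
  moreover have "(LBINT x. indicator {.. y} x *\<^sub>R (indicator {0..} x *\<^sub>R exp (- x\<^sup>2 / 2))) = gauss_int y" for y :: real
  proof -
    have "(LBINT x. indicator {.. y} x *\<^sub>R (indicator {0..} x *\<^sub>R exp (- x\<^sup>2 / 2))) = (LBINT x:{0..y}. exp (- x\<^sup>2 / 2))"
      unfolding set_lebesgue_integral_def by (rule Bochner_Integration.integral_cong) (auto simp: indicator_def)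
    also have "\<dots> = gauss_int y"
      unfolding gauss_int_def
      by (intro set_borel_integral_eq_integral(2) borel_integrable_atLeastAtMost' continuous_intros) auto
    finally show ?thesis .
  qed
  ultimately show ?thesis by simp
qed

text \<open>Put u = sqrt (a^2 + y). Then the power becomes a / u, dy is 2 u du, and exp (-y / 2)
  becomes exp (a^2 / 2) exp (-u^2 / 2), so the integral runs over the Gaussian tail from u = a. The
  function \<open>?F\<close> is the corresponding antiderivative in the variable y.\<close>

lemma limit_integral_eq:
  assumes "a > 0"
  shows "limit_integral (1 / a) = a * exp (a\<^sup>2 / 2) * (sqrt (pi / 2) - gauss_int a)"
proof -
  let ?r = "\<lambda>y. sqrt (a\<^sup>2 + y)"
  let ?F = "\<lambda>y. a * exp (a\<^sup>2 / 2) * gauss_int (?r y)"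
  let ?f = "\<lambda>y. (1 + (1 / a)\<^sup>2 * y) powr (- 1 / 2) * exp (- y / 2) / 2"
  have der: "(?F has_real_derivative ?f y) (at y)" if "0 \<le> y" for y
  proof -
    have pos: "a\<^sup>2 + y > 0" using that assms by (simp add: add_pos_nonneg)
    have r: "?r y > 0" using pos by simp
    have e1: "1 + (1 / a)\<^sup>2 * y = (a\<^sup>2 + y) / a\<^sup>2" using assms by (simp add: field_simps)
    have e: "(1 + (1 / a)\<^sup>2 * y) powr (- 1 / 2) = a / ?r y"
    proof -
      have "(1 + (1 / a)\<^sup>2 * y) powr (- 1 / 2) = inverse ((1 + (1 / a)\<^sup>2 * y) powr (1 / 2))"
        by (simp add: powr_minus[symmetric])
      also have "\<dots> = inverse (sqrt ((a\<^sup>2 + y) / a\<^sup>2))"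
        unfolding e1 using pos by (simp add: powr_half_sqrt)
      also have "\<dots> = a / ?r y" using assms by (simp add: real_sqrt_divide)
      finally show ?thesis .
    qed
    have "(?F has_real_derivative a * exp (a\<^sup>2 / 2) * (exp (- (?r y)\<^sup>2 / 2) * (inverse (?r y) / 2 * 1))) (at y)"
      using pos by (intro DERIV_cmult DERIV_chain2[where f=gauss_int and g="?r", OF has_derivative_gauss_int[OF r]])
        (auto intro!: derivative_eq_intros)
    also have "a * exp (a\<^sup>2 / 2) * (exp (- (?r y)\<^sup>2 / 2) * (inverse (?r y) / 2 * 1)) = ?f y"
    proof -
      have "exp (a\<^sup>2 / 2) * exp (- (?r y)\<^sup>2 / 2) = exp (- y / 2)"
        using pos by (simp add: exp_add[symmetric] field_simps del: exp_add)
      thus ?thesis unfolding e by (simp add: field_simps)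
    qed
    finally show ?thesis .
  qed
  have lim: "(?F \<longlongrightarrow> a * exp (a\<^sup>2 / 2) * sqrt (pi / 2)) at_top"
  proof (intro tendsto_intros filterlim_compose[OF gauss_int_tendsto])
    show "filterlim ?r at_top at_top" by real_asymp
  qed
  have "(LBINT y:{0<..}. ?f y) = a * exp (a\<^sup>2 / 2) * sqrt (pi / 2) - ?F 0"
    by (rule halfline_FTC(2)[OF _ der _ lim]) auto
  thus ?thesis using assms
    by (simp add: limit_integral_def algebra_simps set_lebesgue_integral_def)
qed

section \<open>The numerical value of the constant\<close>

text \<open>Both polynomials are truncations of the series \<open>\<Sum> a ^ (2 n + 1) / (2 n + 1)!!\<close> of
  \<open>exp (a\<^sup>2 / 2) * gauss_int a\<close>; the last coefficient of the upper bound is enlarged from 1/105 to 1/90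
  to absorb the tail.\<close>

lemma gauss_int_bounds:
  assumes "0 \<le> a" "a \<le> 1"
  shows "exp (a\<^sup>2 / 2) * gauss_int a \<le> a + a ^ 3 / 3 + a ^ 5 / 15 + a ^ 7 / 90"
    and "a + a ^ 3 / 3 + a ^ 5 / 15 + a ^ 7 / 105 \<le> exp (a\<^sup>2 / 2) * gauss_int a"
proof -
  \<comment> \<open>The function exp (x^2 / 2) \<open>gauss_int\<close> x solves y' = x y + 1 with y
    = 0 at 0. A polynomial with P' - x P \<le> 1 is therefore a subsolution; with the integrating
    factor exp (-x^2 / 2) the comparison becomes monotonicity of a difference. The companion
    \<open>gen'\<close> treats supersolutions.\<close>
  have gen: "gauss_int 0 - exp (- 0\<^sup>2 / 2) * P 0 \<le> gauss_int a - exp (- a\<^sup>2 / 2) * P a"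
    if der: "\<And>x. (P has_real_derivative P' x) (at x)" 
      and le: "\<And>x. 0 \<le> x \<Longrightarrow> x \<le> 1 \<Longrightarrow> P' x - x * P x \<le> 1" for P P' :: "real \<Rightarrow> real"
  proof (rule DERIV_nonneg_imp_increasing_open[OF assms(1)])
    fix x assume x: "0 < x" "x < a"
    show "\<exists>y. ((\<lambda>x. gauss_int x - exp (- x\<^sup>2 / 2) * P x) has_real_derivative y) (at x) \<and> 0 \<le> y"
    proof (intro exI conjI)
      show "((\<lambda>x. gauss_int x - exp (- x\<^sup>2 / 2) * P x) has_real_derivative
        exp (- x\<^sup>2 / 2) * (1 - (P' x - x * P x))) (at x)"
        by (rule has_derivative_gauss_int[OF x(1)] der derivative_eq_intros refl)+
           (use has_derivative_gauss_int[OF x(1)] in \<open>auto simp: algebra_simps intro: der\<close>)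
      show "0 \<le> exp (- x\<^sup>2 / 2) * (1 - (P' x - x * P x))"
        using le[of x] x assms by auto
    qed
  next
    have "continuous_on {0..a} P"
      by (rule DERIV_continuous_on) (rule has_field_derivative_at_within[OF der])
    thus "continuous_on {0..a} (\<lambda>x. gauss_int x - exp (- x\<^sup>2 / 2) * P x)"
      by (intro continuous_intros continuous_on_gauss_int) auto
  qed
  have gen': "exp (- a\<^sup>2 / 2) * P a - gauss_int a \<ge> exp (- 0\<^sup>2 / 2) * P 0 - gauss_int 0"
    if der: "\<And>x. (P has_real_derivative P' x) (at x)" 
      and le: "\<And>x. 0 \<le> x \<Longrightarrow> x \<le> 1 \<Longrightarrow> P' x - x * P x \<ge> 1" for P P' :: "real \<Rightarrow> real"
  proof (rule DERIV_nonneg_imp_increasing_open[OF assms(1)])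
    fix x assume x: "0 < x" "x < a"
    show "\<exists>y. ((\<lambda>x. exp (- x\<^sup>2 / 2) * P x - gauss_int x) has_real_derivative y) (at x) \<and> 0 \<le> y"
    proof (intro exI conjI)
      show "((\<lambda>x. exp (- x\<^sup>2 / 2) * P x - gauss_int x) has_real_derivative
        exp (- x\<^sup>2 / 2) * ((P' x - x * P x) - 1)) (at x)"
        by (rule has_derivative_gauss_int[OF x(1)] der derivative_eq_intros refl)+
           (use has_derivative_gauss_int[OF x(1)] in \<open>auto simp: algebra_simps intro: der\<close>)
      show "0 \<le> exp (- x\<^sup>2 / 2) * ((P' x - x * P x) - 1)"
        using le[of x] x assms by auto
    qed
  next
    have "continuous_on {0..a} P"
      by (rule DERIV_continuous_on) (rule has_field_derivative_at_within[OF der])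
    thus "continuous_on {0..a} (\<lambda>x. exp (- x\<^sup>2 / 2) * P x - gauss_int x)"
      by (intro continuous_intros continuous_on_gauss_int) auto
  qed
  have e: "exp (a\<^sup>2 / 2) * exp (- a\<^sup>2 / 2) = 1" by (simp add: exp_add[symmetric])
  have mult: "exp (a\<^sup>2 / 2) * (exp (- a\<^sup>2 / 2) * y) = y" for y
    using e by (simp add: mult.assoc[symmetric])
  let ?U = "\<lambda>a::real. a + a ^ 3 / 3 + a ^ 5 / 15 + a ^ 7 / 90"
  let ?L = "\<lambda>a::real. a + a ^ 3 / 3 + a ^ 5 / 15 + a ^ 7 / 105"
  have "0 \<le> exp (- a\<^sup>2 / 2) * ?U a - gauss_int a"
  proof -
    have d: "(?U has_real_derivative 1 + x ^ 2 + x ^ 4 / 3 + 7 * x ^ 6 / 90) (at x)" for x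
      by (auto intro!: derivative_eq_intros)
    \<comment> \<open>With 1/105 the coefficient of x^6 would cancel and leave -x^8 / 105, the wrong
      sign for an upper bound. With 1/90 there remains 7/90 - 1/15 = 1/90 at x^6, which beats -x^8 /
      90 as long as x \<le> 1.\<close>
    have eq: "1 + x ^ 2 + x ^ 4 / 3 + 7 * x ^ 6 / 90 - x * ?U x = 1 + x ^ 6 * (1 - x\<^sup>2) / 90" for x :: real
      by (simp add: field_simps power_numeral_reduce)
    moreover have "0 \<le> x ^ 6 * (1 - x\<^sup>2) / 90" if "0 \<le> x" "x \<le> 1" for x :: real
      using that by (simp add: power_le_one)
    ultimately have le: "1 \<le> 1 + x ^ 2 + x ^ 4 / 3 + 7 * x ^ 6 / 90 - x * ?U x" if "0 \<le> x" "x \<le> 1" for x :: real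
      unfolding eq using that by simp
    show ?thesis using gen'[OF d le] by (simp add: gauss_int_zero)
  qed
  hence "gauss_int a \<le> exp (- a\<^sup>2 / 2) * ?U a" by simp
  hence "exp (a\<^sup>2 / 2) * gauss_int a \<le> exp (a\<^sup>2 / 2) * (exp (- a\<^sup>2 / 2) * ?U a)"
    by (intro mult_left_mono) auto
  thus "exp (a\<^sup>2 / 2) * gauss_int a \<le> ?U a" unfolding mult .
  have "0 \<le> gauss_int a - exp (- a\<^sup>2 / 2) * ?L a"
  proof -
    have d: "(?L has_real_derivative 1 + x ^ 2 + x ^ 4 / 3 + x ^ 6 / 15) (at x)" for x
      by (auto intro!: derivative_eq_intros)
    have "1 + x ^ 2 + x ^ 4 / 3 + x ^ 6 / 15 - x * ?L x = 1 - x ^ 8 / 105" for x :: real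
      by (simp add: field_simps power_numeral_reduce)
    thus ?thesis using gen[OF d] by (simp add: gauss_int_zero)
  qed
  hence "exp (- a\<^sup>2 / 2) * ?L a \<le> gauss_int a" by simp
  hence "exp (a\<^sup>2 / 2) * (exp (- a\<^sup>2 / 2) * ?L a) \<le> exp (a\<^sup>2 / 2) * gauss_int a"
    by (intro mult_left_mono) auto
  thus "?L a \<le> exp (a\<^sup>2 / 2) * gauss_int a" unfolding mult .
qed

text \<open>Lagrange's remainder is nonnegative and at most 3 x^6 / 6!, because exp t \<le> exp 1
  \<le> 3; and 3 / 720 = 1 / 240.\<close>

lemma exp_Taylor_bounds:
  fixes x :: real
  assumes "0 \<le> x" "x \<le> 1"
  shows "(\<Sum>m<6. x ^ m / fact m) \<le> exp x" "exp x \<le> (\<Sum>m<6. x ^ m / fact m) + x ^ 6 / 240"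
proof -
  obtain t where t: "\<bar>t\<bar> \<le> \<bar>x\<bar>" "exp x = (\<Sum>m<6. x ^ m / fact m) + exp t / fact 6 * x ^ 6"
    using Maclaurin_exp_le[of x 6] by blast
  have "exp t \<le> exp 1" using t assms by simp
  also have "\<dots> \<le> 3" by (rule exp_le)
  finally have "exp t / fact 6 * x ^ 6 \<le> 3 / fact 6 * x ^ 6"
    using assms by (intro mult_right_mono divide_right_mono) auto
  also have "\<dots> = x ^ 6 / 240" by (simp add: fact_numeral)
  finally show "exp x \<le> (\<Sum>m<6. x ^ m / fact m) + x ^ 6 / 240" using t by simp
  show "(\<Sum>m<6. x ^ m / fact m) \<le> exp x" using t assms by simp
qed

lemma sqrt_pi_half_bounds: "1.25331 \<le> sqrt (pi / 2)" "sqrt (pi / 2) \<le> 1.25332"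
proof -
  have *: "1.25331\<^sup>2 \<le> pi / 2" "pi / 2 \<le> 1.25332\<^sup>2"
    using pi_approx by (auto simp: power2_eq_square)
  show "1.25331 \<le> sqrt (pi / 2)" by (rule real_le_rsqrt[OF *(1)])
  show "sqrt (pi / 2) \<le> 1.25332" by (rule real_le_lsqrt[OF _ *(2)]) simp
qed

text \<open>The two arguments delimit the numbers that round to 1.634, and their reciprocals are
  2000/3267 and 2000/3269. In the closed form the two terms have opposite signs, so a lower bound
  for the value takes lower bounds for exp and sqrt (pi / 2) but the upper polynomial for the
  product with \<open>gauss_int\<close>, and conversely.\<close>

lemma limit_integral_numeric:
  "limit_integral 1.6335 > 1 / 2" "limit_integral 1.6345 < 1 / 2"
proof -
  let ?a = "2000 / 3267 :: real"
  have eq: "limit_integral (1 / ?a) = ?a * (exp (?a\<^sup>2 / 2) * sqrt (pi / 2) - exp (?a\<^sup>2 / 2) * gauss_int ?a)"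
    by (subst limit_integral_eq) (simp, simp only: right_diff_distrib mult.assoc)
  have "(\<Sum>m<6. (?a\<^sup>2 / 2) ^ m / fact m) \<le> exp (?a\<^sup>2 / 2)"
    by (rule exp_Taylor_bounds) (auto simp: power2_eq_square)
  \<comment> \<open>The Taylor sum rounded down to five decimals; in the second half the
    corresponding upper bound is rounded up to 1.20582.\<close>
  hence e: "1.20608 \<le> exp (?a\<^sup>2 / 2)"
    by (simp add: lessThan_nat_numeral fact_numeral power_divide)
  have "1.20608 * 1.25331 - (?a + ?a ^ 3 / 3 + ?a ^ 5 / 15 + ?a ^ 7 / 90) 
      \<le> exp (?a\<^sup>2 / 2) * sqrt (pi / 2) - exp (?a\<^sup>2 / 2) * gauss_int ?a"
    using e sqrt_pi_half_bounds by (intro diff_mono gauss_int_bounds mult_mono) auto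
  hence "?a * (1.20608 * 1.25331 - (?a + ?a ^ 3 / 3 + ?a ^ 5 / 15 + ?a ^ 7 / 90))
      \<le> limit_integral (1 / ?a)"
    unfolding eq by (intro mult_left_mono) auto
  moreover have "1 / 2 < ?a * (1.20608 * 1.25331 - (?a + ?a ^ 3 / 3 + ?a ^ 5 / 15 + ?a ^ 7 / 90))"
    by (simp add: power_divide)
  ultimately show "limit_integral 1.6335 > 1 / 2" by simp
next
  let ?a = "2000 / 3269 :: real"
  have eq: "limit_integral (1 / ?a) = ?a * (exp (?a\<^sup>2 / 2) * sqrt (pi / 2) - exp (?a\<^sup>2 / 2) * gauss_int ?a)"
    by (subst limit_integral_eq) (simp, simp only: right_diff_distrib mult.assoc)
  have "exp (?a\<^sup>2 / 2) \<le> (\<Sum>m<6. (?a\<^sup>2 / 2) ^ m / fact m) + (?a\<^sup>2 / 2) ^ 6 / 240"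
    by (rule exp_Taylor_bounds) (auto simp: power2_eq_square)
  hence e: "exp (?a\<^sup>2 / 2) \<le> 1.20582"
    by (simp add: lessThan_nat_numeral fact_numeral power_divide)
  have "exp (?a\<^sup>2 / 2) * sqrt (pi / 2) - exp (?a\<^sup>2 / 2) * gauss_int ?a 
     \<le> 1.20582 * 1.25332 - (?a + ?a ^ 3 / 3 + ?a ^ 5 / 15 + ?a ^ 7 / 105)"
    using e sqrt_pi_half_bounds by (intro diff_mono gauss_int_bounds mult_mono) auto
  hence "limit_integral (1 / ?a) \<le> ?a * (1.20582 * 1.25332 - (?a + ?a ^ 3 / 3 + ?a ^ 5 / 15 + ?a ^ 7 / 105))"
    unfolding eq by (intro mult_left_mono) auto
  moreover have "?a * (1.20582 * 1.25332 - (?a + ?a ^ 3 / 3 + ?a ^ 5 / 15 + ?a ^ 7 / 105)) < 1 / 2"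
    by (simp add: power_divide)
  ultimately show "limit_integral 1.6345 < 1 / 2" by simp
qed

text \<open>The root is found in the variable a = 1 / C, where the closed form is visibly
  continuous. Uniqueness among all positive D is the strict monotonicity of
  \<open>limit_integral\<close>.\<close>

lemma limit_integral_half:
  obtains C where "\<bar>C - 1.634\<bar> < 0.0005" "\<And>D. 0 < D \<Longrightarrow> limit_integral D = 1 / 2 \<longleftrightarrow> D = C"
proof -
  let ?h = "\<lambda>a. a * exp (a\<^sup>2 / 2) * (sqrt (pi / 2) - gauss_int a)"
  have "continuous_on {0..1} ?h"
    by (intro continuous_intros continuous_on_gauss_int) auto
  hence "continuous_on {1 / 1.6345..1 / 1.6335} ?h"
    by (rule continuous_on_subset) auto
  moreover have "?h (1 / 1.6345) \<le> 1 / 2" "1 / 2 \<le> ?h (1 / 1.6335)"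
    using limit_integral_numeric limit_integral_eq[of "1 / 1.6345"] limit_integral_eq[of "1 / 1.6335"] by simp_all
  ultimately obtain a where a: "1 / 1.6345 \<le> a" "a \<le> 1 / 1.6335" "?h a = 1 / 2"
    using IVT'[of ?h "1 / 1.6345" "1 / 2" "1 / 1.6335"] by auto
  have "a > 0" using a by simp
  hence C: "limit_integral (1 / a) = 1 / 2" using limit_integral_eq[of a] a by simp
  have uniq: "limit_integral D = 1 / 2 \<longleftrightarrow> D = 1 / a" if "0 < D" for D
    using limit_integral_less[of D "1 / a"] limit_integral_less[of "1 / a" D] that \<open>a > 0\<close> C
    by (metis less_irrefl linorder_neqE_linordered_idom less_imp_le zero_less_divide_1_iff)
  have "1 / a \<le> 1.6345" "1.6335 \<le> 1 / a" using a \<open>a > 0\<close> by (auto simp: field_simps)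
  \<comment> \<open>The intermediate value theorem gives only weak bounds. The values at both
    endpoints differ from 1/2, which excludes them and makes the error strictly less than
    0.0005.\<close>
  moreover have "1 / a \<noteq> 1.6345" "1 / a \<noteq> 1.6335"
    using C limit_integral_numeric by (metis less_irrefl)+
  ultimately have "1 / a < 1.6345" "1.6335 < 1 / a" by (auto simp only: less_le)
  hence "\<bar>1 / a - 1.634\<bar> < 0.0005" unfolding abs_less_iff by simp
  thus ?thesis using that uniq by blast
qed

section \<open>Measurability of vector operations\<close>

lemma space_Rvec: "space (Rvec p) = carrier_vec p"
  by (simp add: Rvec_def)

lemma measurable_Rvec_index [measurable (raw)]:
  assumes "i < p" "f \<in> M \<rightarrow>\<^sub>M Rvec p"
  shows "(\<lambda>x. f x $ i) \<in> borel_measurable M"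
proof -
  have "(\<lambda>v. \<lambda>i\<in>{..<p}. v $ i) \<in> Rvec p \<rightarrow>\<^sub>M Pi\<^sub>M {..<p} (\<lambda>_. borel)"
    unfolding Rvec_def by (rule measurable_vimage_algebra1) (auto simp: space_PiM)
  from measurable_compose[OF this measurable_component_singleton[of i]]
  have "(\<lambda>v. (\<lambda>i\<in>{..<p}. v $ i) i) \<in> borel_measurable (Rvec p)"
    using assms(1) by simp
  hence "(\<lambda>v. v $ i) \<in> borel_measurable (Rvec p)"
    using assms(1) by simp
  from measurable_compose[OF assms(2) this] show ?thesis .
qed

lemma measurable_RvecI:
  assumes "\<And>x. x \<in> space M \<Longrightarrow> f x \<in> carrier_vec p"
    and "\<And>i. i < p \<Longrightarrow> (\<lambda>x. f x $ i) \<in> borel_measurable M"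
  shows "f \<in> M \<rightarrow>\<^sub>M Rvec p"
  unfolding Rvec_def
  by (rule measurable_vimage_algebra2) (use assms in \<open>auto intro!: measurable_restrict\<close>)

lemma measurable_Rvec_carrier: "f \<in> M \<rightarrow>\<^sub>M Rvec p \<Longrightarrow> x \<in> space M \<Longrightarrow> f x \<in> carrier_vec p"
  using measurable_space[of f M "Rvec p" x] by (simp add: space_Rvec)

lemma measurable_scalar_prod [measurable (raw)]:
  assumes [measurable]: "f \<in> M \<rightarrow>\<^sub>M Rvec p" "g \<in> M \<rightarrow>\<^sub>M Rvec p"
  shows "(\<lambda>x. f x \<bullet> g x) \<in> borel_measurable M"
proof -
  have "(\<lambda>x. \<Sum>i\<in>{0..<p}. f x $ i * g x $ i) \<in> borel_measurable M"
    by (intro borel_measurable_sum borel_measurable_times measurable_Rvec_index[of _ p]) auto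
  \<comment> \<open>The sum in a scalar product runs up to the dimension of its second argument,
    which formally depends on x; on the space of M it is p.\<close>
  also have "?this \<longleftrightarrow> ?thesis"
    by (intro measurable_cong) (auto simp: scalar_prod_def dest!: measurable_Rvec_carrier[OF assms(2)])
  finally show ?thesis .
qed

lemma measurable_eucl_norm [measurable (raw)]:
  assumes "f \<in> M \<rightarrow>\<^sub>M Rvec p"
  shows "(\<lambda>x. eucl_norm (f x)) \<in> borel_measurable M"
  using measurable_scalar_prod[OF assms assms] unfolding eucl_norm_def by measurable

lemma measurable_vec_add [measurable (raw)]:
  assumes [measurable]: "f \<in> M \<rightarrow>\<^sub>M Rvec p" "g \<in> M \<rightarrow>\<^sub>M Rvec p"
  shows "(\<lambda>x. f x + g x) \<in> M \<rightarrow>\<^sub>M Rvec p"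
proof (rule measurable_RvecI)
  fix i assume i: "i < p"
  have "(\<lambda>x. f x $ i + g x $ i) \<in> borel_measurable M"
    using i by measurable
  also have "?this \<longleftrightarrow> (\<lambda>x. (f x + g x) $ i) \<in> borel_measurable M"
    using i by (intro measurable_cong) (auto dest: measurable_Rvec_carrier[OF assms(2)])
  finally show "(\<lambda>x. (f x + g x) $ i) \<in> borel_measurable M" .
qed (rule add_carrier_vec[OF measurable_Rvec_carrier[OF assms(1)] measurable_Rvec_carrier[OF assms(2)]])

lemma measurable_vec_smult [measurable (raw)]:
  assumes [measurable]: "f \<in> M \<rightarrow>\<^sub>M Rvec p" "g \<in> borel_measurable M"
  shows "(\<lambda>x. g x \<cdot>\<^sub>v f x) \<in> M \<rightarrow>\<^sub>M Rvec p"
proof (rule measurable_RvecI)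
  fix i assume i: "i < p"
  have "(\<lambda>x. g x * f x $ i) \<in> borel_measurable M"
    using i by measurable
  also have "?this \<longleftrightarrow> (\<lambda>x. (g x \<cdot>\<^sub>v f x) $ i) \<in> borel_measurable M"
    using i by (intro measurable_cong) (auto dest: measurable_Rvec_carrier[OF assms(1)])
  finally show "(\<lambda>x. (g x \<cdot>\<^sub>v f x) $ i) \<in> borel_measurable M" .
qed (auto dest: measurable_Rvec_carrier[OF assms(1)])

lemma measurable_Rvec_const: "a \<in> carrier_vec p \<Longrightarrow> (\<lambda>x. a) \<in> M \<rightarrow>\<^sub>M Rvec p"
  by (rule measurable_const) (simp add: space_Rvec)

lemma measurable_mult_mat_vec [measurable (raw)]:
  assumes A: "A \<in> carrier_mat q p" and f[measurable]: "f \<in> M \<rightarrow>\<^sub>M Rvec p"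
  shows "(\<lambda>x. A *\<^sub>v f x) \<in> M \<rightarrow>\<^sub>M Rvec q"
proof (rule measurable_RvecI)
  fix i assume i: "i < q"
  have "(\<lambda>x. row A i \<bullet> f x) \<in> borel_measurable M"
    using A i by (intro measurable_scalar_prod[of _ _ p] measurable_Rvec_const f) auto
  thus "(\<lambda>x. (A *\<^sub>v f x) $ i) \<in> borel_measurable M"
    using A i by simp
qed (rule mult_mat_vec_carrier[OF A measurable_Rvec_carrier[OF f]])

lemma measurable_vec [measurable]:
  "Matrix.vec p \<in> Pi\<^sub>M {..<p} (\<lambda>_. borel) \<rightarrow>\<^sub>M Rvec p"
  by (rule measurable_RvecI) auto

section \<open>Orthogonal maps\<close>

lemma scalar_prod_ge_0: "0 \<le> (v :: real Matrix.vec) \<bullet> v"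
  by (simp add: scalar_prod_def sum_nonneg)

lemma eucl_norm_nonneg: "0 \<le> eucl_norm v"
  by (simp add: eucl_norm_def scalar_prod_ge_0)

lemma eucl_norm_sq: "(eucl_norm v)\<^sup>2 = v \<bullet> v"
  by (simp add: eucl_norm_def scalar_prod_ge_0)

lemma scalar_prod_self_eq_0:
  assumes "v \<in> carrier_vec p"
  shows "(v :: real Matrix.vec) \<bullet> v = 0 \<longleftrightarrow> v = 0\<^sub>v p"
  using assms by (auto simp: scalar_prod_def sum_nonneg_eq_0_iff)

lemma eucl_norm_eq_0: "v \<in> carrier_vec p \<Longrightarrow> eucl_norm v = 0 \<longleftrightarrow> v = 0\<^sub>v p"
  by (simp add: eucl_norm_def scalar_prod_self_eq_0 scalar_prod_ge_0)

lemma orthogonal_carrier: "V \<in> orthogonal_mats p \<Longrightarrow> V \<in> carrier_mat p p"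
  by (simp add: orthogonal_mats_def)

lemma scalar_prod_mult_mat_vec:
  assumes "A \<in> carrier_mat n p" "v \<in> carrier_vec p" "w \<in> carrier_vec n"
  shows "(A *\<^sub>v v) \<bullet> (w :: real Matrix.vec) = v \<bullet> (A\<^sup>T *\<^sub>v w)"
  using transpose_vec_mult_scalar[of A n p v w] assms
  by (metis comm_scalar_prod mult_mat_vec_carrier transpose_carrier_mat)

lemma orthogonal_scalar_prod:
  assumes "V \<in> orthogonal_mats p" "v \<in> carrier_vec p" "w \<in> carrier_vec p"
  shows "(V *\<^sub>v v) \<bullet> (V *\<^sub>v w) = v \<bullet> w"
proof -
  have V: "V \<in> carrier_mat p p" "V\<^sup>T * V = 1\<^sub>m p" using assms by (auto simp: orthogonal_mats_def)
  have "(V *\<^sub>v v) \<bullet> (V *\<^sub>v w) = v \<bullet> (V\<^sup>T *\<^sub>v (V *\<^sub>v w))"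
    using V assms by (intro scalar_prod_mult_mat_vec[of _ p p]) auto
  also have "V\<^sup>T *\<^sub>v (V *\<^sub>v w) = (V\<^sup>T * V) *\<^sub>v w"
    using V assms by (intro assoc_mult_mat_vec[symmetric]) auto
  finally show ?thesis using V assms by simp
qed

lemma orthogonal_eucl_norm:
  "V \<in> orthogonal_mats p \<Longrightarrow> v \<in> carrier_vec p \<Longrightarrow> eucl_norm (V *\<^sub>v v) = eucl_norm v"
  by (simp add: eucl_norm_def orthogonal_scalar_prod)

text \<open>The Householder matrix of the hyperplane orthogonal to w. Apart from the identity,
  sphericity is used only for these: w a basis vector flips one coordinate, w a difference of two
  basis vectors swaps two, and w the difference of the first basis vector and a unit vector
  exchanges those.\<close>

definition reflection :: "nat \<Rightarrow> real Matrix.vec \<Rightarrow> real Matrix.mat" where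
  "reflection p w = Matrix.mat p p (\<lambda>(i, j). (if i = j then 1 else 0) - 2 * w $ i * w $ j / (w \<bullet> w))"

lemma reflection_mult_vec:
  assumes "w \<in> carrier_vec p" "v \<in> carrier_vec p" "i < p"
  shows "(reflection p w *\<^sub>v v) $ i = v $ i - 2 * (w \<bullet> v) / (w \<bullet> w) * w $ i"
proof -
  have "(reflection p w *\<^sub>v v) $ i = (\<Sum>j\<in>{0..<p}. ((if i = j then 1 else 0) - 2 * w $ i * w $ j / (w \<bullet> w)) * v $ j)"
    using assms by (auto simp: reflection_def scalar_prod_def intro!: sum.cong)
  also have "\<dots> = (\<Sum>j\<in>{0..<p}. (if i = j then v $ j else 0) - 2 / (w \<bullet> w) * w $ i * (w $ j * v $ j))"
    by (intro sum.cong) (auto simp: algebra_simps)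
  also have "\<dots> = v $ i - 2 / (w \<bullet> w) * w $ i * (w \<bullet> v)"
    unfolding sum_subtractf sum_distrib_left[symmetric] using assms by (auto simp: scalar_prod_def)
  finally show ?thesis by simp
qed

text \<open>The matrix is symmetric, so both orthogonality equations say that its square is the
  identity. Column j has scalar product - w_j with w, and reflecting that column once more restores
  the basis vector.\<close>

lemma reflection_orthogonal:
  assumes "w \<in> carrier_vec p" "w \<bullet> w \<noteq> 0"
  shows "reflection p w \<in> orthogonal_mats p"
proof -
  have T: "(reflection p w)\<^sup>T = reflection p w"
    by (rule eq_matI) (auto simp: reflection_def)
  have "reflection p w * reflection p w = 1\<^sub>m p"
  proof (rule eq_matI)
    fix i j assume ij: "i < dim_row (1\<^sub>m p)" "j < dim_col (1\<^sub>m p)"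
    let ?v = "col (reflection p w) j"
    have v: "?v $ k = (if k = j then 1 else 0) - 2 * w $ k * w $ j / (w \<bullet> w)" if "k < p" for k
      using that ij by (simp add: reflection_def)
    have "w \<bullet> ?v = (\<Sum>k\<in>{0..<p}. (if k = j then w $ k else 0) - 2 * w $ j / (w \<bullet> w) * (w $ k * w $ k))"
    proof -
      have "w \<bullet> ?v = (\<Sum>k\<in>{0..<p}. w $ k * ?v $ k)"
        by (simp add: scalar_prod_def reflection_def)
      also have "\<dots> = (\<Sum>k\<in>{0..<p}. (if k = j then w $ k else 0) - 2 * w $ j / (w \<bullet> w) * (w $ k * w $ k))"
      proof (rule sum.cong)
        fix k assume "k \<in> {0..<p}"
        hence "?v $ k = (if k = j then 1 else 0) - 2 * w $ k * w $ j / (w \<bullet> w)" by (intro v) simp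
        thus "w $ k * ?v $ k = (if k = j then w $ k else 0) - 2 * w $ j / (w \<bullet> w) * (w $ k * w $ k)"
          by (simp only: right_diff_distrib) (simp add: mult_ac)
      qed simp
      finally show ?thesis .
    qed
    also have "\<dots> = w $ j - 2 * w $ j / (w \<bullet> w) * (w \<bullet> w)"
      unfolding sum_subtractf sum_distrib_left[symmetric] using ij assms by (auto simp: scalar_prod_def)
    also have "\<dots> = - w $ j" using assms by simp
    finally have wv: "w \<bullet> ?v = - w $ j" .
    have "(reflection p w * reflection p w) $$ (i, j) = (reflection p w *\<^sub>v ?v) $ i"
      using ij by (simp add: reflection_def)
    also have "\<dots> = ?v $ i - 2 * (w \<bullet> ?v) / (w \<bullet> w) * w $ i"
    proof (rule reflection_mult_vec[OF assms(1)])
      show "?v \<in> carrier_vec p" by (rule carrier_vecI) (simp add: reflection_def)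
    qed (use ij in simp)
    also have "\<dots> = 1\<^sub>m p $$ (i, j)"
      unfolding wv using ij by (simp add: v)
    finally show "(reflection p w * reflection p w) $$ (i, j) = 1\<^sub>m p $$ (i, j)" .
  qed (auto simp: reflection_def)
  moreover have "reflection p w \<in> carrier_mat p p" by (simp add: reflection_def)
  ultimately show ?thesis unfolding orthogonal_mats_def mem_Collect_eq T by blast
qed

section \<open>Lebesgue measure on coordinate vectors\<close>

definition Leb :: "nat \<Rightarrow> real Matrix.vec measure" where
  "Leb p = distr (Pi\<^sub>M {..<p} (\<lambda>_. lborel)) (Rvec p) (Matrix.vec p)"

lemma sets_Leb [measurable_cong, simp]: "sets (Leb p) = sets (Rvec p)"
  by (simp add: Leb_def)

lemma space_Leb: "space (Leb p) = carrier_vec p"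
  by (simp add: Leb_def space_Rvec)

lemma sets_PiM_lborel [measurable_cong]: "sets (Pi\<^sub>M I (\<lambda>_. lborel :: real measure)) = sets (Pi\<^sub>M I (\<lambda>_. borel))"
  by (rule sets_PiM_cong) auto

lemma measurable_vec_lborel [measurable]:
  "Matrix.vec p \<in> Pi\<^sub>M {..<p} (\<lambda>_. lborel) \<rightarrow>\<^sub>M Rvec p"
  by (rule measurable_RvecI) auto

interpretation lborel_prod: product_sigma_finite "\<lambda>_::nat. lborel :: real measure"
  by standard

text \<open>A product measure is determined by its values on boxes. The preimage of a box under a
  coordinatewise affine map is again a box, and the one-dimensional rule contributes one factor
  \<bar>r\<bar> per coordinate.\<close>

lemma distr_PiM_affine:
  assumes "r \<noteq> 0"
  shows "density (distr (Pi\<^sub>M {..<p} (\<lambda>_. lborel)) (Pi\<^sub>M {..<p} (\<lambda>_. borel)) (\<lambda>f. \<lambda>i\<in>{..<p}. t i + r * f i))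
      (\<lambda>_. ennreal (\<bar>r\<bar> ^ p)) = Pi\<^sub>M {..<p} (\<lambda>_. lborel :: real measure)" (is "density ?D _ = _")
proof (rule lborel_prod.PiM_eqI)
  fix A :: "nat \<Rightarrow> real set" assume A: "\<And>i. i \<in> {..<p} \<Longrightarrow> A i \<in> sets lborel"
  have AA: "Pi\<^sub>E {..<p} A \<in> sets (Pi\<^sub>M {..<p} (\<lambda>_. borel))"
    using A by (intro sets_PiM_I_finite) auto
  have m: "(\<lambda>f. \<lambda>i\<in>{..<p}. t i + r * f i) \<in> Pi\<^sub>M {..<p} (\<lambda>_. lborel :: real measure) \<rightarrow>\<^sub>M Pi\<^sub>M {..<p} (\<lambda>_. borel)"
    by measurable
  have "emeasure ?D (Pi\<^sub>E {..<p} A) = emeasure (Pi\<^sub>M {..<p} (\<lambda>_. lborel))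
     ((\<lambda>f. \<lambda>i\<in>{..<p}. t i + r * f i) -` (Pi\<^sub>E {..<p} A) \<inter> space (Pi\<^sub>M {..<p} (\<lambda>_. lborel :: real measure)))"
    using AA m by (intro emeasure_distr) auto
  also have "(\<lambda>f. \<lambda>i\<in>{..<p}. t i + r * f i) -` (Pi\<^sub>E {..<p} A) \<inter> space (Pi\<^sub>M {..<p} (\<lambda>_. lborel :: real measure))
      = Pi\<^sub>E {..<p} (\<lambda>i. (\<lambda>x. t i + r * x) -` A i)"
    by (auto simp: space_PiM PiE_iff extensional_def)
  also have "emeasure (Pi\<^sub>M {..<p} (\<lambda>_. lborel)) \<dots> = (\<Prod>i\<in>{..<p}. emeasure lborel ((\<lambda>x. t i + r * x) -` A i))"
  proof (rule lborel_prod.emeasure_PiM)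
    fix i assume "i \<in> {..<p}"
    hence "A i \<in> sets borel" using A by simp
    hence "(\<lambda>x. t i + r * x) -` A i \<inter> space borel \<in> sets borel"
      by (intro measurable_sets[where A=borel]) auto
    thus "(\<lambda>x. t i + r * x) -` A i \<in> sets lborel" by simp
  qed simp
  finally have D: "emeasure ?D (Pi\<^sub>E {..<p} A) = (\<Prod>i\<in>{..<p}. emeasure lborel ((\<lambda>x. t i + r * x) -` A i))" .
  have "emeasure (density ?D (\<lambda>_. ennreal (\<bar>r\<bar> ^ p))) (Pi\<^sub>E {..<p} A) = ennreal (\<bar>r\<bar> ^ p) * emeasure ?D (Pi\<^sub>E {..<p} A)"
    using AA by (subst emeasure_density) (auto simp: nn_integral_cmult_indicator)
  also have "\<dots> = (\<Prod>i\<in>{..<p}. ennreal \<bar>r\<bar> * emeasure lborel ((\<lambda>x. t i + r * x) -` A i))"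
    unfolding D by (simp add: prod.distrib ennreal_power)
  also have "\<dots> = (\<Prod>i\<in>{..<p}. emeasure lborel (A i))"
  proof (rule prod.cong)
    fix i assume "i \<in> {..<p}"
    hence Ai: "A i \<in> sets borel" using A by simp
    have "emeasure lborel (A i) = emeasure (density (distr lborel borel (\<lambda>x. t i + r * x)) (\<lambda>_. ennreal \<bar>r\<bar>)) (A i)"
      using lborel_real_affine[OF assms, of "t i"] by simp
    also have "\<dots> = ennreal \<bar>r\<bar> * emeasure (distr lborel borel (\<lambda>x. t i + r * x)) (A i)"
      using Ai by (subst emeasure_density) (auto simp: nn_integral_cmult_indicator)
    also have "\<dots> = ennreal \<bar>r\<bar> * emeasure lborel ((\<lambda>x. t i + r * x) -` A i)"
      using Ai by (subst emeasure_distr) auto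
    finally show "ennreal \<bar>r\<bar> * emeasure lborel ((\<lambda>x. t i + r * x) -` A i) = emeasure lborel (A i)" ..
  qed simp
  finally show "emeasure (density ?D (\<lambda>_. ennreal (\<bar>r\<bar> ^ p))) (Pi\<^sub>E {..<p} A) = (\<Prod>i\<in>{..<p}. emeasure lborel (A i))" .
qed (auto simp: sets_PiM_lborel)

text \<open>Two special cases matter: r = 1 is translation invariance, and a = 0 gives the volume of
  balls as a multiple of r^p.\<close>

lemma Leb_affine:
  assumes "r \<noteq> 0" "a \<in> carrier_vec p"
  shows "density (distr (Leb p) (Rvec p) (\<lambda>v. a + r \<cdot>\<^sub>v v)) (\<lambda>_. ennreal (\<bar>r\<bar> ^ p)) = Leb p"
proof -
  let ?P = "Pi\<^sub>M {..<p} (\<lambda>_. lborel :: real measure)"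
  let ?B = "Pi\<^sub>M {..<p} (\<lambda>_. borel :: real measure)"
  let ?g = "\<lambda>f. \<lambda>i\<in>{..<p}. a $ i + r * f i"
  have ma: "(\<lambda>v. a + r \<cdot>\<^sub>v v) \<in> Rvec p \<rightarrow>\<^sub>M Rvec p"
    by (intro measurable_vec_add measurable_vec_smult measurable_Rvec_const assms) auto
  have mg: "?g \<in> ?P \<rightarrow>\<^sub>M ?B" by measurable
  have "distr (Leb p) (Rvec p) (\<lambda>v. a + r \<cdot>\<^sub>v v) = distr ?P (Rvec p) ((\<lambda>v. a + r \<cdot>\<^sub>v v) \<circ> Matrix.vec p)"
    unfolding Leb_def by (rule distr_distr[OF ma measurable_vec_lborel])
  also have "\<dots> = distr ?P (Rvec p) (Matrix.vec p \<circ> ?g)"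
    by (rule distr_cong) (use assms in auto)
  also have "\<dots> = distr (distr ?P ?B ?g) (Rvec p) (Matrix.vec p)"
    by (rule distr_distr[OF measurable_vec mg, symmetric])
  finally have "density (distr (Leb p) (Rvec p) (\<lambda>v. a + r \<cdot>\<^sub>v v)) (\<lambda>_. ennreal (\<bar>r\<bar> ^ p))
     = distr (density (distr ?P ?B ?g) (\<lambda>_. ennreal (\<bar>r\<bar> ^ p))) (Rvec p) (Matrix.vec p)"
    by (simp add: density_distr)
  thus ?thesis
    by (simp only: distr_PiM_affine[OF assms(1)] Leb_def)
qed

lemma Leb_translate:
  assumes "a \<in> carrier_vec p"
  shows "distr (Leb p) (Rvec p) (\<lambda>v. a + v) = Leb p"
proof -
  have "distr (Leb p) (Rvec p) (\<lambda>v. a + v) = distr (Leb p) (Rvec p) (\<lambda>v. a + 1 \<cdot>\<^sub>v v)"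
    by (rule distr_cong) auto
  also have "density \<dots> (\<lambda>_. 1) = Leb p"
    using Leb_affine[of 1 a p] assms by simp
  finally show ?thesis by (simp add: density_1)
qed

definition vball :: "nat \<Rightarrow> real \<Rightarrow> real Matrix.vec set" where
  "vball p r = {v \<in> carrier_vec p. eucl_norm v \<le> r}"

lemma sets_vball [measurable]: "vball p r \<in> sets (Rvec p)"
proof -
  have "{v \<in> space (Rvec p). eucl_norm v \<le> r} \<in> sets (Rvec p)" by measurable
  thus ?thesis by (simp add: vball_def space_Rvec)
qed

lemma abs_index_le_eucl_norm:
  assumes "v \<in> carrier_vec p" "i < p"
  shows "\<bar>v $ i\<bar> \<le> eucl_norm v"
proof -
  have "(v $ i)\<^sup>2 \<le> v \<bullet> v"
    using assms unfolding scalar_prod_def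
    by (auto intro!: member_le_sum[where f="\<lambda>i. v $ i * v $ i"] simp: power2_eq_square)
  thus ?thesis unfolding eucl_norm_def by (intro real_le_rsqrt) simp
qed

lemma emeasure_Leb:
  assumes "A \<in> sets (Rvec p)"
  shows "emeasure (Leb p) A = emeasure (Pi\<^sub>M {..<p} (\<lambda>_. lborel)) (Matrix.vec p -` A \<inter> space (Pi\<^sub>M {..<p} (\<lambda>_. lborel :: real measure)))"
  unfolding Leb_def using assms by (intro emeasure_distr) auto

lemma emeasure_vball_finite: "emeasure (Leb p) (vball p r) < \<infinity>"
proof -
  have "emeasure (Leb p) (vball p r) \<le> emeasure (Pi\<^sub>M {..<p} (\<lambda>_. lborel)) (Pi\<^sub>E {..<p} (\<lambda>_. {-r..r}))"
    unfolding emeasure_Leb[OF sets_vball]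
  proof (rule emeasure_mono)
    show "Matrix.vec p -` vball p r \<inter> space (Pi\<^sub>M {..<p} (\<lambda>_. lborel :: real measure)) \<subseteq> Pi\<^sub>E {..<p} (\<lambda>_. {-r..r})"
    proof
      fix f assume f: "f \<in> Matrix.vec p -` vball p r \<inter> space (Pi\<^sub>M {..<p} (\<lambda>_. lborel :: real measure))"
      have "- r \<le> f i \<and> f i \<le> r" if "i < p" for i
        using abs_index_le_eucl_norm[of "Matrix.vec p f" p i] f that by (auto simp: vball_def)
      thus "f \<in> Pi\<^sub>E {..<p} (\<lambda>_. {-r..r})" using f by (auto simp: space_PiM PiE_iff)
    qed
    show "Pi\<^sub>E {..<p} (\<lambda>_. {-r..r}) \<in> sets (Pi\<^sub>M {..<p} (\<lambda>_. lborel :: real measure))"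
      by (intro sets_PiM_I_finite) auto
  qed
  also have "\<dots> = (\<Prod>i\<in>{..<p}. emeasure lborel {-r..r})"
    by (rule lborel_prod.emeasure_PiM) auto
  also have "\<dots> < \<infinity>"
    by (cases "- r \<le> r") (auto simp: emeasure_lborel_Icc ennreal_power less_top[symmetric] simp flip: ennreal_0)
  finally show ?thesis .
qed

lemma emeasure_vball_pos:
  assumes "r > 0"
  shows "emeasure (Leb p) (vball p r) > 0"
proof -
  \<comment> \<open>The cube with half-side s lies in the ball because p s^2 \<le> (p + 1)^2 s^2 =
    r^2. The denominator p + 1 avoids square roots and is nonzero even for p = 0.\<close>
  define s where "s = r / (real p + 1)"
  have s: "s > 0" using assms by (simp add: s_def)
  have "0 < (\<Prod>i\<in>{..<p}. emeasure lborel {-s..s})"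
    using s by (auto simp: ennreal_power)
  also have "\<dots> = emeasure (Pi\<^sub>M {..<p} (\<lambda>_. lborel)) (Pi\<^sub>E {..<p} (\<lambda>_. {-s..s}))"
    by (rule lborel_prod.emeasure_PiM[symmetric]) auto
  also have "\<dots> \<le> emeasure (Leb p) (vball p r)"
    unfolding emeasure_Leb[OF sets_vball]
  proof (rule emeasure_mono)
    show "Pi\<^sub>E {..<p} (\<lambda>_. {-s..s}) \<subseteq> Matrix.vec p -` vball p r \<inter> space (Pi\<^sub>M {..<p} (\<lambda>_. lborel :: real measure))"
    proof
      fix f assume f: "f \<in> Pi\<^sub>E {..<p} (\<lambda>_. {-s..s})"
      have "(\<Sum>i\<in>{0..<p}. f i * f i) \<le> (\<Sum>i\<in>{0..<p}. s * s)"
      proof (rule sum_mono)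
        fix i assume "i \<in> {0..<p}"
        hence "- s \<le> f i \<and> f i \<le> s" using f by (auto simp: PiE_iff)
        hence "\<bar>f i\<bar> \<le> s" by (simp add: abs_le_iff)
        hence "\<bar>f i\<bar> * \<bar>f i\<bar> \<le> s * s" by (intro mult_mono) auto
        thus "f i * f i \<le> s * s" by simp
      qed
      also have "\<dots> = real p * (s * s)" by simp
      also have "\<dots> \<le> (real p + 1)\<^sup>2 * (s * s)"
        by (intro mult_right_mono) (auto simp: power2_eq_square algebra_simps)
      also have "\<dots> = r\<^sup>2" by (simp add: s_def power2_eq_square)
      finally have "eucl_norm (Matrix.vec p f) \<le> r"
        unfolding eucl_norm_def using assms by (intro real_le_lsqrt) (auto simp: scalar_prod_def sum_nonneg)
      thus "f \<in> Matrix.vec p -` vball p r \<inter> space (Pi\<^sub>M {..<p} (\<lambda>_. lborel :: real measure))"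
        using f by (auto simp: vball_def space_PiM PiE_iff)
    qed
    have "Matrix.vec p \<in> Pi\<^sub>M {..<p} (\<lambda>_. lborel) \<rightarrow>\<^sub>M Rvec p" by measurable
    thus "Matrix.vec p -` vball p r \<inter> space (Pi\<^sub>M {..<p} (\<lambda>_. lborel :: real measure)) \<in> sets (Pi\<^sub>M {..<p} (\<lambda>_. lborel :: real measure))"
      by (rule measurable_sets) auto
  qed
  finally show ?thesis .
qed

lemma sigma_finite_Rvec:
  assumes "sets M = sets (Rvec p)" "\<And>n::nat. emeasure M (vball p (real n)) < \<infinity>"
  shows "sigma_finite_measure M"
proof
  have sp: "space M = carrier_vec p" using sets_eq_imp_space_eq[OF assms(1)] by (simp add: space_Rvec)
  show "\<exists>A. countable A \<and> A \<subseteq> sets M \<and> \<Union> A = space M \<and> (\<forall>a\<in>A. emeasure M a \<noteq> \<infinity>)"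
  proof (intro exI conjI ballI)
    show "countable (range (\<lambda>n::nat. vball p (real n)))" by simp
    show "range (\<lambda>n::nat. vball p (real n)) \<subseteq> sets M"
      unfolding assms(1) by (intro image_subsetI sets_vball)
    show "\<Union> (range (\<lambda>n::nat. vball p (real n))) = space M"
      unfolding sp
    proof (intro equalityI subsetI)
      fix v :: "real Matrix.vec" assume v: "v \<in> carrier_vec p"
      obtain n :: nat where "eucl_norm v \<le> real n" using real_arch_simple by blast
      with v have "v \<in> vball p (real n)" by (simp add: vball_def)
      thus "v \<in> \<Union> (range (\<lambda>n::nat. vball p (real n)))" by blast
    qed (auto simp: vball_def)
  next
    fix a assume "a \<in> range (\<lambda>n::nat. vball p (real n))"
    then obtain n :: nat where "a = vball p (real n)" by blast
    thus "emeasure M a \<noteq> \<infinity>" using assms(2)[of n] by simp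
  qed
qed

lemma sigma_finite_Leb: "sigma_finite_measure (Leb p)"
  by (rule sigma_finite_Rvec[where p=p], rule sets_Leb, rule emeasure_vball_finite)

text \<open>Integrating \<open>f (x + y) * g y\<close> in both orders, with \<open>g\<close> the indicator of a ball, shows that a
  translation-invariant measure is a multiple of Lebesgue measure; its value on balls fixes the factor.\<close>

lemma Leb_unique:
  assumes sets: "sets M = sets (Rvec p)"
    and trans: "\<And>a. a \<in> carrier_vec p \<Longrightarrow> distr M (Rvec p) (\<lambda>v. a + v) = M"
    and ball: "\<And>r. emeasure M (vball p r) = emeasure (Leb p) (vball p r)"
  shows "M = Leb p"
proof (rule measure_eqI)
  note sets [measurable_cong]
  have sp: "space M = carrier_vec p" using sets_eq_imp_space_eq[OF sets] by (simp add: space_Rvec)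
  interpret M: sigma_finite_measure M
    by (rule sigma_finite_Rvec[OF sets]) (unfold ball, rule emeasure_vball_finite)
  interpret L: sigma_finite_measure "Leb p" by (rule sigma_finite_Leb)
  interpret P: pair_sigma_finite M "Leb p" ..
  fix A assume "A \<in> sets M"
  hence A[measurable]: "A \<in> sets (Rvec p)" using sets by simp
  let ?B = "vball p 1"
  have inv: "(\<integral>\<^sup>+x. h (a + x) \<partial>M) = (\<integral>\<^sup>+x. h x \<partial>M)" 
    if "a \<in> carrier_vec p" and [measurable]: "h \<in> borel_measurable (Rvec p)" for a h
  proof -
    have m: "(\<lambda>v. a + v) \<in> M \<rightarrow>\<^sub>M Rvec p"
      by (intro measurable_vec_add measurable_Rvec_const that measurable_ident_sets sets)
    have "(\<integral>\<^sup>+x. h x \<partial>M) = (\<integral>\<^sup>+x. h x \<partial>distr M (Rvec p) (\<lambda>v. a + v))" using trans[OF that(1)] by simp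
    also have "\<dots> = (\<integral>\<^sup>+x. h (a + x) \<partial>M)" by (rule nn_integral_distr[OF m]) simp
    finally show ?thesis ..
  qed
  have invL: "(\<integral>\<^sup>+x. h (a + x) \<partial>Leb p) = (\<integral>\<^sup>+x. h x \<partial>Leb p)" 
    if "a \<in> carrier_vec p" and [measurable]: "h \<in> borel_measurable (Rvec p)" for a h
  proof -
    have m: "(\<lambda>v. a + v) \<in> Leb p \<rightarrow>\<^sub>M Rvec p"
      by (intro measurable_vec_add measurable_Rvec_const that measurable_ident_sets) simp
    have "(\<integral>\<^sup>+x. h x \<partial>Leb p) = (\<integral>\<^sup>+x. h x \<partial>distr (Leb p) (Rvec p) (\<lambda>v. a + v))" using Leb_translate[OF that(1)] by simp
    also have "\<dots> = (\<integral>\<^sup>+x. h (a + x) \<partial>Leb p)" by (rule nn_integral_distr[OF m]) simp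
    finally show ?thesis ..
  qed
  let ?f = "indicator A :: real Matrix.vec \<Rightarrow> ennreal" and ?g = "indicator ?B :: real Matrix.vec \<Rightarrow> ennreal"
  \<comment> \<open>The symmetry of the ball is what later turns y - x into x - y, so that the
    translation invariance of M applies in the variable x.\<close>
  have neg: "?g (- v) = ?g v" if "v \<in> carrier_vec p" for v
    using that by (simp add: indicator_def vball_def eucl_norm_def)
  have m1: "fst \<in> M \<Otimes>\<^sub>M Leb p \<rightarrow>\<^sub>M Rvec p" "snd \<in> M \<Otimes>\<^sub>M Leb p \<rightarrow>\<^sub>M Rvec p"
    using measurable_fst[of M "Leb p"] measurable_snd[of M "Leb p"] measurable_cong_sets[OF refl sets] 
     measurable_cong_sets[OF refl sets_Leb] by auto
  have [measurable]: "(\<lambda>(x, y). ?f (y + x) * ?g y) \<in> borel_measurable (M \<Otimes>\<^sub>M Leb p)"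
    unfolding split_beta'
    by (intro borel_measurable_times_ennreal borel_measurable_indicator' measurable_compose[OF measurable_vec_add[OF m1(2,1)] borel_measurable_indicator]
      measurable_compose[OF m1(2) borel_measurable_indicator]) (auto simp: A)
  \<comment> \<open>The difference y - x is written with the scalar -1, so that the measurability
    rules for sums and multiples of vectors cover it.\<close>
  have [measurable]: "(\<lambda>(x, y). ?f y * ?g (y + (- 1) \<cdot>\<^sub>v x)) \<in> borel_measurable (M \<Otimes>\<^sub>M Leb p)"
    unfolding split_beta'
    by (intro borel_measurable_times_ennreal measurable_compose[OF measurable_vec_add[OF m1(2) measurable_vec_smult[OF m1(1)]] borel_measurable_indicator]
      measurable_compose[OF m1(2) borel_measurable_indicator]) (auto simp: A)
  have "emeasure M A * emeasure (Leb p) ?B = (\<integral>\<^sup>+x. ?f x \<partial>M) * (\<integral>\<^sup>+y. ?g y \<partial>Leb p)"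
    using A sets by simp
  also have "\<dots> = (\<integral>\<^sup>+y. (\<integral>\<^sup>+x. ?f x \<partial>M) * ?g y \<partial>Leb p)"
    by (rule nn_integral_cmult[symmetric]) measurable
  also have "\<dots> = (\<integral>\<^sup>+y. (\<integral>\<^sup>+x. ?f (y + x) * ?g y \<partial>M) \<partial>Leb p)"
  proof (rule nn_integral_cong)
    fix y assume y: "y \<in> space (Leb p)"
    have m: "(\<lambda>v. y + v) \<in> M \<rightarrow>\<^sub>M Rvec p"
      using y by (intro measurable_vec_add measurable_Rvec_const measurable_ident_sets sets) (auto simp: space_Leb)
    have "(\<integral>\<^sup>+x. ?f (y + x) * ?g y \<partial>M) = (\<integral>\<^sup>+x. ?f (y + x) \<partial>M) * ?g y"
      by (rule nn_integral_multc) (use measurable_compose[OF m borel_measurable_indicator[OF A]] in simp)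
    thus "(\<integral>\<^sup>+x. ?f x \<partial>M) * ?g y = (\<integral>\<^sup>+x. ?f (y + x) * ?g y \<partial>M)"
      using inv[of y ?f] y by (simp add: space_Leb)
  qed
  also have "\<dots> = (\<integral>\<^sup>+x. (\<integral>\<^sup>+y. ?f (y + x) * ?g y \<partial>Leb p) \<partial>M)"
    by (rule P.Fubini') measurable
  also have "\<dots> = (\<integral>\<^sup>+x. (\<integral>\<^sup>+y. ?f y * ?g (y + (- 1) \<cdot>\<^sub>v x) \<partial>Leb p) \<partial>M)"
  proof (rule nn_integral_cong)
    fix x assume "x \<in> space M"
    hence x: "x \<in> carrier_vec p" by (simp add: sp)
    have m: "(\<lambda>y. y + (- 1) \<cdot>\<^sub>v x) \<in> Rvec p \<rightarrow>\<^sub>M Rvec p"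
      using x by (intro measurable_vec_add measurable_Rvec_const measurable_ident_sets) auto
    have "(\<integral>\<^sup>+y. ?f (y + x) * ?g y \<partial>Leb p) = (\<integral>\<^sup>+y. ?f (x + y) * ?g ((x + y) + (- 1) \<cdot>\<^sub>v x) \<partial>Leb p)"
    proof (rule nn_integral_cong)
      fix y assume "y \<in> space (Leb p)"
      hence y: "y \<in> carrier_vec p" by (simp add: space_Leb)
      have "x + y = y + x" using x y by (rule comm_add_vec)
      moreover have "(x + y) + (- 1) \<cdot>\<^sub>v x = y" using x y by (intro eq_vecI) auto
      ultimately show "?f (y + x) * ?g y = ?f (x + y) * ?g ((x + y) + (- 1) \<cdot>\<^sub>v x)" by simp
    qed
    also have "\<dots> = (\<integral>\<^sup>+y. ?f y * ?g (y + (- 1) \<cdot>\<^sub>v x) \<partial>Leb p)"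
      by (rule invL[OF x]) (intro borel_measurable_times_ennreal borel_measurable_indicator A measurable_compose[OF m] sets_vball)
    finally show "(\<integral>\<^sup>+y. ?f (y + x) * ?g y \<partial>Leb p) = (\<integral>\<^sup>+y. ?f y * ?g (y + (- 1) \<cdot>\<^sub>v x) \<partial>Leb p)" .
  qed
  also have "\<dots> = (\<integral>\<^sup>+y. (\<integral>\<^sup>+x. ?f y * ?g (y + (- 1) \<cdot>\<^sub>v x) \<partial>M) \<partial>Leb p)"
    by (rule P.Fubini'[symmetric]) measurable
  also have "\<dots> = (\<integral>\<^sup>+y. ?f y * (\<integral>\<^sup>+x. ?g x \<partial>M) \<partial>Leb p)"
  proof (rule nn_integral_cong)
    fix y assume "y \<in> space (Leb p)"
    hence y: "y \<in> carrier_vec p" by (simp add: space_Leb)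
    have m: "(\<lambda>x. y + (- 1) \<cdot>\<^sub>v x) \<in> M \<rightarrow>\<^sub>M Rvec p"
      using y by (intro measurable_vec_add measurable_vec_smult measurable_Rvec_const measurable_ident_sets sets) auto
    have "(\<integral>\<^sup>+x. ?f y * ?g (y + (- 1) \<cdot>\<^sub>v x) \<partial>M) = ?f y * (\<integral>\<^sup>+x. ?g (y + (- 1) \<cdot>\<^sub>v x) \<partial>M)"
      by (rule nn_integral_cmult) (rule measurable_compose[OF m borel_measurable_indicator[OF sets_vball]])
    also have "(\<integral>\<^sup>+x. ?g (y + (- 1) \<cdot>\<^sub>v x) \<partial>M) = (\<integral>\<^sup>+x. ?g ((- y) + x) \<partial>M)"
    proof (rule nn_integral_cong)
      fix x assume "x \<in> space M"
      hence x: "x \<in> carrier_vec p" by (simp add: sp)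
      have "- (y + (- 1) \<cdot>\<^sub>v x) = - y + x" using x y by (intro eq_vecI) auto
      thus "?g (y + (- 1) \<cdot>\<^sub>v x) = ?g ((- y) + x)" using neg[of "y + (- 1) \<cdot>\<^sub>v x"] x y by simp
    qed
    also have "\<dots> = (\<integral>\<^sup>+x. ?g x \<partial>M)"
      using y by (intro inv) auto
    finally show "(\<integral>\<^sup>+x. ?f y * ?g (y + (- 1) \<cdot>\<^sub>v x) \<partial>M) = ?f y * (\<integral>\<^sup>+x. ?g x \<partial>M)" .
  qed
  also have "\<dots> = (\<integral>\<^sup>+y. ?f y \<partial>Leb p) * (\<integral>\<^sup>+x. ?g x \<partial>M)"
    by (rule nn_integral_multc) measurable
  also have "\<dots> = emeasure (Leb p) A * emeasure (Leb p) ?B"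
    using A sets by (simp add: ball)
  finally have "emeasure M A * emeasure (Leb p) ?B = emeasure (Leb p) A * emeasure (Leb p) ?B" .
  \<comment> \<open>The factor common to both sides can be cancelled because the unit ball has
    positive finite volume.\<close>
  moreover have "emeasure (Leb p) ?B \<noteq> 0" "emeasure (Leb p) ?B \<noteq> \<top>"
    using emeasure_vball_pos[of 1 p] emeasure_vball_finite[of p 1] by simp_all
  ultimately show "emeasure M A = emeasure (Leb p) A"
    using mult_divide_eq_ennreal[of "emeasure (Leb p) ?B"] by metis
qed (simp add: sets)

text \<open>The image measure satisfies the hypotheses of \<open>Leb_unique\<close>: V preserves
  norms, hence balls, and a translation by a after V is a translation by V' a before it, since a + V
  v = V (V' a + v).\<close>

lemma Leb_orthogonal:
  assumes V: "V \<in> orthogonal_mats p"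
  shows "distr (Leb p) (Rvec p) (\<lambda>v. V *\<^sub>v v) = Leb p"
proof (rule Leb_unique)
  note carr = orthogonal_carrier[OF V]
  have m: "(\<lambda>v. V *\<^sub>v v) \<in> Leb p \<rightarrow>\<^sub>M Rvec p"
    by (intro measurable_mult_mat_vec[OF carr] measurable_ident_sets) simp
  show "sets (distr (Leb p) (Rvec p) ((*\<^sub>v) V)) = sets (Rvec p)" by simp
  show "emeasure (distr (Leb p) (Rvec p) ((*\<^sub>v) V)) (vball p r) = emeasure (Leb p) (vball p r)" for r
  proof -
    have "(*\<^sub>v) V -` vball p r \<inter> space (Leb p) = vball p r"
      using carr orthogonal_eucl_norm[OF V] by (auto simp: vball_def space_Leb)
    thus ?thesis using m by (subst emeasure_distr) auto
  qed
  fix a :: "real Matrix.vec" assume a: "a \<in> carrier_vec p"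
  define b where "b = V\<^sup>T *\<^sub>v a"
  have b: "b \<in> carrier_vec p" using carr a by (simp add: b_def)
  have Vb: "V *\<^sub>v b = a"
  proof -
    have "V *\<^sub>v b = (V * V\<^sup>T) *\<^sub>v a"
      unfolding b_def using carr a by (intro assoc_mult_mat_vec[symmetric]) auto
    thus ?thesis using V a by (simp add: orthogonal_mats_def)
  qed
  have ma: "(\<lambda>v. a + v) \<in> Rvec p \<rightarrow>\<^sub>M Rvec p" "(\<lambda>v. b + v) \<in> Leb p \<rightarrow>\<^sub>M Rvec p"
    by (intro measurable_vec_add measurable_Rvec_const a b measurable_ident_sets, simp)+
  have m': "(\<lambda>v. V *\<^sub>v v) \<in> Rvec p \<rightarrow>\<^sub>M Rvec p"
    by (intro measurable_mult_mat_vec[OF carr] measurable_ident_sets) simp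
  have "distr (distr (Leb p) (Rvec p) ((*\<^sub>v) V)) (Rvec p) ((+) a) = distr (Leb p) (Rvec p) ((+) a \<circ> (*\<^sub>v) V)"
    by (rule distr_distr[OF ma(1) m])
  also have "\<dots> = distr (Leb p) (Rvec p) ((*\<^sub>v) V \<circ> (+) b)"
    by (rule distr_cong) (use b Vb carr in \<open>auto simp: space_Leb mult_add_distrib_mat_vec\<close>)
  also have "\<dots> = distr (distr (Leb p) (Rvec p) ((+) b)) (Rvec p) ((*\<^sub>v) V)"
    by (rule distr_distr[OF m' ma(2), symmetric])
  also have "\<dots> = distr (Leb p) (Rvec p) ((*\<^sub>v) V)"
    using Leb_translate[OF b] by simp
  finally show "distr (distr (Leb p) (Rvec p) ((*\<^sub>v) V)) (Rvec p) ((+) a) = distr (Leb p) (Rvec p) ((*\<^sub>v) V)" .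
qed

section \<open>The Gaussian law\<close>

definition gauss :: "nat \<Rightarrow> real Matrix.vec measure" where
  "gauss p = distr (Pi\<^sub>M {..<p} (\<lambda>_. density lborel std_normal_density)) (Rvec p) (Matrix.vec p)"

lemma sets_gauss [measurable_cong, simp]: "sets (gauss p) = sets (Rvec p)"
  by (simp add: gauss_def)

lemma space_gauss: "space (gauss p) = carrier_vec p"
  by (simp add: gauss_def space_Rvec)

lemma prob_space_std_normal: "prob_space (density lborel std_normal_density)"
  by (rule prob_space_normal_density) simp

interpretation std_normal: prob_space "density lborel std_normal_density"
  by (rule prob_space_std_normal)

interpretation normal_prod: product_sigma_finite "\<lambda>_::nat. density lborel std_normal_density"
  by standard

lemma measurable_vec_normal:
  "Matrix.vec p \<in> Pi\<^sub>M {..<p} (\<lambda>_. density lborel std_normal_density) \<rightarrow>\<^sub>M Rvec p"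
  by (rule measurable_RvecI) auto

lemma prob_space_gauss: "prob_space (gauss p)"
  unfolding gauss_def
  by (intro prob_space.prob_space_distr prob_space_PiM prob_space_std_normal measurable_vec_normal)

lemma nn_integral_gauss_prod:
  assumes "\<And>i. i < p \<Longrightarrow> g i \<in> borel_measurable borel"
  shows "(\<integral>\<^sup>+v. (\<Prod>i<p. g i (v $ i)) \<partial>gauss p) = (\<Prod>i<p. \<integral>\<^sup>+x. ennreal (std_normal_density x) * g i x \<partial>lborel)"
proof -
  let ?N = "density lborel std_normal_density"
  have m: "(\<lambda>v. \<Prod>i<p. g i (v $ i)) \<in> borel_measurable (Rvec p)"
    by (intro borel_measurable_prod_ennreal measurable_compose[OF measurable_Rvec_index assms]) auto
  have "(\<integral>\<^sup>+v. (\<Prod>i<p. g i (v $ i)) \<partial>gauss p) = (\<integral>\<^sup>+f. (\<Prod>i<p. g i (Matrix.vec p f $ i)) \<partial>Pi\<^sub>M {..<p} (\<lambda>_. ?N))"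
    unfolding gauss_def by (rule nn_integral_distr[OF measurable_vec_normal]) (use m in simp)
  also have "\<dots> = (\<integral>\<^sup>+f. (\<Prod>i\<in>{..<p}. g i (f i)) \<partial>Pi\<^sub>M {..<p} (\<lambda>_. ?N))"
    by (intro nn_integral_cong prod.cong) auto
  also have "\<dots> = (\<Prod>i\<in>{..<p}. integral\<^sup>N ?N (g i))"
    by (rule normal_prod.product_nn_integral_prod) (use assms in auto)
  also have "\<dots> = (\<Prod>i<p. \<integral>\<^sup>+x. ennreal (std_normal_density x) * g i x \<partial>lborel)"
    by (intro prod.cong nn_integral_density) (use assms in auto)
  finally show ?thesis .
qed

definition gauss_const :: "nat \<Rightarrow> real" where "gauss_const p = (1 / sqrt (2 * pi)) ^ p"

lemma gauss_const_pos: "gauss_const p > 0"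
  by (simp add: gauss_const_def)

text \<open>The product of the coordinate densities depends on the norm alone. In this form the
  Gaussian law inherits orthogonal invariance from Lebesgue measure, and its radial law follows from
  the volume of balls.\<close>

lemma gauss_eq_density:
  "gauss p = density (Leb p) (\<lambda>v. ennreal (gauss_const p * exp (- (eucl_norm v)\<^sup>2 / 2)))"
proof -
  let ?N = "density lborel std_normal_density"
  let ?P = "Pi\<^sub>M {..<p} (\<lambda>_. lborel :: real measure)"
  let ?d = "\<lambda>f. \<Prod>i<p. ennreal (std_normal_density (f i))"
  have md: "?d \<in> borel_measurable ?P"
    by (intro borel_measurable_prod_ennreal) measurable
  have PN: "density ?P ?d = Pi\<^sub>M {..<p} (\<lambda>_. ?N)"
  proof (rule normal_prod.PiM_eqI)
    fix A :: "nat \<Rightarrow> real set" assume "\<And>i. i \<in> {..<p} \<Longrightarrow> A i \<in> sets ?N"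
    hence A: "\<And>i. i \<in> {..<p} \<Longrightarrow> A i \<in> sets borel" by simp
    have AA: "Pi\<^sub>E {..<p} A \<in> sets ?P"
      using A by (intro sets_PiM_I_finite) auto
    have "emeasure (density ?P ?d) (Pi\<^sub>E {..<p} A) = (\<integral>\<^sup>+f. ?d f * indicator (Pi\<^sub>E {..<p} A) f \<partial>?P)"
      by (rule emeasure_density[OF md AA])
    also have "\<dots> = (\<integral>\<^sup>+f. (\<Prod>i\<in>{..<p}. ennreal (std_normal_density (f i)) * indicator (A i) (f i)) \<partial>?P)"
    proof (rule nn_integral_cong)
      fix f assume f: "f \<in> space ?P"
      have "(indicator (Pi\<^sub>E {..<p} A) f :: ennreal) = (\<Prod>i\<in>{..<p}. indicator (A i) (f i))"
        using f by (auto simp: indicator_def space_PiM PiE_iff)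
      thus "?d f * indicator (Pi\<^sub>E {..<p} A) f = (\<Prod>i\<in>{..<p}. ennreal (std_normal_density (f i)) * indicator (A i) (f i))"
        by (simp add: prod.distrib)
    qed
    also have "\<dots> = (\<Prod>i\<in>{..<p}. \<integral>\<^sup>+x. ennreal (std_normal_density x) * indicator (A i) x \<partial>lborel)"
      by (rule lborel_prod.product_nn_integral_prod) (use A in auto)
    also have "\<dots> = (\<Prod>i\<in>{..<p}. emeasure ?N (A i))"
      by (intro prod.cong emeasure_density[symmetric]) (use A in auto)
    finally show "emeasure (density ?P ?d) (Pi\<^sub>E {..<p} A) = (\<Prod>i\<in>{..<p}. emeasure ?N (A i))" .
  qed (auto intro!: sets_PiM_cong)
  have mg: "(\<lambda>v. ennreal (gauss_const p * exp (- (eucl_norm v)\<^sup>2 / 2))) \<in> borel_measurable (Rvec p)"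
    by measurable
  have "density (Leb p) (\<lambda>v. ennreal (gauss_const p * exp (- (eucl_norm v)\<^sup>2 / 2)))
      = distr (density ?P (\<lambda>f. ennreal (gauss_const p * exp (- (eucl_norm (Matrix.vec p f))\<^sup>2 / 2)))) (Rvec p) (Matrix.vec p)"
    unfolding Leb_def by (rule density_distr[OF mg measurable_vec_lborel])
  also have "(\<lambda>f. ennreal (gauss_const p * exp (- (eucl_norm (Matrix.vec p f))\<^sup>2 / 2))) = ?d"
  proof
    fix f :: "nat \<Rightarrow> real"
    have "?d f = ennreal (\<Prod>i<p. 1 / sqrt (2 * pi) * exp (- (f i)\<^sup>2 / 2))"
      by (simp only: std_normal_density_def) (rule prod_ennreal, simp)
    also have "(\<Prod>i<p. 1 / sqrt (2 * pi) * exp (- (f i)\<^sup>2 / 2)) = gauss_const p * exp (\<Sum>i<p. - (f i)\<^sup>2 / 2)"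
      by (simp add: prod.distrib prod_dividef gauss_const_def exp_sum power_divide)
    also have "(\<Sum>i<p. - (f i)\<^sup>2 / 2) = - (eucl_norm (Matrix.vec p f))\<^sup>2 / 2"
      unfolding eucl_norm_sq
      by (simp add: scalar_prod_def sum_negf sum_divide_distrib power2_eq_square atLeast0LessThan)
    finally show "ennreal (gauss_const p * exp (- (eucl_norm (Matrix.vec p f))\<^sup>2 / 2)) = ?d f" ..
  qed
  also have "distr (density ?P ?d) (Rvec p) (Matrix.vec p) = gauss p"
    by (simp only: PN gauss_def)
  finally show ?thesis ..
qed

lemma spherical_gauss: "spherical p (gauss p)"
  unfolding spherical_def
proof
  fix V assume V: "V \<in> orthogonal_mats p"
  let ?g = "\<lambda>v. ennreal (gauss_const p * exp (- (eucl_norm v)\<^sup>2 / 2))"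
  have mg: "?g \<in> borel_measurable (Rvec p)" by measurable
  have mV: "(\<lambda>v. V *\<^sub>v v) \<in> Leb p \<rightarrow>\<^sub>M Rvec p"
    by (intro measurable_mult_mat_vec[OF orthogonal_carrier[OF V]] measurable_ident_sets) simp
  have "distr (gauss p) (Rvec p) (\<lambda>v. V *\<^sub>v v) = distr (density (Leb p) (\<lambda>v. ?g (V *\<^sub>v v))) (Rvec p) (\<lambda>v. V *\<^sub>v v)"
    unfolding gauss_eq_density
  proof (intro arg_cong3[where f=distr] density_cong refl)
    show "?g \<in> borel_measurable (Leb p)" using mg by (simp cong: measurable_cong_sets)
    show "(\<lambda>v. ?g (V *\<^sub>v v)) \<in> borel_measurable (Leb p)" by (rule measurable_compose[OF mV mg])
    show "AE v in Leb p. ?g v = ?g (V *\<^sub>v v)"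
      using orthogonal_eucl_norm[OF V] by (intro AE_I2) (simp add: space_Leb)
  qed
  also have "\<dots> = density (distr (Leb p) (Rvec p) (\<lambda>v. V *\<^sub>v v)) ?g"
    by (rule density_distr[OF mg mV, symmetric])
  also have "\<dots> = gauss p"
    unfolding Leb_orthogonal[OF V] gauss_eq_density ..
  finally show "distr (gauss p) (Rvec p) (\<lambda>v. V *\<^sub>v v) = gauss p" .
qed

section \<open>Volume of balls, the radial Gaussian density and membership in the model\<close>

definition unit_ball_volume :: "nat \<Rightarrow> real" where
  "unit_ball_volume p = measure (Leb p) (vball p 1)"

lemma emeasure_unit_vball: "emeasure (Leb p) (vball p 1) = ennreal (unit_ball_volume p)"
  unfolding unit_ball_volume_def using emeasure_vball_finite[of p 1]
  by (intro emeasure_eq_ennreal_measure) (simp add: less_top[symmetric])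

lemma unit_ball_volume_pos: "unit_ball_volume p > 0"
  using emeasure_vball_pos[of 1 p] by (simp add: emeasure_unit_vball)

lemma eucl_norm_smult: "eucl_norm (r \<cdot>\<^sub>v v) = \<bar>r\<bar> * eucl_norm v"
proof -
  have "(r \<cdot>\<^sub>v v) \<bullet> (r \<cdot>\<^sub>v v) = r\<^sup>2 * (v \<bullet> v)"
    by (simp add: scalar_prod_def sum_distrib_left power2_eq_square mult_ac)
  thus ?thesis by (simp add: eucl_norm_def real_sqrt_mult)
qed

text \<open>For r > 0, scaling by r maps the unit ball onto the ball of radius r. At r = 0 the map
  degenerates, and the ball is squeezed into arbitrarily small ones; with p > 0 the formula gives 0
  there as well.\<close>

lemma emeasure_vball:
  assumes "p > 0" "r \<ge> 0"
  shows "emeasure (Leb p) (vball p r) = ennreal (r ^ p * unit_ball_volume p)"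
proof -
  have pos: "emeasure (Leb p) (vball p r) = ennreal (r ^ p * unit_ball_volume p)" if r: "r > 0" for r
  proof -
    let ?h = "\<lambda>v. 0\<^sub>v p + r \<cdot>\<^sub>v v"
    have mh: "?h \<in> Leb p \<rightarrow>\<^sub>M Rvec p"
      by (intro measurable_vec_add measurable_vec_smult measurable_Rvec_const measurable_ident_sets) auto
    have "emeasure (Leb p) (vball p r) = emeasure (density (distr (Leb p) (Rvec p) ?h) (\<lambda>_. ennreal (\<bar>r\<bar> ^ p))) (vball p r)"
      by (subst Leb_affine) (use r in simp_all)
    also have "\<dots> = ennreal (r ^ p) * emeasure (distr (Leb p) (Rvec p) ?h) (vball p r)"
      using r by (subst emeasure_density) (simp_all add: nn_integral_cmult_indicator)
    also have "emeasure (distr (Leb p) (Rvec p) ?h) (vball p r) = emeasure (Leb p) (?h -` vball p r \<inter> space (Leb p))"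
      by (rule emeasure_distr[OF mh sets_vball])
    also have "?h -` vball p r \<inter> space (Leb p) = vball p 1"
      using r by (auto simp: vball_def space_Leb eucl_norm_smult)
    finally show ?thesis
      using r unit_ball_volume_pos[of p] by (simp add: emeasure_unit_vball ennreal_mult)
  qed
  show ?thesis
  proof (cases "r = 0")
    case False
    show ?thesis by (rule pos) (use False assms in simp)
  next
    case True
    have "emeasure (Leb p) (vball p 0) \<le> ennreal e" if "e > 0" for e
    proof -
      \<comment> \<open>The radius is capped at 1 so that s^p \<le> s; the other bound then makes
        the volume at most e.\<close>
      define s where "s = min 1 (e / unit_ball_volume p)"
      have s: "0 < s" "s \<le> 1" using that unit_ball_volume_pos[of p] by (auto simp: s_def)
      have "emeasure (Leb p) (vball p 0) \<le> emeasure (Leb p) (vball p s)"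
      proof (rule emeasure_mono)
        show "vball p 0 \<subseteq> vball p s" using s by (auto simp: vball_def)
      qed simp
      also have "\<dots> = ennreal (s ^ p * unit_ball_volume p)" by (rule pos[OF s(1)])
      also have "\<dots> \<le> ennreal e"
      proof (rule ennreal_leI)
        have "s ^ p \<le> s ^ 1" using s assms by (intro power_decreasing) auto
        also have "\<dots> \<le> e / unit_ball_volume p" by (simp add: s_def)
        finally show "s ^ p * unit_ball_volume p \<le> e"
          using unit_ball_volume_pos[of p] by (simp add: pos_le_divide_eq)
      qed
      finally show ?thesis .
    qed
    hence "emeasure (Leb p) (vball p 0) \<le> 0 + ennreal e" if "e > 0" for e
      using that by simp
    hence "emeasure (Leb p) (vball p 0) \<le> 0"
      by (rule ennreal_le_epsilon[rotated])
    moreover have "ennreal (r ^ p * unit_ball_volume p) = 0"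
      using True assms by (simp add: zero_power)
    ultimately show ?thesis unfolding True by (simp only: le_zero_eq)
  qed
qed

text \<open>The mass of \<open>{..r}\<close> under the law of the norm is the volume of a ball, and
  the density is the derivative of that volume in r. The half-lines generate the Borel sets and are
  closed under intersection, so agreement on them suffices.\<close>

lemma Leb_norm_density:
  assumes "p \<ge> 1"
  shows "distr (Leb p) borel eucl_norm =
    density lborel (\<lambda>r. ennreal (unit_ball_volume p * real p * r ^ (p - 1)) * indicator {0..} r)" (is "?D = ?L")
proof (rule measure_eqI_generator_eq[where E="range atMost" and \<Omega>=UNIV and A="\<lambda>n. {..real n}"])
  have mn: "eucl_norm \<in> Leb p \<rightarrow>\<^sub>M borel"
    by (intro measurable_eucl_norm[of _ _ p] measurable_ident_sets) simp
  have D: "emeasure ?D {..r} = emeasure (Leb p) (vball p r)" for r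
    by (subst emeasure_distr[OF mn]) (auto simp: vball_def space_Leb intro!: arg_cong2[where f=emeasure])
  show "emeasure ?D X = emeasure ?L X" if X_in: "X \<in> range atMost" for X :: "real set"
  proof -
    obtain r where X: "X = {..r}" using X_in by auto
    show ?thesis
    proof (cases "r \<ge> 0")
      case False
      have "r < eucl_norm v" for v using eucl_norm_nonneg[of v] False by linarith
      hence "vball p r = {}" by (auto simp: vball_def not_le)
      moreover have "emeasure ?L X = 0"
        unfolding X using False
        by (subst emeasure_density) (auto simp: nn_integral_0_iff_AE indicator_def)
      ultimately show ?thesis using D X by simp
    next
      case True
      have "emeasure ?L X = (\<integral>\<^sup>+x. ennreal (unit_ball_volume p * real p * x ^ (p - 1)) * indicator {0..r} x \<partial>lborel)"
        unfolding X by (subst emeasure_density) (auto intro!: nn_integral_cong simp: indicator_def)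
      also have "\<dots> = ennreal (unit_ball_volume p * r ^ p - unit_ball_volume p * 0 ^ p)"
      proof (rule nn_integral_FTC_Icc)
        fix x :: real
        show "((\<lambda>x. unit_ball_volume p * x ^ p) has_real_derivative unit_ball_volume p * real p * x ^ (p - 1)) (at x)"
          using assms by (auto intro!: derivative_eq_intros)
      qed (use True unit_ball_volume_pos[of p] in auto)
      also have "\<dots> = emeasure (Leb p) (vball p r)"
        using assms True by (simp add: emeasure_vball mult.commute zero_power)
      finally show ?thesis using D X by simp
    qed
  qed
  show "emeasure ?D {..real i} \<noteq> \<infinity>" for i
    using emeasure_vball_finite[of p "real i"] by (simp add: D less_top[symmetric])
  have S: "sets (borel :: real measure) = sigma_sets UNIV (range atMost)"
    unfolding borel_eq_atMost by (rule sets_measure_of) simp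
  show "sets ?D = sigma_sets UNIV (range atMost)" unfolding sets_distr by (rule S)
  show "sets ?L = sigma_sets UNIV (range atMost)" unfolding sets_density sets_lborel by (rule S)
  show "Int_stable (range (atMost :: real \<Rightarrow> _))"
  proof (rule Int_stableI)
    fix a b :: "real set" assume "a \<in> range atMost" "b \<in> range atMost"
    then obtain x y where "a = {..x}" "b = {..y}" by blast
    hence "a \<inter> b = {..min x y}" by auto
    thus "a \<inter> b \<in> range atMost" by blast
  qed
  show "(\<Union>i. {..real i}) = UNIV"
  proof (intro equalityI subsetI)
    fix x :: real
    obtain n :: nat where "x \<le> real n" using real_arch_simple by blast
    thus "x \<in> (\<Union>i. {..real i})" by blast
  qed simp
  show "range (\<lambda>n. {..real n}) \<subseteq> range atMost" by blast
qed simp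

lemma gauss_norm_distributed:
  assumes "p \<ge> 2"
  shows "distributed (gauss p) lborel eucl_norm
    (\<lambda>r. ennreal (indicator {0<..} r * (gauss_const p * unit_ball_volume p * real p * r ^ (p - 1) * exp (- r\<^sup>2 / 2))))"
  unfolding distributed_def
proof (intro conjI)
  have mn: "eucl_norm \<in> Leb p \<rightarrow>\<^sub>M borel"
    by (intro measurable_eucl_norm[of _ _ p] measurable_ident_sets) simp
  thus "eucl_norm \<in> gauss p \<rightarrow>\<^sub>M lborel" by (simp cong: measurable_cong_sets)
  let ?h = "\<lambda>r. ennreal (gauss_const p * exp (- r\<^sup>2 / 2))"
  have "distr (gauss p) lborel eucl_norm = distr (density (Leb p) (\<lambda>v. ?h (eucl_norm v))) borel eucl_norm"
    unfolding gauss_eq_density by (rule distr_cong) auto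
  also have "\<dots> = density (distr (Leb p) borel eucl_norm) ?h"
    by (rule density_distr[symmetric, OF _ mn]) simp
  also have "\<dots> = density lborel (\<lambda>r. ennreal (unit_ball_volume p * real p * r ^ (p - 1)) * indicator {0..} r * ?h r)"
    using assms by (subst Leb_norm_density) (auto intro!: density_density_eq)
  also have "(\<lambda>r. ennreal (unit_ball_volume p * real p * r ^ (p - 1)) * indicator {0..} r * ?h r)
     = (\<lambda>r. ennreal (indicator {0<..} r * (gauss_const p * unit_ball_volume p * real p * r ^ (p - 1) * exp (- r\<^sup>2 / 2))))"
  proof
    fix r :: real
    have "ennreal (unit_ball_volume p * real p * r ^ (p - 1)) * ?h r = ennreal (gauss_const p * unit_ball_volume p * real p * r ^ (p - 1) * exp (- r\<^sup>2 / 2))" if "r \<ge> 0"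
      using that unit_ball_volume_pos[of p] gauss_const_pos[of p] by (subst ennreal_mult[symmetric]) (auto simp: mult_ac)
    \<comment> \<open>The two indicators differ at r = 0 only, where r^(p - 1) vanishes because p
      \<ge> 2.\<close>
    thus "ennreal (unit_ball_volume p * real p * r ^ (p - 1)) * indicator {0..} r * ?h r
      = ennreal (indicator {0<..} r * (gauss_const p * unit_ball_volume p * real p * r ^ (p - 1) * exp (- r\<^sup>2 / 2)))"
      using assms by (cases "r = 0") (auto simp: indicator_def zero_power)
  qed
  finally show "distr (gauss p) lborel eucl_norm = density lborel (\<lambda>r. ennreal (indicator {0<..} r * (gauss_const p * unit_ball_volume p * real p * r ^ (p - 1) * exp (- r\<^sup>2 / 2))))" .
qed measurable

text \<open>Multiplying the standard normal density by exp (-s x^2 / 2) gives \<sigma> times the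
  centred normal density with variance \<sigma>^2 = 1 / (1 + s). The total mass is therefore
  \<sigma> and the second moment \<sigma>^3, the powers -1/2 and -3/2 of 1 + s.\<close>

lemma nn_normal_exp:
  assumes "s \<ge> 0"
  shows "(\<integral>\<^sup>+x. ennreal (std_normal_density x) * ennreal (exp (- s * x\<^sup>2 / 2)) \<partial>lborel) = ennreal ((1 + s) powr (- 1 / 2))"
    and "(\<integral>\<^sup>+x. ennreal (std_normal_density x) * ennreal (x\<^sup>2 * exp (- s * x\<^sup>2 / 2)) \<partial>lborel) = ennreal ((1 + s) powr (- 3 / 2))"
proof -
  define \<sigma> where "\<sigma> = (1 + s) powr (- 1 / 2)"
  have \<sigma>: "\<sigma> > 0" using assms by (simp add: \<sigma>_def)
  have \<sigma>2: "\<sigma>\<^sup>2 = 1 / (1 + s)"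
  proof -
    have "\<sigma>\<^sup>2 = (1 + s) powr (- 1)" using assms by (simp add: \<sigma>_def powr_power)
    also have "\<dots> = 1 / (1 + s)" using assms by (simp add: powr_minus_divide)
    finally show ?thesis .
  qed
  have eq: "std_normal_density x * exp (- s * x\<^sup>2 / 2) = \<sigma> * normal_density 0 \<sigma> x" for x
  proof -
    have "normal_density 0 \<sigma> x = 1 / (sqrt (2 * pi) * \<sigma>) * (exp (- x\<^sup>2 / 2) * exp (- s * x\<^sup>2 / 2))"
    proof -
      have "- (x - 0)\<^sup>2 / (2 * \<sigma>\<^sup>2) = - x\<^sup>2 / 2 + - s * x\<^sup>2 / 2"
        unfolding \<sigma>2 using assms by (simp add: field_simps)
      moreover have "sqrt (2 * pi * \<sigma>\<^sup>2) = sqrt (2 * pi) * \<sigma>"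
        using \<sigma> by (simp add: real_sqrt_mult)
      ultimately show ?thesis unfolding normal_density_def by (simp only: exp_add)
    qed
    thus ?thesis using \<sigma> by (simp add: std_normal_density_def)
  qed
  have "(\<integral>\<^sup>+x. ennreal (std_normal_density x) * ennreal (exp (- s * x\<^sup>2 / 2)) \<partial>lborel) = (\<integral>\<^sup>+x. ennreal (\<sigma> * normal_density 0 \<sigma> x) \<partial>lborel)"
    unfolding eq[symmetric] by (intro nn_integral_cong ennreal_mult[symmetric]) auto
  also have "\<dots> = ennreal (LBINT x. \<sigma> * normal_density 0 \<sigma> x)"
    using \<sigma> by (intro nn_integral_eq_integral) auto
  also have "\<dots> = ennreal \<sigma>" using \<sigma> by simp
  finally show "(\<integral>\<^sup>+x. ennreal (std_normal_density x) * ennreal (exp (- s * x\<^sup>2 / 2)) \<partial>lborel) = ennreal ((1 + s) powr (- 1 / 2))"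
    by (simp only: \<sigma>_def)
  have mom: "has_bochner_integral lborel (\<lambda>x. normal_density 0 \<sigma> x * x\<^sup>2) (\<sigma>\<^sup>2)"
    using normal_moment_even[OF \<sigma>, of 0 1] by (simp add: fact_numeral)
  have "(\<integral>\<^sup>+x. ennreal (std_normal_density x) * ennreal (x\<^sup>2 * exp (- s * x\<^sup>2 / 2)) \<partial>lborel) = (\<integral>\<^sup>+x. ennreal (\<sigma> * (normal_density 0 \<sigma> x * x\<^sup>2)) \<partial>lborel)"
  proof (rule nn_integral_cong)
    fix x :: real
    have "ennreal (std_normal_density x) * ennreal (x\<^sup>2 * exp (- s * x\<^sup>2 / 2)) = ennreal (std_normal_density x * exp (- s * x\<^sup>2 / 2) * x\<^sup>2)"
      by (subst ennreal_mult[symmetric]) (auto simp: mult_ac)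
    thus "ennreal (std_normal_density x) * ennreal (x\<^sup>2 * exp (- s * x\<^sup>2 / 2)) = ennreal (\<sigma> * (normal_density 0 \<sigma> x * x\<^sup>2))"
      unfolding eq by (simp only: mult.assoc)
  qed
  also have "\<dots> = ennreal (LBINT x. \<sigma> * (normal_density 0 \<sigma> x * x\<^sup>2))"
    using \<sigma> mom by (intro nn_integral_eq_integral) (auto simp: has_bochner_integral_iff)
  also have "\<dots> = ennreal (\<sigma> ^ 3)" using mom by (simp add: has_bochner_integral_iff power3_eq_cube power2_eq_square mult.assoc)
  also have "\<sigma> ^ 3 = (1 + s) powr (- 3 / 2)" using assms by (simp add: \<sigma>_def powr_power)
  finally show "(\<integral>\<^sup>+x. ennreal (std_normal_density x) * ennreal (x\<^sup>2 * exp (- s * x\<^sup>2 / 2)) \<partial>lborel) = ennreal ((1 + s) powr (- 3 / 2))" .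
qed

lemma nn_integral_gauss_square:
  assumes "i < p"
  shows "(\<integral>\<^sup>+v. ennreal ((v $ i)\<^sup>2) \<partial>gauss p) = 1"
proof -
  let ?g = "\<lambda>j x. if j = i then ennreal (x\<^sup>2) else 1"
  have "(\<integral>\<^sup>+v. ennreal ((v $ i)\<^sup>2) \<partial>gauss p) = (\<integral>\<^sup>+v. (\<Prod>j<p. ?g j (v $ j)) \<partial>gauss p)"
    using assms by (intro nn_integral_cong) (simp add: prod.delta)
  also have "\<dots> = (\<Prod>j<p. \<integral>\<^sup>+x. ennreal (std_normal_density x) * ?g j x \<partial>lborel)"
    by (rule nn_integral_gauss_prod) auto
  also have "\<dots> = (\<Prod>j<p. 1)"
  proof (rule prod.cong)
    fix j show "(\<integral>\<^sup>+x. ennreal (std_normal_density x) * ?g j x \<partial>lborel) = 1"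
      using nn_normal_exp[of 0] by (cases "j = i") auto
  qed simp
  finally show ?thesis by simp
qed

text \<open>From (r - 1)^2 \<ge> 0 one gets r \<le> 1 + r^2, and the squared norm is a sum of p
  squares, each of expectation 1.\<close>

lemma integrable_gauss_norm: "integrable (gauss p) eucl_norm"
proof (rule integrableI_bounded)
  show "eucl_norm \<in> borel_measurable (gauss p)"
    by (intro measurable_eucl_norm[of _ _ p] measurable_ident_sets) simp
  interpret prob_space "gauss p" by (rule prob_space_gauss)
  have "(\<integral>\<^sup>+v. ennreal (norm (eucl_norm v)) \<partial>gauss p) \<le> (\<integral>\<^sup>+v. 1 + (\<Sum>i<p. ennreal ((v $ i)\<^sup>2)) \<partial>gauss p)"
  proof (rule nn_integral_mono)
    fix v assume "v \<in> space (gauss p)"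
    hence v: "v \<in> carrier_vec p" by (simp add: space_gauss)
    have "eucl_norm v \<le> 1 + (eucl_norm v)\<^sup>2"
    proof -
      have "0 \<le> (eucl_norm v - 1)\<^sup>2" by simp
      thus ?thesis using eucl_norm_nonneg[of v] by (simp add: power2_eq_square algebra_simps)
    qed
    also have "(eucl_norm v)\<^sup>2 = (\<Sum>i<p. (v $ i)\<^sup>2)"
      unfolding eucl_norm_sq using v by (simp add: scalar_prod_def power2_eq_square atLeast0LessThan)
    finally have "ennreal (norm (eucl_norm v)) \<le> ennreal (1 + (\<Sum>i<p. (v $ i)\<^sup>2))"
      using eucl_norm_nonneg[of v] by (intro ennreal_leI) auto
    thus "ennreal (norm (eucl_norm v)) \<le> 1 + (\<Sum>i<p. ennreal ((v $ i)\<^sup>2))"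
      by (simp add: sum_nonneg)
  qed
  also have "\<dots> = 1 + (\<Sum>i<p. \<integral>\<^sup>+v. ennreal ((v $ i)\<^sup>2) \<partial>gauss p)"
  proof -
    have m: "(\<lambda>v. ennreal ((v $ i)\<^sup>2)) \<in> borel_measurable (gauss p)" if "i < p" for i
    proof -
      have "(\<lambda>v. v $ i) \<in> borel_measurable (gauss p)"
        by (rule measurable_Rvec_index[OF that]) (rule measurable_ident_sets, simp)
      thus ?thesis by simp
    qed
    have "(\<integral>\<^sup>+v. 1 + (\<Sum>i<p. ennreal ((v $ i)\<^sup>2)) \<partial>gauss p)
        = (\<integral>\<^sup>+v. 1 \<partial>gauss p) + (\<integral>\<^sup>+v. (\<Sum>i<p. ennreal ((v $ i)\<^sup>2)) \<partial>gauss p)"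
    proof (rule nn_integral_add)
      show "(\<lambda>v. \<Sum>i<p. ennreal ((v $ i)\<^sup>2)) \<in> borel_measurable (gauss p)"
        by (rule borel_measurable_sum) (rule m, simp)
    qed simp
    also have "(\<integral>\<^sup>+v. (\<Sum>i<p. ennreal ((v $ i)\<^sup>2)) \<partial>gauss p) = (\<Sum>i<p. \<integral>\<^sup>+v. ennreal ((v $ i)\<^sup>2) \<partial>gauss p)"
      by (rule nn_integral_sum) (rule m, simp)
    finally show ?thesis by (simp add: emeasure_space_1)
  qed
  also have "\<dots> = 1 + ennreal (real p)"
    by (simp add: nn_integral_gauss_square ennreal_of_nat_eq_real_of_nat)
  also have "\<dots> = ennreal (1 + real p)" by (subst ennreal_plus) auto
  also have "\<dots> < \<infinity>" by (simp add: ennreal_less_top)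
  finally show "(\<integral>\<^sup>+v. ennreal (norm (eucl_norm v)) \<partial>gauss p) < \<infinity>" .
qed

text \<open>This makes the model nonempty, so that the description defining \<open>tau\<close> is
  not vacuous. Dividing the radial density by r^(p - 1) leaves a positive multiple of exp (-r^2 /
  2), which is strictly decreasing.\<close>

lemma gauss_in_model:
  assumes "p \<ge> 2"
  shows "distr (gauss p) (Rvec p) (\<lambda>z. (U * L) *\<^sub>v z) \<in> elliptical p U L"
proof -
  let ?f = "\<lambda>r. gauss_const p * unit_ball_volume p * real p * r ^ (p - 1) * exp (- r\<^sup>2 / 2)"
  have c: "gauss_const p * unit_ball_volume p * real p > 0"
    using gauss_const_pos unit_ball_volume_pos assms by simp
  have "strict_antimono_on {0<..} (\<lambda>r. ?f r / r ^ (p - 1))"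
  proof (rule monotone_onI)
    fix r s :: real assume rs: "r \<in> {0<..}" "s \<in> {0<..}" "r < s"
    have "r\<^sup>2 < s\<^sup>2" using rs by (intro power_strict_mono) auto
    hence "gauss_const p * unit_ball_volume p * real p * exp (- s\<^sup>2 / 2) < gauss_const p * unit_ball_volume p * real p * exp (- r\<^sup>2 / 2)"
      using c by (intro mult_strict_left_mono) auto
    thus "?f r / r ^ (p - 1) > ?f s / s ^ (p - 1)" using rs by simp
  qed
  moreover have "\<forall>r>0. ?f r > 0" using c by simp
  ultimately have "\<exists>f. (\<forall>r>0. f r > 0) \<and>
      distributed (gauss p) lborel eucl_norm (\<lambda>r. ennreal (indicator {0<..} r * f r)) \<and>
      strict_antimono_on {0<..} (\<lambda>r. f r / r ^ (p - 1))"
    using gauss_norm_distributed[OF assms] by (intro exI[of _ ?f]) blast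
  thus ?thesis
    unfolding elliptical_def mem_Collect_eq
    by (rule_tac exI[of _ "gauss p"]) (simp add: prob_space_gauss spherical_gauss integrable_gauss_norm)
qed

section \<open>The moment of the leading coordinate under the Gaussian law\<close>

lemma nn_integral_halfline:
  fixes f :: "real \<Rightarrow> real"
  assumes int: "set_integrable lborel {0<..} f" and nonneg: "\<And>x. 0 < x \<Longrightarrow> 0 \<le> f x"
  shows "(\<integral>\<^sup>+x. ennreal (f x) * indicator {0<..} x \<partial>lborel) = ennreal (LBINT x:{0<..}. f x)"
proof -
  have "(\<integral>\<^sup>+x. ennreal (f x) * indicator {0<..} x \<partial>lborel) = (\<integral>\<^sup>+x. ennreal (indicator {0<..} x *\<^sub>R f x) \<partial>lborel)"
    by (intro nn_integral_cong) (auto simp: indicator_def)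
  also have "\<dots> = ennreal (LBINT x:{0<..}. f x)"
    unfolding set_lebesgue_integral_def
    by (rule nn_integral_eq_integral) (use int nonneg in \<open>auto simp: set_integrable_def indicator_def\<close>)
  finally show ?thesis .
qed

lemma nn_integral_exp_halfline:
  fixes a A :: real
  assumes "A > 0" "a \<ge> 0"
  shows "(\<integral>\<^sup>+t. ennreal (a / 2 * exp (- t * A / 2)) * indicator {0<..} t \<partial>lborel) = ennreal (a / A)"
proof -
  let ?F = "\<lambda>t. - (a / A * exp (- t * A / 2))"
  have lim: "(?F \<longlongrightarrow> 0) at_top" using assms(1) by real_asymp
  have der: "(?F has_real_derivative a / 2 * exp (- t * A / 2)) (at t)" for t
    using assms by (auto intro!: derivative_eq_intros)
  have nonneg: "0 \<le> a / 2 * exp (- t * A / 2)" for t using assms by simp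
  have "(\<integral>\<^sup>+t. ennreal (a / 2 * exp (- t * A / 2)) * indicator {0<..} t \<partial>lborel) = ennreal (LBINT t:{0<..}. a / 2 * exp (- t * A / 2))"
    by (rule nn_integral_halfline[OF halfline_FTC(1)[OF _ der nonneg lim] nonneg]) auto
  also have "(LBINT t:{0<..}. a / 2 * exp (- t * A / 2)) = 0 - ?F 0"
    by (rule halfline_FTC(2)[OF _ der nonneg lim]) auto
  finally show ?thesis by simp
qed

text \<open>The squared norm of diag(l, 1, ..., 1) v. Written as a correction of the scalar product
  in coordinate 0, it is visibly invariant under orthogonal maps that preserve the square of that
  coordinate, and after division by the squared norm it depends on the cosine with the first axis
  only.\<close>

definition qform :: "real \<Rightarrow> real Matrix.vec \<Rightarrow> real" where
  "qform l v = (l\<^sup>2 - 1) * (v $ 0)\<^sup>2 + v \<bullet> v"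

lemma qform_eq_sum:
  assumes "v \<in> carrier_vec p" "p > 0"
  shows "qform l v = (\<Sum>k<p. (if k = 0 then l else 1)\<^sup>2 * (v $ k)\<^sup>2)"
proof -
  obtain q where p: "p = Suc q" using assms(2) gr0_implies_Suc by blast
  show ?thesis using assms(1)
    unfolding qform_def scalar_prod_def p
    by (simp add: atLeast0LessThan sum.lessThan_Suc_shift power2_eq_square algebra_simps del: sum.lessThan_Suc)
qed

lemma qform_ge: "1 \<le> l \<Longrightarrow> v \<bullet> v \<le> qform l v"
  by (simp add: qform_def)

lemma qform_nonneg: "1 \<le> l \<Longrightarrow> 0 \<le> qform l v"
  using qform_ge[of l v] scalar_prod_ge_0[of v] by linarith

lemma gauss_value:
  assumes p: "p \<ge> 2" and l: "l \<ge> 1"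
  shows "(\<integral>\<^sup>+v. ennreal (l\<^sup>2 * (v $ 0)\<^sup>2 / qform l v) \<partial>gauss p) = ennreal (tau_integral l p)"
proof -
  obtain q where q: "p = Suc q" using p by (cases p) auto
  interpret G: prob_space "gauss p" by (rule prob_space_gauss)
  interpret P: pair_sigma_finite "gauss p" lborel ..
  have mult3: "ennreal (a * b * c) = ennreal a * ennreal b * ennreal c" if "0 \<le> a" "0 \<le> b" "0 \<le> c" for a b c :: real
    using that by (simp add: ennreal_mult)
  let ?h = "\<lambda>v t. ennreal (l\<^sup>2 * (v $ 0)\<^sup>2 / 2 * exp (- t * qform l v / 2)) * indicator {0<..} t"
  have f: "fst \<in> gauss p \<Otimes>\<^sub>M lborel \<rightarrow>\<^sub>M Rvec p"
    using measurable_fst[of "gauss p" lborel] measurable_cong_sets[OF refl sets_gauss] by auto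
  have s: "snd \<in> gauss p \<Otimes>\<^sub>M lborel \<rightarrow>\<^sub>M borel"
    using measurable_snd[of "gauss p" lborel] by simp
  have m: "(\<lambda>x. fst x $ 0) \<in> borel_measurable (gauss p \<Otimes>\<^sub>M lborel)"
    by (rule measurable_Rvec_index[OF _ f]) (use p in simp)
  have mq: "(\<lambda>x. qform l (fst x)) \<in> borel_measurable (gauss p \<Otimes>\<^sub>M lborel)"
    unfolding qform_def by (intro borel_measurable_add borel_measurable_times borel_measurable_power m measurable_scalar_prod[OF f f] borel_measurable_const)
  have meas: "case_prod ?h \<in> borel_measurable (gauss p \<Otimes>\<^sub>M lborel)"
    unfolding split_beta' using m s mq by measurable
  \<comment> \<open>For fixed t the integrand is a product over coordinates: coordinate 0 gives a
    second moment with parameter l^2 t, and each of the other q = p - 1 coordinates gives a mass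
    with parameter t.\<close>
  have inner: "(\<integral>\<^sup>+v. ?h v t \<partial>gauss p) = ennreal (l\<^sup>2 / 2 * ((1 + l\<^sup>2 * t) powr (- 3 / 2) * (1 + t) powr ((1 - real p) / 2))) * indicator {0<..} t" for t
  proof (cases "t > 0")
    case True
    let ?g = "\<lambda>i x. if i = 0 then ennreal (l\<^sup>2 / 2) * ennreal (x\<^sup>2 * exp (- (l\<^sup>2 * t) * x\<^sup>2 / 2)) else ennreal (exp (- t * x\<^sup>2 / 2))"
    have "(\<integral>\<^sup>+v. ?h v t \<partial>gauss p) = (\<integral>\<^sup>+v. (\<Prod>i<p. ?g i (v $ i)) \<partial>gauss p)"
    proof (rule nn_integral_cong)
      fix v assume "v \<in> space (gauss p)"
      hence v: "v \<in> carrier_vec p" by (simp add: space_gauss)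
      have "- t * qform l v / 2 = - (l\<^sup>2 * t) * (v $ 0)\<^sup>2 / 2 + (\<Sum>i<q. - t * (v $ Suc i)\<^sup>2 / 2)"
      proof -
        have "qform l v = l\<^sup>2 * (v $ 0)\<^sup>2 + (\<Sum>i<q. (v $ Suc i)\<^sup>2)"
          using qform_eq_sum[OF v, of l] unfolding q sum.lessThan_Suc_shift by simp
        moreover have "(\<Sum>i<q. - t * (v $ Suc i)\<^sup>2 / 2) = - t * (\<Sum>i<q. (v $ Suc i)\<^sup>2) / 2"
          by (simp only: sum_distrib_left sum_divide_distrib)
        ultimately show ?thesis by (simp add: algebra_simps add_divide_distrib diff_divide_distrib)
      qed
      hence "l\<^sup>2 * (v $ 0)\<^sup>2 / 2 * exp (- t * qform l v / 2)
        = l\<^sup>2 / 2 * ((v $ 0)\<^sup>2 * exp (- (l\<^sup>2 * t) * (v $ 0)\<^sup>2 / 2)) * (\<Prod>i<q. exp (- t * (v $ Suc i)\<^sup>2 / 2))"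
        by (simp only: exp_add exp_sum finite_lessThan) simp
      hence "ennreal (l\<^sup>2 * (v $ 0)\<^sup>2 / 2 * exp (- t * qform l v / 2))
        = ennreal (l\<^sup>2 / 2) * ennreal ((v $ 0)\<^sup>2 * exp (- (l\<^sup>2 * t) * (v $ 0)\<^sup>2 / 2)) * (\<Prod>i<q. ennreal (exp (- t * (v $ Suc i)\<^sup>2 / 2)))"
      proof (elim ssubst)
        show "ennreal (l\<^sup>2 / 2 * ((v $ 0)\<^sup>2 * exp (- (l\<^sup>2 * t) * (v $ 0)\<^sup>2 / 2)) * (\<Prod>i<q. exp (- t * (v $ Suc i)\<^sup>2 / 2)))
          = ennreal (l\<^sup>2 / 2) * ennreal ((v $ 0)\<^sup>2 * exp (- (l\<^sup>2 * t) * (v $ 0)\<^sup>2 / 2)) * (\<Prod>i<q. ennreal (exp (- t * (v $ Suc i)\<^sup>2 / 2)))"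
          by (subst mult3) (simp_all add: prod_nonneg prod_ennreal)
      qed
      thus "?h v t = (\<Prod>i<p. ?g i (v $ i))"
        using True by (simp add: q prod.lessThan_Suc_shift del: prod.lessThan_Suc)
    qed
    also have "\<dots> = (\<Prod>i<p. \<integral>\<^sup>+x. ennreal (std_normal_density x) * ?g i x \<partial>lborel)"
      by (rule nn_integral_gauss_prod) auto
    also have "\<dots> = (\<integral>\<^sup>+x. ennreal (std_normal_density x) * (ennreal (l\<^sup>2 / 2) * ennreal (x\<^sup>2 * exp (- (l\<^sup>2 * t) * x\<^sup>2 / 2))) \<partial>lborel)
        * (\<Prod>i<q. \<integral>\<^sup>+x. ennreal (std_normal_density x) * ennreal (exp (- t * x\<^sup>2 / 2)) \<partial>lborel)"
      by (simp add: q prod.lessThan_Suc_shift del: prod.lessThan_Suc)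
    also have "(\<integral>\<^sup>+x. ennreal (std_normal_density x) * (ennreal (l\<^sup>2 / 2) * ennreal (x\<^sup>2 * exp (- (l\<^sup>2 * t) * x\<^sup>2 / 2))) \<partial>lborel)
        = ennreal (l\<^sup>2 / 2) * (\<integral>\<^sup>+x. ennreal (std_normal_density x) * ennreal (x\<^sup>2 * exp (- (l\<^sup>2 * t) * x\<^sup>2 / 2)) \<partial>lborel)"
      by (subst nn_integral_cmult[symmetric]) (auto intro!: nn_integral_cong simp: mult_ac)
    also have "\<dots> = ennreal (l\<^sup>2 / 2) * ennreal ((1 + l\<^sup>2 * t) powr (- 3 / 2))"
      by (subst nn_normal_exp(2)) (use True in auto)
    also have "(\<Prod>i<q. \<integral>\<^sup>+x. ennreal (std_normal_density x) * ennreal (exp (- t * x\<^sup>2 / 2)) \<partial>lborel) = ennreal (((1 + t) powr (- 1 / 2)) ^ q)"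
      by (subst nn_normal_exp(1)) (use True in \<open>auto simp: ennreal_power\<close>)
    also have "((1 + t) powr (- 1 / 2)) ^ q = (1 + t) powr ((1 - real p) / 2)"
      using True by (simp add: powr_power q)
    also have "ennreal (l\<^sup>2 / 2) * ennreal ((1 + l\<^sup>2 * t) powr (- 3 / 2)) * ennreal ((1 + t) powr ((1 - real p) / 2))
        = ennreal (l\<^sup>2 / 2 * ((1 + l\<^sup>2 * t) powr (- 3 / 2) * (1 + t) powr ((1 - real p) / 2)))"
      by (subst mult3[symmetric]) (simp_all add: mult.assoc)
    finally show ?thesis using True by simp
  qed simp
  have "(\<integral>\<^sup>+v. ennreal (l\<^sup>2 * (v $ 0)\<^sup>2 / qform l v) \<partial>gauss p) = (\<integral>\<^sup>+v. (\<integral>\<^sup>+t. ?h v t \<partial>lborel) \<partial>gauss p)"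
  proof (rule nn_integral_cong)
    fix v assume "v \<in> space (gauss p)"
    hence v: "v \<in> carrier_vec p" by (simp add: space_gauss)
    show "ennreal (l\<^sup>2 * (v $ 0)\<^sup>2 / qform l v) = (\<integral>\<^sup>+t. ?h v t \<partial>lborel)"
    \<comment> \<open>At the origin both sides are 0: the quotient because division by zero yields
      0, the integral because its factor v_0^2 vanishes. The identity thus holds at every
      point.\<close>
    proof (cases "qform l v = 0")
      case True
      hence "v \<bullet> v = 0" using qform_ge[OF l, of v] scalar_prod_ge_0[of v] by linarith
      hence "v $ 0 = 0" using v p by (simp add: scalar_prod_self_eq_0)
      thus ?thesis by simp
    next
      case False
      hence "qform l v > 0" using qform_nonneg[OF l, of v] by simp
      thus ?thesis by (rule nn_integral_exp_halfline[symmetric]) simp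
    qed
  qed
  also have "\<dots> = (\<integral>\<^sup>+t. (\<integral>\<^sup>+v. ?h v t \<partial>gauss p) \<partial>lborel)"
    by (rule P.Fubini'[OF meas, symmetric])
  also have "\<dots> = ennreal (LBINT t:{0<..}. l\<^sup>2 / 2 * ((1 + l\<^sup>2 * t) powr (- 3 / 2) * (1 + t) powr ((1 - real p) / 2)))"
    unfolding inner
    by (rule nn_integral_halfline) (use tau_add_tau0_integral(1)[OF p, of l] l in auto)
  also have "\<dots> = ennreal (tau_integral l p)"
    by (simp add: tau_integral_def)
  finally show ?thesis .
qed

section \<open>Spherical laws\<close>

lemma spherical_nn_integral:
  assumes sph: "spherical p Q" and sets: "sets Q = sets (Rvec p)"
    and V: "V \<in> orthogonal_mats p" and h: "h \<in> borel_measurable (Rvec p)"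
  shows "(\<integral>\<^sup>+z. h (V *\<^sub>v z) \<partial>Q) = (\<integral>\<^sup>+z. h z \<partial>Q)"
proof -
  have m: "(\<lambda>z. V *\<^sub>v z) \<in> Q \<rightarrow>\<^sub>M Rvec p"
    by (intro measurable_mult_mat_vec[OF orthogonal_carrier[OF V]] measurable_ident_sets sets)
  have "(\<integral>\<^sup>+z. h z \<partial>Q) = (\<integral>\<^sup>+z. h z \<partial>distr Q (Rvec p) (\<lambda>z. V *\<^sub>v z))"
    using sph V by (simp add: spherical_def)
  also have "\<dots> = (\<integral>\<^sup>+z. h (V *\<^sub>v z) \<partial>Q)"
    by (rule nn_integral_distr[OF m]) (use h in simp)
  finally show ?thesis ..
qed

lemma spherical_integral:
  assumes sph: "spherical p Q" and sets: "sets Q = sets (Rvec p)"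
    and V: "V \<in> orthogonal_mats p" and h: "h \<in> borel_measurable (Rvec p)"
  shows "(\<integral>z. h (V *\<^sub>v z) \<partial>Q) = (\<integral>z. (h z :: real) \<partial>Q)"
proof -
  have m: "(\<lambda>z. V *\<^sub>v z) \<in> Q \<rightarrow>\<^sub>M Rvec p"
    by (intro measurable_mult_mat_vec[OF orthogonal_carrier[OF V]] measurable_ident_sets sets)
  have "(\<integral>z. h z \<partial>Q) = (\<integral>z. h z \<partial>distr Q (Rvec p) (\<lambda>z. V *\<^sub>v z))"
    using sph V by (simp add: spherical_def)
  also have "\<dots> = (\<integral>z. h (V *\<^sub>v z) \<partial>Q)"
    by (rule integral_distr[OF m h])
  finally show ?thesis ..
qed

text \<open>Some orthogonal V has the normalised vector b = a / norm a as its first row, so that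
  coordinate 0 of V z is the scalar product of z with b. Since V keeps norms, sphericity replaces V
  z by z.\<close>

lemma spherical_direction:
  assumes sph: "spherical p Q" and sets: "sets Q = sets (Rvec p)" and p: "p > 0"
    and a: "a \<in> carrier_vec p" "a \<noteq> 0\<^sub>v p" and F: "F \<in> borel_measurable borel"
  shows "(\<integral>\<^sup>+z. F (z \<bullet> a / (eucl_norm z * eucl_norm a)) \<partial>Q) = (\<integral>\<^sup>+z. F (z $ 0 / eucl_norm z) \<partial>Q)"
proof -
  have sp: "space Q = carrier_vec p" using sets_eq_imp_space_eq[OF sets] by (simp add: space_Rvec)
  have na: "eucl_norm a \<noteq> 0" using a by (simp add: eucl_norm_eq_0)
  define b where "b = (1 / eucl_norm a) \<cdot>\<^sub>v a"
  have b: "b \<in> carrier_vec p" using a by (simp add: b_def)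
  have bb: "b \<bullet> b = 1"
  proof -
    have "b \<bullet> b = 1 / eucl_norm a * (1 / eucl_norm a * (a \<bullet> a))"
      unfolding b_def using a by simp
    also have "a \<bullet> a = eucl_norm a * eucl_norm a" by (simp add: eucl_norm_sq[unfolded power2_eq_square])
    finally show ?thesis using na by simp
  qed
  have zb: "z \<bullet> a / (eucl_norm z * eucl_norm a) = z \<bullet> b / eucl_norm z" if "z \<in> carrier_vec p" for z
    using that a by (simp add: b_def)
  have e: "unit_vec p 0 \<bullet> v = v $ 0" if "v \<in> carrier_vec p" for v :: "real Matrix.vec"
    using that p by simp
  obtain V where V: "V \<in> orthogonal_mats p" "\<And>z. z \<in> carrier_vec p \<Longrightarrow> (V *\<^sub>v z) $ 0 = z \<bullet> b"
  proof (cases "b = unit_vec p 0")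
    case True
    show ?thesis by (rule that[of "1\<^sub>m p"]) (auto simp: orthogonal_mats_def True p)
  next
    case False
    \<comment> \<open>The reflection along w exchanges b and the first basis vector. As both have
      length 1, w . w = 2 w_0, which makes the coefficient in the reflection formula come out
      exactly. The case of equal vectors, where w = 0, has been split off.\<close>
    define w where "w = unit_vec p 0 - b"
    have w: "w \<in> carrier_vec p" using b by (simp add: w_def)
    have wz: "w \<bullet> z = z $ 0 - z \<bullet> b" if "z \<in> carrier_vec p" for z
      using that b e[OF that] unfolding w_def
      by (simp add: minus_scalar_prod_distrib[of _ p] comm_scalar_prod[of b p z])
    have w0: "w $ 0 = 1 - b $ 0" using p b by (simp add: w_def)
    have "w \<bullet> w = w $ 0 - w \<bullet> b" by (rule wz[OF w])
    also have "w \<bullet> b = b $ 0 - 1" using wz[OF b] bb by simp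
    finally have ww: "w \<bullet> w = 2 * w $ 0" using w0 by simp
    have "w \<noteq> 0\<^sub>v p"
    proof
      assume "w = 0\<^sub>v p"
      have "unit_vec p 0 $ i = b $ i" if "i < p" for i
      proof -
        have "w $ i = 0" using \<open>w = 0\<^sub>v p\<close> that by simp
        thus ?thesis using that b by (simp add: w_def)
      qed
      hence "unit_vec p 0 = b" using b by (intro eq_vecI) auto
      with False show False by simp
    qed
    hence nz: "w \<bullet> w \<noteq> 0" using w by (simp add: scalar_prod_self_eq_0)
    show ?thesis
    proof (rule that)
      show "reflection p w \<in> orthogonal_mats p" by (rule reflection_orthogonal[OF w nz])
      fix z :: "real Matrix.vec" assume z: "z \<in> carrier_vec p"
      have "(reflection p w *\<^sub>v z) $ 0 = z $ 0 - 2 * (w \<bullet> z) / (w \<bullet> w) * w $ 0"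
        by (rule reflection_mult_vec[OF w z p])
      also have "2 * (w \<bullet> z) / (w \<bullet> w) * w $ 0 = w \<bullet> z" using nz unfolding ww by simp
      finally show "(reflection p w *\<^sub>v z) $ 0 = z \<bullet> b" using wz[OF z] by simp
    qed
  qed
  have m: "(\<lambda>z. F (z $ 0 / eucl_norm z)) \<in> borel_measurable (Rvec p)"
    by (intro measurable_compose[OF borel_measurable_divide F] measurable_eucl_norm[of _ _ p] measurable_Rvec_index[OF p] measurable_ident_sets refl)
  have "(\<integral>\<^sup>+z. F (z \<bullet> a / (eucl_norm z * eucl_norm a)) \<partial>Q) = (\<integral>\<^sup>+z. F ((V *\<^sub>v z) $ 0 / eucl_norm (V *\<^sub>v z)) \<partial>Q)"
    by (intro nn_integral_cong) (simp add: sp zb V(2) orthogonal_eucl_norm[OF V(1)])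
  also have "\<dots> = (\<integral>\<^sup>+z. F (z $ 0 / eucl_norm z) \<partial>Q)"
    by (rule spherical_nn_integral[OF sph sets V(1) m])
  finally show ?thesis .
qed

lemma spherical_direction_unique:
  assumes Q: "prob_space Q" "spherical p Q" "sets Q = sets (Rvec p)" "AE z in Q. eucl_norm z \<noteq> 0"
    and Q': "prob_space Q'" "spherical p Q'" "sets Q' = sets (Rvec p)" "AE z in Q'. eucl_norm z \<noteq> 0"
    and p: "p > 0" and F: "F \<in> borel_measurable borel"
  shows "(\<integral>\<^sup>+z. F (z $ 0 / eucl_norm z) \<partial>Q) = (\<integral>\<^sup>+z. F (z $ 0 / eucl_norm z) \<partial>Q')"
proof -
  interpret Q: prob_space Q by fact
  interpret Q': prob_space Q' by fact
  interpret P: pair_sigma_finite Q Q' ..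
  have sp: "space Q = carrier_vec p" "space Q' = carrier_vec p"
    using sets_eq_imp_space_eq[OF Q(3)] sets_eq_imp_space_eq[OF Q'(3)] by (simp_all add: space_Rvec)
  let ?c = "\<lambda>z a. z \<bullet> a / (eucl_norm z * eucl_norm a)"
  have f: "fst \<in> Q \<Otimes>\<^sub>M Q' \<rightarrow>\<^sub>M Rvec p" "snd \<in> Q \<Otimes>\<^sub>M Q' \<rightarrow>\<^sub>M Rvec p"
    using measurable_fst[of Q Q'] measurable_snd[of Q Q'] measurable_cong_sets[OF refl Q(3)] measurable_cong_sets[OF refl Q'(3)] by auto
  have meas: "case_prod (\<lambda>z a. F (?c z a)) \<in> borel_measurable (Q \<Otimes>\<^sub>M Q')"
    unfolding split_beta'
    by (intro measurable_compose[OF _ F] borel_measurable_divide borel_measurable_times measurable_scalar_prod[of _ _ p] measurable_eucl_norm[of _ _ p] f)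
  have "(\<integral>\<^sup>+z. F (z $ 0 / eucl_norm z) \<partial>Q) = (\<integral>\<^sup>+a. (\<integral>\<^sup>+z. F (z $ 0 / eucl_norm z) \<partial>Q) \<partial>Q')"
    by (simp add: Q'.emeasure_space_1)
  also have "\<dots> = (\<integral>\<^sup>+a. (\<integral>\<^sup>+z. F (?c z a) \<partial>Q) \<partial>Q')"
  proof (rule nn_integral_cong_AE)
    show "AE a in Q'. (\<integral>\<^sup>+z. F (z $ 0 / eucl_norm z) \<partial>Q) = (\<integral>\<^sup>+z. F (?c z a) \<partial>Q)"
      using Q'(4) AE_space
    proof eventually_elim
      case (elim a)
      thus ?case
        using spherical_direction[OF Q(2,3) p _ _ F, of a] by (simp add: sp eucl_norm_eq_0)
    qed
  qed
  also have "\<dots> = (\<integral>\<^sup>+z. (\<integral>\<^sup>+a. F (?c z a) \<partial>Q') \<partial>Q)"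
    by (rule P.Fubini'[OF meas])
  also have "\<dots> = (\<integral>\<^sup>+z. (\<integral>\<^sup>+a. F (a $ 0 / eucl_norm a) \<partial>Q') \<partial>Q)"
  proof (rule nn_integral_cong_AE)
    show "AE z in Q. (\<integral>\<^sup>+a. F (?c z a) \<partial>Q') = (\<integral>\<^sup>+a. F (a $ 0 / eucl_norm a) \<partial>Q')"
      using Q(4) AE_space
    proof eventually_elim
      case (elim z)
      hence z: "z \<in> carrier_vec p" by (simp add: sp)
      have "(\<integral>\<^sup>+a. F (?c z a) \<partial>Q') = (\<integral>\<^sup>+a. F (?c a z) \<partial>Q')"
        by (intro nn_integral_cong) (simp add: sp comm_scalar_prod[OF z] mult.commute)
      thus ?case
        using spherical_direction[OF Q'(2,3) p z _ F] elim z by (simp add: eucl_norm_eq_0)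
    qed
  qed
  also have "\<dots> = (\<integral>\<^sup>+a. F (a $ 0 / eucl_norm a) \<partial>Q')"
    by (simp add: Q.emeasure_space_1)
  finally show ?thesis .
qed

section \<open>The sign covariance matrix\<close>

definition axis_scale :: "real \<Rightarrow> nat \<Rightarrow> real" where
  "axis_scale l k = (if k = 0 then l else 1)"

text \<open>The product of two coordinates is at most the mean of their squares, and each square is
  one term of the sum \<open>qform\<close>. The quotients below are therefore bounded by 1 and
  integrable under any probability law.\<close>

lemma abs_axis_le_qform:
  assumes "v \<in> carrier_vec p" "k < p" "m < p"
  shows "\<bar>axis_scale l k * v $ k * (axis_scale l m * v $ m)\<bar> \<le> qform l v"
proof -
  let ?y = "\<lambda>k. axis_scale l k * v $ k"
  have le: "(?y k)\<^sup>2 \<le> qform l v" if "k < p" for k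
    using that assms(1) member_le_sum[of k "{..<p}" "\<lambda>k. (?y k)\<^sup>2"]
    by (subst qform_eq_sum[of v p]) (auto simp: axis_scale_def power_mult_distrib)
  have "0 \<le> (\<bar>?y k\<bar> - \<bar>?y m\<bar>)\<^sup>2" by simp
  hence "2 * (\<bar>?y k\<bar> * \<bar>?y m\<bar>) \<le> (?y k)\<^sup>2 + (?y m)\<^sup>2"
    by (simp add: power2_diff)
  also have "\<dots> \<le> 2 * qform l v" using le[OF assms(2)] le[OF assms(3)] by simp
  finally show ?thesis by (simp add: abs_mult)
qed

text \<open>Entry (k, m) of the sign covariance matrix before the rotation by U; the scale \<sigma>
  cancels in the quotient.\<close>

definition radial_moment :: "real \<Rightarrow> real Matrix.vec measure \<Rightarrow> nat \<Rightarrow> nat \<Rightarrow> real" where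
  "radial_moment l Q k m = (\<integral>z. axis_scale l k * z $ k * (axis_scale l m * z $ m) / qform l z \<partial>Q)"

section \<open>Second moments of the rescaled direction under a spherical law\<close>

context
  fixes p :: nat and l :: real and Q :: "real Matrix.vec measure"
  assumes p: "p \<ge> 2" and l: "l > 1"
    and prob: "prob_space Q" and sets: "sets Q = sets (Rvec p)" and sph: "spherical p Q"
    and AE: "AE z in Q. eucl_norm z \<noteq> 0"
begin

lemma space_Q: "space Q = carrier_vec p"
  using sets_eq_imp_space_eq[OF sets] by (simp add: space_Rvec)

lemma measurable_coord: "k < p \<Longrightarrow> (\<lambda>z. z $ k) \<in> borel_measurable (Rvec p)"
  by (rule measurable_Rvec_index) (auto intro: measurable_ident_sets)

lemma measurable_qform: "qform l \<in> borel_measurable (Rvec p)"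
proof -
  have "(\<lambda>z. z \<bullet> z) \<in> borel_measurable (Rvec p)"
    by (rule measurable_scalar_prod[of _ _ p]) (rule measurable_ident_sets, rule refl)+
  moreover have "(\<lambda>z. z $ 0) \<in> borel_measurable (Rvec p)"
    by (rule measurable_coord) (use p in simp)
  ultimately show ?thesis unfolding qform_def[abs_def] by measurable
qed

lemma measurable_ratio:
  "k < p \<Longrightarrow> m < p \<Longrightarrow> (\<lambda>z. axis_scale l k * z $ k * (axis_scale l m * z $ m) / qform l z) \<in> borel_measurable (Rvec p)"
  using measurable_coord measurable_qform by measurable

lemma integrable_ratio:
  assumes "k < p" "m < p"
  shows "integrable Q (\<lambda>z. axis_scale l k * z $ k * (axis_scale l m * z $ m) / qform l z)"
proof -
  interpret prob_space Q by (rule prob)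
  show ?thesis
  proof (rule integrable_const_bound[where B=1])
    show "(\<lambda>z. axis_scale l k * z $ k * (axis_scale l m * z $ m) / qform l z) \<in> borel_measurable Q"
      using measurable_ratio[OF assms] measurable_cong_sets[OF sets refl] by blast
    show "AE z in Q. norm (axis_scale l k * z $ k * (axis_scale l m * z $ m) / qform l z) \<le> 1"
    proof (rule AE_I2)
      fix z assume "z \<in> space Q"
      hence z: "z \<in> carrier_vec p" by (simp add: space_Q)
      have "\<bar>axis_scale l k * z $ k * (axis_scale l m * z $ m)\<bar> \<le> qform l z"
        by (rule abs_axis_le_qform[OF z assms])
      thus "norm (axis_scale l k * z $ k * (axis_scale l m * z $ m) / qform l z) \<le> 1"
        using qform_nonneg[of l z] l by (cases "qform l z = 0") (auto simp: abs_mult divide_le_eq_1)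
    qed
  qed
qed

lemma qform_AE_pos: "AE z in Q. qform l z > 0"
  using AE
proof eventually_elim
  case (elim z)
  have "z \<bullet> z \<noteq> 0" using elim by (simp add: eucl_norm_def)
  thus ?case using qform_ge[of l z] scalar_prod_ge_0[of z] l by linarith
qed

text \<open>The reflection along the k-th basis vector changes the sign of coordinate k only. It
  preserves \<open>qform\<close> and negates the integrand, so the moment equals its own
  negative.\<close>

lemma radial_moment_off:
  assumes k: "k < p" and m: "m < p" and km: "k \<noteq> m"
  shows "radial_moment l Q k m = 0"
proof -
  let ?w = "unit_vec p k :: real Matrix.vec"
  have ww: "?w \<bullet> ?w = 1" using k by simp
  have V: "reflection p ?w \<in> orthogonal_mats p"
    by (rule reflection_orthogonal) (simp_all add: ww)
  have R: "(reflection p ?w *\<^sub>v z) $ i = (if i = k then - z $ i else z $ i)" if "z \<in> carrier_vec p" "i < p" for z i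
    using that k by (subst reflection_mult_vec) (auto simp: ww)
  have q: "qform l (reflection p ?w *\<^sub>v z) = qform l z" if "z \<in> carrier_vec p" for z
    using that p R[of z 0] orthogonal_scalar_prod[OF V, of z z] by (simp add: qform_def)
  have "radial_moment l Q k m = (\<integral>z. axis_scale l k * (reflection p ?w *\<^sub>v z) $ k * (axis_scale l m * (reflection p ?w *\<^sub>v z) $ m) / qform l (reflection p ?w *\<^sub>v z) \<partial>Q)"
    unfolding radial_moment_def
    by (rule spherical_integral[OF sph sets V measurable_ratio[OF k m], symmetric])
  also have "\<dots> = (\<integral>z. - (axis_scale l k * z $ k * (axis_scale l m * z $ m) / qform l z) \<partial>Q)"
  proof (rule Bochner_Integration.integral_cong)
    fix z assume "z \<in> space Q"
    hence z: "z \<in> carrier_vec p" by (simp add: space_Q)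
    have "(reflection p ?w *\<^sub>v z) $ k = - z $ k" "(reflection p ?w *\<^sub>v z) $ m = z $ m"
      using R[OF z] k m km by simp_all
    thus "axis_scale l k * (reflection p ?w *\<^sub>v z) $ k * (axis_scale l m * (reflection p ?w *\<^sub>v z) $ m) / qform l (reflection p ?w *\<^sub>v z)
        = - (axis_scale l k * z $ k * (axis_scale l m * z $ m) / qform l z)"
      unfolding q[OF z] by simp
  qed simp
  also have "\<dots> = - radial_moment l Q k m"
    unfolding radial_moment_def by simp
  finally show ?thesis by simp
qed

text \<open>The reflection along the difference of the two basis vectors swaps coordinates k and m.
  Both indices are positive, so coordinate 0, the only one with scale l, stays in place and
  \<open>qform\<close> is unchanged.\<close>

lemma radial_moment_eq:
  assumes k: "0 < k" "k < p" and m: "0 < m" "m < p"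
  shows "radial_moment l Q k k = radial_moment l Q m m"
proof (cases "k = m")
  case False
  let ?w = "unit_vec p k - unit_vec p m :: real Matrix.vec"
  have w: "?w \<in> carrier_vec p" by simp
  have wz: "?w \<bullet> z = z $ k - z $ m" if "z \<in> carrier_vec p" for z
    using that k m by (simp add: minus_scalar_prod_distrib[of _ p])
  have ww: "?w \<bullet> ?w = 2" unfolding wz[OF w] using k m False by simp
  have V: "reflection p ?w \<in> orthogonal_mats p"
    by (rule reflection_orthogonal[OF w]) (simp add: ww)
  have R: "(reflection p ?w *\<^sub>v z) $ i = z $ i - (z $ k - z $ m) * ?w $ i" if "z \<in> carrier_vec p" "i < p" for z i
    using reflection_mult_vec[OF w that] unfolding ww wz[OF that(1)] by simp
  have q: "qform l (reflection p ?w *\<^sub>v z) = qform l z" if "z \<in> carrier_vec p" for z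
  proof -
    have "(reflection p ?w *\<^sub>v z) $ 0 = z $ 0" using R[OF that, of 0] k m p by simp
    thus ?thesis using orthogonal_scalar_prod[OF V that that] by (simp add: qform_def)
  qed
  have "radial_moment l Q k k = (\<integral>z. axis_scale l k * (reflection p ?w *\<^sub>v z) $ k * (axis_scale l k * (reflection p ?w *\<^sub>v z) $ k) / qform l (reflection p ?w *\<^sub>v z) \<partial>Q)"
    unfolding radial_moment_def
    by (rule spherical_integral[OF sph sets V measurable_ratio[OF k(2) k(2)], symmetric])
  also have "\<dots> = (\<integral>z. axis_scale l m * z $ m * (axis_scale l m * z $ m) / qform l z \<partial>Q)"
  proof (rule Bochner_Integration.integral_cong)
    fix z assume "z \<in> space Q"
    hence z: "z \<in> carrier_vec p" by (simp add: space_Q)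
    have "(reflection p ?w *\<^sub>v z) $ k = z $ m"
      using R[OF z k(2)] k m False by simp
    thus "axis_scale l k * (reflection p ?w *\<^sub>v z) $ k * (axis_scale l k * (reflection p ?w *\<^sub>v z) $ k) / qform l (reflection p ?w *\<^sub>v z)
        = axis_scale l m * z $ m * (axis_scale l m * z $ m) / qform l z"
      unfolding q[OF z] using k m by (simp add: axis_scale_def)
  qed simp
  finally show ?thesis unfolding radial_moment_def .
qed simp

lemma radial_moment_sum: "(\<Sum>k<p. radial_moment l Q k k) = 1"
proof -
  interpret prob_space Q by (rule prob)
  have "(\<Sum>k<p. radial_moment l Q k k) = (\<integral>z. (\<Sum>k<p. axis_scale l k * z $ k * (axis_scale l k * z $ k) / qform l z) \<partial>Q)"
    unfolding radial_moment_def by (rule Bochner_Integration.integral_sum[symmetric]) (rule integrable_ratio, simp_all)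
  also have "\<dots> = (\<integral>z. 1 \<partial>Q)"
  proof (rule integral_cong_AE)
    show "(\<lambda>z. \<Sum>k<p. axis_scale l k * z $ k * (axis_scale l k * z $ k) / qform l z) \<in> borel_measurable Q"
      by (rule borel_measurable_sum) (rule borel_measurable_integrable, rule integrable_ratio, simp_all)
    show "AE z in Q. (\<Sum>k<p. axis_scale l k * z $ k * (axis_scale l k * z $ k) / qform l z) = 1"
      using qform_AE_pos AE_space
    proof eventually_elim
      case (elim z)
      hence z: "z \<in> carrier_vec p" by (simp add: space_Q)
      have "(\<Sum>k<p. axis_scale l k * z $ k * (axis_scale l k * z $ k)) = qform l z"
        using qform_eq_sum[OF z, of l] p by (simp add: axis_scale_def power2_eq_square mult_ac)
      thus ?case using elim by (simp add: sum_divide_distrib[symmetric])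
    qed
  qed simp
  also have "\<dots> = 1" by (simp add: prob_space)
  finally show ?thesis .
qed

text \<open>Dividing numerator and denominator by the squared norm turns the integrand into a
  function F of the cosine with the first axis. Its expectation is common to all spherical laws
  without an atom at the origin, so the Gaussian value applies.\<close>

lemma radial_moment_0: "radial_moment l Q 0 0 = tau_integral l p"
proof -
  define F where "F c = ennreal (l\<^sup>2 * c\<^sup>2 / ((l\<^sup>2 - 1) * c\<^sup>2 + 1))" for c :: real
  have F: "F \<in> borel_measurable borel" unfolding F_def[abs_def] by measurable
  have p0: "0 < p" using p by simp
  have l0: "l > 0" using l by simp
  have Feq: "ennreal (l\<^sup>2 * (z $ 0)\<^sup>2 / qform l z) = F (z $ 0 / eucl_norm z)" if "eucl_norm z \<noteq> 0" for z
  proof -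
    have "l\<^sup>2 * (z $ 0)\<^sup>2 / qform l z = (l\<^sup>2 * (z $ 0)\<^sup>2 / (eucl_norm z)\<^sup>2) / (qform l z / (eucl_norm z)\<^sup>2)"
      using that by simp
    also have "qform l z / (eucl_norm z)\<^sup>2 = (l\<^sup>2 - 1) * (z $ 0 / eucl_norm z)\<^sup>2 + 1"
      using that unfolding qform_def eucl_norm_sq[symmetric] by (simp add: add_divide_distrib power_divide)
    finally show ?thesis by (simp only: F_def power_divide times_divide_eq_right)
  qed
  have gauss_AE: "AE z in gauss p. eucl_norm z \<noteq> 0"
  proof -
    have "AE r in distr (gauss p) lborel eucl_norm. r \<noteq> 0"
      unfolding distributed_distr_eq_density[OF gauss_norm_distributed[OF p]]
      by (subst AE_density) (auto simp: indicator_def intro!: AE_I2)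
    thus ?thesis
      by (rule AE_distrD[rotated]) (rule distributed_measurable[OF gauss_norm_distributed[OF p]])
  qed
  have nn: "(\<integral>\<^sup>+z. ennreal (axis_scale l 0 * z $ 0 * (axis_scale l 0 * z $ 0) / qform l z) \<partial>Q) = ennreal (radial_moment l Q 0 0)"
    unfolding radial_moment_def
  proof (rule nn_integral_eq_integral[OF integrable_ratio[OF p0 p0]])
    show "AE z in Q. 0 \<le> axis_scale l 0 * z $ 0 * (axis_scale l 0 * z $ 0) / qform l z"
      using l qform_nonneg[of l] by (intro AE_I2 divide_nonneg_nonneg) auto
  qed
  have nonneg: "0 \<le> radial_moment l Q 0 0"
    unfolding radial_moment_def using l qform_nonneg[of l] by (intro Bochner_Integration.integral_nonneg divide_nonneg_nonneg) auto
  have "ennreal (radial_moment l Q 0 0) = (\<integral>\<^sup>+z. F (z $ 0 / eucl_norm z) \<partial>Q)"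
    unfolding nn[symmetric]
  proof (rule nn_integral_cong_AE)
    show "AE z in Q. ennreal (axis_scale l 0 * z $ 0 * (axis_scale l 0 * z $ 0) / qform l z) = F (z $ 0 / eucl_norm z)"
      using AE by eventually_elim (simp add: Feq[symmetric] axis_scale_def power2_eq_square mult_ac)
  qed
  also have "\<dots> = (\<integral>\<^sup>+z. F (z $ 0 / eucl_norm z) \<partial>gauss p)"
    by (rule spherical_direction_unique[OF prob sph sets AE prob_space_gauss spherical_gauss sets_gauss gauss_AE p0 F])
  also have "\<dots> = (\<integral>\<^sup>+z. ennreal (l\<^sup>2 * (z $ 0)\<^sup>2 / qform l z) \<partial>gauss p)"
    by (rule nn_integral_cong_AE) (use gauss_AE in \<open>eventually_elim, simp add: Feq\<close>)
  also have "\<dots> = ennreal (tau_integral l p)"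
    by (rule gauss_value) (use p l in auto)
  finally have "ennreal (radial_moment l Q 0 0) = ennreal (tau_integral l p)" .
  \<comment> \<open>Equality in \<open>ennreal\<close> determines a real number only when both sides
    are nonnegative; here the sign follows from the lower bound 1/p.\<close>
  moreover have "0 \<le> tau_integral l p"
  proof -
    have "1 / real p < tau_integral l p"
      using tau_integral_less_l[OF p, of 1 l] l by (simp add: tau_integral_one[OF p])
    thus ?thesis by (meson divide_nonneg_nonneg less_imp_le of_nat_0_le_iff order_trans zero_le_one)
  qed
  ultimately show ?thesis using nonneg by simp
qed

text \<open>The p - 1 moments with positive index are equal, and with the leading one they sum to 1.
  The integrals satisfy the same relation, which identifies the common value.\<close>

lemma radial_moment_diag:
  assumes "k < p"
  shows "radial_moment l Q k k = (if k = 0 then tau_integral l p else tau0_integral l p)"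
proof (cases "k = 0")
  case True thus ?thesis by (simp add: radial_moment_0)
next
  case False
  obtain q where q: "p = Suc q" using p by (cases p) auto
  have "(\<Sum>i<q. radial_moment l Q (Suc i) (Suc i)) = (\<Sum>i<q. radial_moment l Q k k)"
    by (intro sum.cong refl radial_moment_eq) (use False assms q in auto)
  hence "1 = tau_integral l p + real q * radial_moment l Q k k"
    using radial_moment_sum by (simp add: q sum.lessThan_Suc_shift radial_moment_0[unfolded q] del: sum.lessThan_Suc)
  moreover have "tau_integral l p + real q * tau0_integral l p = 1"
    using tau_add_tau0_integral(2)[OF p, of l] l by (simp add: q)
  ultimately have "real q * radial_moment l Q k k = real q * tau0_integral l p" by linarith
  moreover have "real q \<noteq> 0" using p q by simp
  ultimately show ?thesis using False by simp
qed

end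

section \<open>Diagonal form and spectrum of the sign covariance matrix\<close>

lemma Lambda_mat_mult_vec:
  assumes "z \<in> carrier_vec p" "k < p"
  shows "(Lambda_mat p \<sigma> l *\<^sub>v z) $ k = \<sigma> * (axis_scale l k * z $ k)"
proof -
  have "(Lambda_mat p \<sigma> l *\<^sub>v z) $ k = (\<Sum>j\<in>{0..<p}. \<sigma> * (if k = j then axis_scale l k * z $ j else 0))"
    using assms by (auto simp: Lambda_mat_def mat_diag_def scalar_prod_def axis_scale_def intro!: sum.cong)
  also have "\<dots> = \<sigma> * (axis_scale l k * z $ k)"
    using assms by (simp add: sum_distrib_left[symmetric])
  finally show ?thesis .
qed

lemma mult_mat_vec_index_sum:
  assumes "A \<in> carrier_mat n p" "v \<in> carrier_vec p" "i < n"
  shows "(A *\<^sub>v v) $ i = (\<Sum>k\<in>{0..<p}. A $$ (i, k) * v $ k)"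
  using assms by (auto simp: scalar_prod_def intro!: sum.cong)

lemma Lambda_mat_carrier: "Lambda_mat p \<sigma> l \<in> carrier_mat p p"
  by (simp add: Lambda_mat_def)

text \<open>With X = \<sigma> U Y and Y the rescaled spherical vector, U preserves the norm and
  \<sigma>^2 cancels. Each entry becomes a double sum of products of entries of U with moments of Y,
  and the vanishing mixed moments reduce it to the entry of U D U'.\<close>

lemma sign_cov_elliptical:
  assumes p: "p \<ge> 2" and l: "l > 1" and U: "U \<in> orthogonal_mats p" and \<sigma>: "\<sigma> > 0"
    and P: "P \<in> elliptical p U (Lambda_mat p \<sigma> l)"
  shows "sign_cov p P = U * mat_diag p (\<lambda>k. if k = 0 then tau_integral l p else tau0_integral l p) * U\<^sup>T"
proof -
  let ?L = "Lambda_mat p \<sigma> l"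
  let ?t = "\<lambda>k. if k = 0 then tau_integral l p else tau0_integral l p"
  from P obtain Q f where Q: "prob_space Q" "sets Q = sets (Rvec p)" "P = distr Q (Rvec p) (\<lambda>z. (U * ?L) *\<^sub>v z)"
     "spherical p Q" and dist: "distributed Q lborel eucl_norm (\<lambda>r. ennreal (indicator {0<..} r * f r))"
    unfolding elliptical_def by blast
  have AE: "AE z in Q. eucl_norm z \<noteq> 0"
  proof -
    have "AE r in distr Q lborel eucl_norm. r \<noteq> 0"
      unfolding distributed_distr_eq_density[OF dist]
      using distributed_borel_measurable[OF dist]
      by (subst AE_density) (auto simp: indicator_def intro!: AE_I2)
    thus ?thesis
      by (rule AE_distrD[rotated]) (rule distributed_measurable[OF dist])
  qed
  note R = p l Q(1,2,4) AE
  have Uc: "U \<in> carrier_mat p p" by (rule orthogonal_carrier[OF U])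
  have UL: "U * ?L \<in> carrier_mat p p" using Uc Lambda_mat_carrier by (rule mult_carrier_mat)
  have sp: "space Q = carrier_vec p" using sets_eq_imp_space_eq[OF Q(2)] by (simp add: space_Rvec)
  have m: "(\<lambda>z. (U * ?L) *\<^sub>v z) \<in> Q \<rightarrow>\<^sub>M Rvec p"
    by (rule measurable_mult_mat_vec[OF UL]) (rule measurable_ident_sets[OF Q(2)])
  have entry: "sign_cov p P $$ (i, j) = (\<Sum>k<p. U $$ (i, k) * U $$ (j, k) * ?t k)" if ij: "i < p" "j < p" for i j
  proof -
    have mf: "(\<lambda>x. x $ i * x $ j / (eucl_norm x)\<^sup>2) \<in> borel_measurable (Rvec p)"
      by (intro borel_measurable_divide borel_measurable_times borel_measurable_power measurable_eucl_norm[of _ _ p]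
        measurable_Rvec_index[OF ij(1)] measurable_Rvec_index[OF ij(2)] measurable_ident_sets refl)
    have "sign_cov p P $$ (i, j) = (\<integral>x. x $ i * x $ j / (eucl_norm x)\<^sup>2 \<partial>P)"
      using ij by (simp add: sign_cov_def)
    also have "\<dots> = (\<integral>z. ((U * ?L) *\<^sub>v z) $ i * ((U * ?L) *\<^sub>v z) $ j / (eucl_norm ((U * ?L) *\<^sub>v z))\<^sup>2 \<partial>Q)"
      unfolding Q(3) by (rule integral_distr[OF m mf])
    also have "\<dots> = (\<integral>z. (\<Sum>k<p. \<Sum>n<p. U $$ (i, k) * U $$ (j, n) * (axis_scale l k * z $ k * (axis_scale l n * z $ n) / qform l z)) \<partial>Q)"
    proof (rule Bochner_Integration.integral_cong)
      fix z assume "z \<in> space Q"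
      hence z: "z \<in> carrier_vec p" by (simp add: sp)
      have Lz: "?L *\<^sub>v z \<in> carrier_vec p" using Lambda_mat_carrier z by (rule mult_mat_vec_carrier)
      have x: "(U * ?L) *\<^sub>v z = U *\<^sub>v (?L *\<^sub>v z)"
        using Uc Lambda_mat_carrier z by (rule assoc_mult_mat_vec)
      have xi: "((U * ?L) *\<^sub>v z) $ i = \<sigma> * (\<Sum>k<p. U $$ (i, k) * (axis_scale l k * z $ k))" if "i < p" for i
      proof -
        have "(U *\<^sub>v (?L *\<^sub>v z)) $ i = (\<Sum>k\<in>{0..<p}. U $$ (i, k) * (?L *\<^sub>v z) $ k)"
          by (rule mult_mat_vec_index_sum[OF Uc Lz that])
        also have "\<dots> = (\<Sum>k\<in>{0..<p}. \<sigma> * (U $$ (i, k) * (axis_scale l k * z $ k)))"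
          by (intro sum.cong) (auto simp: Lambda_mat_mult_vec[OF z])
        finally show ?thesis unfolding x by (simp add: sum_distrib_left atLeast0LessThan)
      qed
      have "(eucl_norm ((U * ?L) *\<^sub>v z))\<^sup>2 = (?L *\<^sub>v z) \<bullet> (?L *\<^sub>v z)"
        unfolding x orthogonal_eucl_norm[OF U Lz] eucl_norm_sq ..
      also have "\<dots> = (\<Sum>k\<in>{0..<p}. (?L *\<^sub>v z) $ k * (?L *\<^sub>v z) $ k)"
        unfolding scalar_prod_def carrier_vecD[OF Lz] ..
      also have "\<dots> = (\<Sum>k\<in>{0..<p}. \<sigma>\<^sup>2 * ((if k = 0 then l else 1)\<^sup>2 * (z $ k)\<^sup>2))"
        by (intro sum.cong) (auto simp: Lambda_mat_mult_vec[OF z] axis_scale_def power2_eq_square mult_ac)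
      also have "\<dots> = \<sigma>\<^sup>2 * qform l z"
        using qform_eq_sum[OF z, of l] p by (simp add: sum_distrib_left atLeast0LessThan)
      finally have nx: "(eucl_norm ((U * ?L) *\<^sub>v z))\<^sup>2 = \<sigma>\<^sup>2 * qform l z" .
      have "((U * ?L) *\<^sub>v z) $ i * ((U * ?L) *\<^sub>v z) $ j / (eucl_norm ((U * ?L) *\<^sub>v z))\<^sup>2
        = (\<Sum>k<p. U $$ (i, k) * (axis_scale l k * z $ k)) * (\<Sum>n<p. U $$ (j, n) * (axis_scale l n * z $ n)) / qform l z"
        unfolding nx xi[OF ij(1)] xi[OF ij(2)] using \<sigma> by (simp add: power2_eq_square)
      also have "\<dots> = (\<Sum>k<p. \<Sum>n<p. U $$ (i, k) * U $$ (j, n) * (axis_scale l k * z $ k * (axis_scale l n * z $ n) / qform l z))"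
        unfolding sum_product sum_divide_distrib by (intro sum.cong refl) (simp add: mult_ac)
      finally show "((U * ?L) *\<^sub>v z) $ i * ((U * ?L) *\<^sub>v z) $ j / (eucl_norm ((U * ?L) *\<^sub>v z))\<^sup>2 = \<dots>" .
    qed simp
    also have "\<dots> = (\<Sum>k<p. \<integral>z. (\<Sum>n<p. U $$ (i, k) * U $$ (j, n) * (axis_scale l k * z $ k * (axis_scale l n * z $ n) / qform l z)) \<partial>Q)"
      by (rule Bochner_Integration.integral_sum)
         (rule Bochner_Integration.integrable_sum, rule integrable_mult_right, rule integrable_ratio[OF R], simp_all)
    also have "\<dots> = (\<Sum>k<p. \<Sum>n<p. U $$ (i, k) * U $$ (j, n) * radial_moment l Q k n)"
    proof (rule sum.cong)
      fix k assume k: "k \<in> {..<p}"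
      have "(\<integral>z. (\<Sum>n<p. U $$ (i, k) * U $$ (j, n) * (axis_scale l k * z $ k * (axis_scale l n * z $ n) / qform l z)) \<partial>Q)
         = (\<Sum>n<p. \<integral>z. U $$ (i, k) * U $$ (j, n) * (axis_scale l k * z $ k * (axis_scale l n * z $ n) / qform l z) \<partial>Q)"
        by (rule Bochner_Integration.integral_sum)
           (rule integrable_mult_right, rule integrable_ratio[OF R], use k in simp_all)
      also have "\<dots> = (\<Sum>n<p. U $$ (i, k) * U $$ (j, n) * radial_moment l Q k n)"
        unfolding radial_moment_def by (intro sum.cong refl integral_mult_right_zero)
      finally show "(\<integral>z. (\<Sum>n<p. U $$ (i, k) * U $$ (j, n) * (axis_scale l k * z $ k * (axis_scale l n * z $ n) / qform l z)) \<partial>Q) = \<dots>" .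
    qed simp
    also have "\<dots> = (\<Sum>k<p. \<Sum>n<p. if n = k then U $$ (i, k) * U $$ (j, k) * ?t k else 0)"
    proof (intro sum.cong refl)
      fix k n assume kn: "k \<in> {..<p}" "n \<in> {..<p}"
      show "U $$ (i, k) * U $$ (j, n) * radial_moment l Q k n = (if n = k then U $$ (i, k) * U $$ (j, k) * ?t k else 0)"
        using radial_moment_diag[OF R, of k] radial_moment_off[OF R, of k n] kn by auto
    qed
    also have "\<dots> = (\<Sum>k<p. U $$ (i, k) * U $$ (j, k) * ?t k)"
      by (intro sum.cong refl) simp
    finally show ?thesis .
  qed
  show ?thesis
  proof (rule eq_matI)
    fix i j assume "i < dim_row (U * mat_diag p ?t * U\<^sup>T)" "j < dim_col (U * mat_diag p ?t * U\<^sup>T)"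
    hence ij: "i < p" "j < p" using Uc by auto
    have UD: "(U * mat_diag p ?t) $$ (i, k) = U $$ (i, k) * ?t k" if "k < p" for k
    proof -
      have "(U * mat_diag p ?t) $$ (i, k) = (\<Sum>n\<in>{0..<p}. U $$ (i, n) * mat_diag p ?t $$ (n, k))"
        using that ij Uc by (simp add: scalar_prod_def mat_diag_def)
      also have "\<dots> = (\<Sum>n\<in>{0..<p}. if n = k then U $$ (i, k) * ?t k else 0)"
        by (intro sum.cong refl) (use that in \<open>auto simp: mat_diag_def\<close>)
      finally show ?thesis using that by simp
    qed
    have "(U * mat_diag p ?t * U\<^sup>T) $$ (i, j) = (\<Sum>k\<in>{0..<p}. (U * mat_diag p ?t) $$ (i, k) * U\<^sup>T $$ (k, j))"
      using ij Uc by (auto simp: scalar_prod_def mat_diag_def intro!: sum.cong)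
    also have "\<dots> = (\<Sum>k\<in>{0..<p}. U $$ (i, k) * U $$ (j, k) * ?t k)"
      using ij Uc by (intro sum.cong refl) (simp add: UD mult_ac del: index_mult_mat)
    finally show "sign_cov p P $$ (i, j) = (U * mat_diag p ?t * U\<^sup>T) $$ (i, j)"
      using entry[OF ij] by (simp add: atLeast0LessThan)
  qed (use Uc in \<open>auto simp: sign_cov_def\<close>)
qed

lemma poly_linear_factors_eq_0:
  fixes k :: real
  shows "poly (\<Prod>a\<leftarrow>xs. [:- a, 1:]) k = 0 \<longleftrightarrow> k \<in> set xs"
  by (induction xs) auto

text \<open>Conjugation by U is a similarity, so the characteristic polynomial is that of the
  diagonal matrix, a product of linear factors. As p \<ge> 2, index 0 contributes t and index 1
  contributes s, and the spectrum is exactly these values.\<close>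

lemma largest_eigenvalue_orthogonal_diag:
  assumes U: "U \<in> orthogonal_mats p" and p: "p \<ge> 2" and st: "s \<le> (t :: real)"
  shows "largest_eigenvalue (U * mat_diag p (\<lambda>k. if k = 0 then t else s) * U\<^sup>T) = t"
proof -
  let ?d = "\<lambda>k. if k = 0 then t else s"
  let ?D = "mat_diag p ?d" and ?A = "U * mat_diag p ?d * U\<^sup>T"
  have Uc: "U \<in> carrier_mat p p" by (rule orthogonal_carrier[OF U])
  have D: "?D \<in> carrier_mat p p" by simp
  have A: "?A \<in> carrier_mat p p" using mult_carrier_mat[OF mult_carrier_mat[OF Uc D], of "U\<^sup>T" p] Uc by simp
  have "similar_mat_wit ?A ?D U U\<^sup>T"
  proof (rule similar_mat_witI[of _ _ p])
    show "U * U\<^sup>T = 1\<^sub>m p" "U\<^sup>T * U = 1\<^sub>m p" using U by (simp_all add: orthogonal_mats_def)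
    show "U\<^sup>T \<in> carrier_mat p p" using Uc by simp
  qed (rule refl A D Uc)+
  hence "similar_mat ?A ?D" unfolding similar_mat_def by blast
  hence cp: "char_poly ?A = char_poly ?D" by (rule char_poly_similar)
  have diag: "diag_mat ?D = map ?d [0..<p]"
    by (auto simp: diag_mat_def mat_diag_def)
  have cpD: "char_poly ?D = (\<Prod>a\<leftarrow>diag_mat ?D. [:- a, 1:])"
    by (rule char_poly_upper_triangular[OF D]) (auto simp: mat_diag_def upper_triangular_def)
  have "eigenvalue ?A k \<longleftrightarrow> k \<in> set (diag_mat ?D)" for k
    unfolding eigenvalue_root_char_poly[OF A] cp cpD
    by (rule poly_linear_factors_eq_0)
  moreover have "set (diag_mat ?D) = {s, t}"
  proof -
    have "?d ` {0..<p} = {s, t}"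
    proof (intro equalityI subsetI)
      fix x assume "x \<in> {s, t}"
      moreover have "t \<in> ?d ` {0..<p}" by (rule image_eqI[of _ _ 0]) (use p in auto)
      moreover have "s \<in> ?d ` {0..<p}" by (rule image_eqI[of _ _ 1]) (use p in auto)
      ultimately show "x \<in> ?d ` {0..<p}" by auto
    qed auto
    thus ?thesis unfolding diag by simp
  qed
  ultimately have "spectrum ?A = {s, t}" by (auto simp: spectrum_def)
  thus ?thesis using st by (simp add: largest_eigenvalue_def max_def)
qed

text \<open>For l > 1 every member of the model has \<open>tau_integral\<close> as its largest
  eigenvalue, and the Gaussian member with U = 1 and \<sigma> = 1 forces any t that fits the
  description to be this value. For l = 1 the equation is the definition.\<close>

lemma tau_eq_integral:
  assumes p: "p \<ge> 2" and l: "l \<ge> 1"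
  shows "tau l p = tau_integral l p"
proof (cases "l = 1")
  case True thus ?thesis by (simp add: tau_def)
next
  case False
  hence l: "l > 1" using l by simp
  \<comment> \<open>The eigenvalues average 1/p. The simple one exceeds 1/p by monotonicity in l,
    hence the repeated one cannot be larger.\<close>
  have le: "tau0_integral l p \<le> tau_integral l p"
  proof -
    have t: "1 / real p < tau_integral l p"
      using tau_integral_less_l[OF p, of 1 l] l by (simp add: tau_integral_one[OF p])
    have "(real p - 1) * tau0_integral l p = 1 - tau_integral l p"
      using tau_add_tau0_integral(2)[OF p, of l] l by simp
    also have "\<dots> \<le> (real p - 1) * tau_integral l p"
    proof -
      have "1 < real p * tau_integral l p"
        using t p by (simp add: pos_divide_less_eq mult.commute)
      thus ?thesis by (simp add: algebra_simps)
    qed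
    finally show ?thesis using p by simp
  qed
  have val: "largest_eigenvalue (sign_cov p P) = tau_integral l p"
    if "U \<in> orthogonal_mats p" "\<sigma> > 0" "P \<in> elliptical p U (Lambda_mat p \<sigma> l)" for U \<sigma> P
    unfolding sign_cov_elliptical[OF p l that] by (rule largest_eigenvalue_orthogonal_diag[OF that(1) p le])
  have one: "1\<^sub>m p \<in> orthogonal_mats p" by (simp add: orthogonal_mats_def)
  have "(THE t. \<forall>U\<in>orthogonal_mats p. \<forall>\<sigma>>0. \<forall>P\<in>elliptical p U (Lambda_mat p \<sigma> l).
                 largest_eigenvalue (sign_cov p P) = t) = tau_integral l p"
  proof (rule the_equality)
    fix t assume t: "\<forall>U\<in>orthogonal_mats p. \<forall>\<sigma>>0. \<forall>P\<in>elliptical p U (Lambda_mat p \<sigma> l). largest_eigenvalue (sign_cov p P) = t"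
    note in_model = gauss_in_model[OF p, of "1\<^sub>m p" "Lambda_mat p 1 l"]
    have t': "largest_eigenvalue (sign_cov p P) = t"
      if "U \<in> orthogonal_mats p" "0 < \<sigma>" "P \<in> elliptical p U (Lambda_mat p \<sigma> l)" for U \<sigma> P
      using t that by blast
    have "(0 :: real) < 1" by simp
    thus "t = tau_integral l p"
      using t'[OF one _ in_model] val[OF one _ in_model] by simp
  qed (intro ballI allI impI val)
  thus ?thesis using l by (simp add: tau_def)
qed

section \<open>The critical shape parameter\<close>

lemma tau0_eq_integral:
  assumes "p \<ge> 2" "l \<ge> 1"
  shows "tau0 l p = tau0_integral l p"
proof -
  have "1 - tau l p = (real p - 1) * tau0_integral l p"
    using tau_add_tau0_integral(2)[of p l] assms by (simp add: tau_eq_integral)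
  thus ?thesis using assms by (simp add: tau0_def)
qed

text \<open>\<open>tau_integral\<close> starts at 1/p, tends to 1 and is continuous, so it attains
  1/2; strict monotonicity makes the description in \<open>lambda_star\<close> unambiguous.\<close>

lemma lambda_star_root:
  assumes p: "p \<ge> 2"
  shows "lambda_star p \<ge> 1" and "tau_integral (lambda_star p) p = 1 / 2"
proof -
  have "\<forall>\<^sub>F l in at_top. tau_integral l p > 1 / 2"
    using order_tendstoD(1)[OF tau_integral_tendsto_l[OF p], of "1 / 2"] by simp
  then obtain b where b: "b \<ge> 1" "tau_integral b p > 1 / 2"
    using eventually_happens'[OF _ eventually_conj[OF _ eventually_ge_at_top[of 1]]] by force
  \<comment> \<open>Equality occurs for p = 2: the root is then the boundary point 1, which is why
    the range of l has to include it.\<close>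
  have "tau_integral 1 p \<le> 1 / 2" using p by (simp add: tau_integral_one)
  then obtain l where l: "1 \<le> l" "l \<le> b" "tau_integral l p = 1 / 2"
    using IVT'[of "\<lambda>l. tau_integral l p" 1 "1 / 2" b] b
      continuous_on_subset[OF continuous_on_tau_integral[OF p], of "{1..b}"] by auto
  have "lambda_star p = l"
    unfolding lambda_star_def
  proof (rule the_equality)
    show "1 \<le> l \<and> tau l p - 1 / 2 = 0" using l p by (simp add: tau_eq_integral)
    fix m assume "1 \<le> m \<and> tau m p - 1 / 2 = 0"
    hence m: "1 \<le> m" "tau_integral m p = 1 / 2" using tau_eq_integral[OF p, of m] by auto
    show "m = l"
      using tau_integral_less_l[OF p, of l m] tau_integral_less_l[OF p, of m l] l m
      by (cases m l rule: linorder_cases) auto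
  qed
  thus "lambda_star p \<ge> 1" "tau_integral (lambda_star p) p = 1 / 2" using l by auto
qed

lemma lambda_star_bounds:
  assumes p: "p \<ge> 2" and l: "l \<ge> 1"
  shows "tau_integral l p < 1 / 2 \<Longrightarrow> l < lambda_star p" and "tau_integral l p > 1 / 2 \<Longrightarrow> lambda_star p < l"
  using lambda_star_root[OF p] l tau_integral_less_l[OF p, of l "lambda_star p"] tau_integral_less_l[OF p, of "lambda_star p" l]
  by (cases l "lambda_star p" rule: linorder_cases; force)+

text \<open>With C the critical constant, the limits of \<open>tau_integral\<close> along 2 C sqrt p
  and C/2 sqrt p lie strictly on opposite sides of 1/2. For large p the root is thus caught between
  these two multiples of sqrt p, and the powers with \<epsilon> outgrow the constants. The
  comparison needs arguments of at least 1, which \<open>ge\<close> supplies.\<close>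

lemma lambda_star_asymp:
  assumes e: "\<epsilon> > (0 :: real)"
  shows "\<forall>\<^sub>F p in sequentially. real p powr (1 / 2 - \<epsilon>) < lambda_star p \<and> lambda_star p < real p powr (1 / 2 + \<epsilon>)"
proof -
  obtain C where C: "\<bar>C - 1.634\<bar> < 0.0005" "\<And>D. 0 < D \<Longrightarrow> limit_integral D = 1 / 2 \<longleftrightarrow> D = C"
    by (rule limit_integral_half) blast
  have Cpos: "C > 1" using C(1) unfolding abs_less_iff by simp
  have half: "limit_integral C = 1 / 2" using C(2)[of C] Cpos by simp
  have "limit_integral (2 * C) < 1 / 2" "limit_integral (C / 2) > 1 / 2"
    using limit_integral_less[of C "2 * C"] limit_integral_less[of "C / 2" C] Cpos half by simp_all
  hence lim: "\<forall>\<^sub>F p in sequentially. tau_integral (2 * C * sqrt (real p)) p > 1 / 2"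
    "\<forall>\<^sub>F p in sequentially. tau_integral (C / 2 * sqrt (real p)) p < 1 / 2"
    using order_tendstoD(1)[OF tau_integral_scaled_tendsto[of "2 * C"], of "1 / 2"]
      order_tendstoD(2)[OF tau_integral_scaled_tendsto[of "C / 2"], of "1 / 2"] Cpos by simp_all
  have up: "\<forall>\<^sub>F p in sequentially. 2 * C * sqrt (real p) < real p powr (1 / 2 + \<epsilon>)"
    and low: "\<forall>\<^sub>F p in sequentially. real p powr (1 / 2 - \<epsilon>) < C / 2 * sqrt (real p)"
    and ge: "\<forall>\<^sub>F p in sequentially. 1 \<le> C / 2 * sqrt (real p)"
    using e Cpos by real_asymp+
  show ?thesis
    using lim up low ge eventually_ge_at_top[of 2]
  proof eventually_elim
    case (elim p)
    have "C / 2 * sqrt (real p) \<le> 2 * C * sqrt (real p)"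
      using Cpos by (intro mult_right_mono) auto
    thus ?case
      using lambda_star_bounds(2)[of p "2 * C * sqrt (real p)"] lambda_star_bounds(1)[of p "C / 2 * sqrt (real p)"] elim
      by linarith
  qed
qed

lemma tau_scaled_tendsto:
  assumes "C > 0"
  shows "(\<lambda>p. tau (C * sqrt (real p)) p) \<longlonglongrightarrow> 1 - limit_integral C"
proof (rule Lim_transform_eventually[OF tau_integral_scaled_tendsto[OF assms]])
  have "\<forall>\<^sub>F p in sequentially. 1 \<le> C * sqrt (real p)" using assms by real_asymp
  thus "\<forall>\<^sub>F p in sequentially. tau_integral (C * sqrt (real p)) p = tau (C * sqrt (real p)) p"
    using eventually_ge_at_top[of 2] by eventually_elim (simp add: tau_eq_integral)
qed

lemma smallo_inverse_real:
  assumes "(\<lambda>p. real p * f p) \<longlonglongrightarrow> c"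
  shows "(\<lambda>p. f p - c / real p) \<in> o(\<lambda>p. 1 / real p)"
proof (rule smalloI_tendsto)
  have "(\<lambda>p. real p * f p - c) \<longlonglongrightarrow> 0" using assms by (simp add: LIM_zero)
  thus "(\<lambda>p. (f p - c / real p) / (1 / real p)) \<longlonglongrightarrow> 0"
    by (rule Lim_transform_eventually)
       (rule eventually_mono[OF eventually_gt_at_top[of 0]], simp add: field_simps)
  show "\<forall>\<^sub>F p in sequentially. 1 / real p \<noteq> 0"
    by (rule eventually_mono[OF eventually_gt_at_top[of 0]]) simp
qed

theorem theorem5:
  shows
    "(\<forall>l>1. strict_antimono_on {2..} (\<lambda>p. tau l p) \<and>
        (\<lambda>p. tau l p - l\<^sup>2 / real p) \<in> o(\<lambda>p. 1 / real p)) \<and>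
     (\<forall>l>1. strict_antimono_on {2..} (\<lambda>p. tau0 l p) \<and>
        (\<lambda>p. tau0 l p - 1 / real p) \<in> o(\<lambda>p. 1 / real p)) \<and>
     (\<forall>p\<ge>2. strict_mono_on {1..} (\<lambda>l. tau l p) \<and>
        (\<lambda>l. tau l p - 1) \<in> o[at_top](\<lambda>_. 1)) \<and>
     (strict_mono_on {2..} lambda_star \<and>
        (\<forall>\<epsilon>>0. \<forall>\<^sub>F p in sequentially.
           real p powr (1 / 2 - \<epsilon>) < lambda_star p \<and>
           lambda_star p < real p powr (1 / 2 + \<epsilon>))) \<and>
     ((\<exists>!C. C > 0 \<and> (\<lambda>p. tau (C * sqrt (real p)) p) \<longlonglongrightarrow> 1 / 2) \<and>
      (\<forall>C. C > 0 \<and> (\<lambda>p. tau (C * sqrt (real p)) p) \<longlonglongrightarrow> 1 / 2 \<longrightarrow>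
         \<bar>C - 1.634\<bar> < 0.0005))"
proof (intro conjI allI impI)
  fix l :: real assume l: "l > 1"
  show "strict_antimono_on {2..} (\<lambda>p. tau l p)"
    by (rule monotone_onI) (use l in \<open>simp add: tau_eq_integral tau_integral_less_p\<close>)
  have "(\<lambda>p. real p * tau l p) \<longlonglongrightarrow> l\<^sup>2"
    by (rule Lim_transform_eventually[OF tau_integral_asymp])
       (use l in \<open>auto intro!: eventually_mono[OF eventually_ge_at_top[of 2]] simp: tau_eq_integral\<close>)
  thus "(\<lambda>p. tau l p - l\<^sup>2 / real p) \<in> o(\<lambda>p. 1 / real p)" by (rule smallo_inverse_real)
next
  fix l :: real assume l: "l > 1"
  show "strict_antimono_on {2..} (\<lambda>p. tau0 l p)"
    by (rule monotone_onI) (use l in \<open>simp add: tau0_eq_integral tau0_integral_less_p\<close>)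
  have "(\<lambda>p. real p * tau0 l p) \<longlonglongrightarrow> 1"
    by (rule Lim_transform_eventually[OF tau0_integral_asymp])
       (use l in \<open>auto intro!: eventually_mono[OF eventually_ge_at_top[of 2]] simp: tau0_eq_integral\<close>)
  thus "(\<lambda>p. tau0 l p - 1 / real p) \<in> o(\<lambda>p. 1 / real p)" by (rule smallo_inverse_real)
next
  fix p :: nat assume p: "p \<ge> 2"
  show "strict_mono_on {1..} (\<lambda>l. tau l p)"
    by (rule monotone_onI) (use p in \<open>simp add: tau_eq_integral tau_integral_less_l\<close>)
  have "((\<lambda>l. tau l p) \<longlongrightarrow> 1) at_top"
    by (rule Lim_transform_eventually[OF tau_integral_tendsto_l[OF p]])
       (use p in \<open>auto intro!: eventually_mono[OF eventually_ge_at_top[of 1]] simp: tau_eq_integral\<close>)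
  thus "(\<lambda>l. tau l p - 1) \<in> o[at_top](\<lambda>_. 1)"
    by (intro smalloI_tendsto) (auto simp: LIM_zero)
next
  show "strict_mono_on {2..} lambda_star"
  proof (rule monotone_onI)
    fix p q :: nat assume "p \<in> {2..}" "q \<in> {2..}" "p < q"
    hence pq: "p \<ge> 2" "q \<ge> 2" "p < q" by auto
    note lp = lambda_star_root[OF pq(1)]
    \<comment> \<open>The old root is inserted in the larger dimension, where the value has dropped
      below 1/2; as \<open>tau_integral\<close> increases in l, the new root lies further to the
      right.\<close>
    have "tau_integral (lambda_star p) q < 1 / 2"
      using tau_integral_less_p[OF pq(1,3), of "lambda_star p"] lp by simp
    thus "lambda_star p < lambda_star q" by (rule lambda_star_bounds(1)[OF pq(2) lp(1)])
  qed
next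
  fix \<epsilon> :: real assume "\<epsilon> > 0"
  thus "\<forall>\<^sub>F p in sequentially. real p powr (1 / 2 - \<epsilon>) < lambda_star p \<and> lambda_star p < real p powr (1 / 2 + \<epsilon>)"
    by (rule lambda_star_asymp)
next
  obtain C where C: "\<bar>C - 1.634\<bar> < 0.0005" "\<And>D. 0 < D \<Longrightarrow> limit_integral D = 1 / 2 \<longleftrightarrow> D = C"
    by (rule limit_integral_half) blast
  have Cpos: "C > 0" using C(1) unfolding abs_less_iff by simp
  have iff: "(\<lambda>p. tau (D * sqrt (real p)) p) \<longlonglongrightarrow> 1 / 2 \<longleftrightarrow> D = C" if "D > 0" for D
  proof -
    have "(\<lambda>p. tau (D * sqrt (real p)) p) \<longlonglongrightarrow> 1 / 2 \<longleftrightarrow> 1 - limit_integral D = 1 / 2"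
      using tau_scaled_tendsto[OF that] by (metis LIMSEQ_unique)
    thus ?thesis using C(2)[OF that] by auto
  qed
  show "\<exists>!C. C > 0 \<and> (\<lambda>p. tau (C * sqrt (real p)) p) \<longlonglongrightarrow> 1 / 2"
    using iff Cpos by blast
  show "\<bar>D - 1.634\<bar> < 0.0005" if "D > 0 \<and> (\<lambda>p. tau (D * sqrt (real p)) p) \<longlonglongrightarrow> 1 / 2" for D
    using iff[of D] that C(1) by simp
qed

end
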